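(* Let $k$ be an infinite field and $A=k[x_1,\ldots,x_m]/I$ with $I$ a homogeneous ideal, $d=\dim A$. Let $\{\mathcal V_n\}_{n\ge0}$ be the projective varieties in $\mathbb P_k^{md-1}$ associated with $A$ as defined in the context. Let $$y_i=\sum_{j=1}^m\alpha_{ij}x_j,\qquad i=1,\ldots,d,$$ where $\alpha=(\alpha_{ij})\in\mathbb P_k^{md-1}$. Then $k[y_1,\ldots,y_d]\hookrightarrow A$ is a Noether normalization if and only if $\alpha\notin\mathcal V_{br(A)+1}$.
   Context: $A$ is a standard graded $k$-algebra (so $I$ is proper). A reduction of $A$ is an ideal $Q$ generated by linear forms (elements of $A_1$) such that $Q_n=A_n$ for all large $n$. The reduction number $r_Q(A)$ of $A$ with respect to $Q$ is the least $n\ge0$ with $Q_{n+1}=A_{n+1}$. A reduction is minimal if it contains no other reduction (equivalently, it is a reduction generated by $d$ linear forms). The big reduction number is $br(A)=\max\{r_Q(A)\mid Q\text{ a minimal reduction of }A\}$, which is finite. "$k[y_1,\ldots,y_d]\hookrightarrow A$ is a Noether normalization" means that the images of $y_1,\ldots,y_d$ in $A$ are algebraically independent over $k$ and $A$ is a finite module over the subalgebra they generate. Let $R=k[x_1,\ldots,x_m]$, let $u=\{u_{ij}\mid 1\le i\le d,\ 1\le j\le m\}$ be indeterminates and $z_i=\sum_{j=1}^m u_{ij}x_j$. Fix generators $I=(f_1,\ldots,f_v)$ with $f_j$ a form of degree $d_j$. For $n\ge0$, $M_n(u)$ is the matrix with entries in $k[u]$ of the coefficients of the elements $z_ig$ ($g$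 a monomial of $R$ of degree $n-1$) and $f_jh$ ($h$ a monomial of $R$ of degree $n-d_j$), written as linear combinations of the monomials of degree $n$ in $x_1,\ldots,x_m$. With $N=\binom{n+m-1}{m-1}$, $J_n$ is the ideal of $k[u]$ generated by the $N\times N$ minors of $M_n(u)$ ($J_n=0$ if one of the sizes of $M_n(u)$ is less than $N$; in particular $J_0=0$). $\mathcal V_n\subseteq\mathbb P_k^{md-1}$ is the zero locus of $J_n$, i.e. the set of points with coordinates in $k$ at which all elements of $J_n$ vanish. *)

theory Defs
  imports
    "HOL-Algebra.QuotRing"
    "Jordan_Normal_Form.Determinant"
    "HOL-Library.Extended_Nat"
    "HOL-Library.Poly_Mapping"
begin

section \<open>Polynomial rings\<close>

text \<open>
  A monomial is a finitely supported exponent function, a polynomial a finitely supported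
  function from monomials to coefficients.  A set \<open>X\<close> of variables cuts out the polynomial
  ring in these variables; the whole type is the ring in all variables of type \<open>'v\<close>.
\<close>

type_synonym 'v monom = "'v \<Rightarrow>\<^sub>0 nat"
type_synonym ('v, 'k) mpoly = "'v monom \<Rightarrow>\<^sub>0 'k"

definition mpoly_ring :: "'v set \<Rightarrow> ('v, 'k::comm_ring_1) mpoly ring" where
  "mpoly_ring X =
     \<lparr>carrier = {p. \<forall>t\<in>Poly_Mapping.keys p. Poly_Mapping.keys t \<subseteq> X},
      monoid.mult = (*), one = 1, zero = 0, add = (+)\<rparr>"

definition mpoly_const :: "'k \<Rightarrow> ('v, 'k::comm_ring_1) mpoly" where
  "mpoly_const c = Poly_Mapping.single 0 c"

definition mpoly_var :: "'v \<Rightarrow> ('v, 'k::comm_ring_1) mpoly" where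
  "mpoly_var x = Poly_Mapping.single (Poly_Mapping.single x 1) 1"

definition mpoly_mono :: "'v monom \<Rightarrow> ('v, 'k::comm_ring_1) mpoly" where
  "mpoly_mono t = Poly_Mapping.single t 1"

definition mdeg :: "'v monom \<Rightarrow> nat" where
  "mdeg t = (\<Sum>x\<in>Poly_Mapping.keys t. Poly_Mapping.lookup t x)"

definition monomials :: "'v set \<Rightarrow> nat \<Rightarrow> 'v monom set" where
  "monomials X n = {t. Poly_Mapping.keys t \<subseteq> X \<and> mdeg t = n}"

text \<open>The forms of degree \<open>n\<close>, including \<open>0\<close>.\<close>

definition forms :: "'v set \<Rightarrow> nat \<Rightarrow> ('v, 'k::comm_ring_1) mpoly set" where
  "forms X n = {p. Poly_Mapping.keys p \<subseteq> monomials X n}"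

definition eval_at :: "('v \<Rightarrow> 'k) \<Rightarrow> ('v, 'k::comm_ring_1) mpoly \<Rightarrow> 'k" where
  "eval_at a p =
    (\<Sum>t\<in>Poly_Mapping.keys p. Poly_Mapping.lookup p t *
       (\<Prod>x\<in>Poly_Mapping.keys t. a x ^ Poly_Mapping.lookup t x))"

text \<open>
  The value of a polynomial at elements \<open>a x\<close> of a ring \<open>S\<close> that is a \<open>'k\<close>-algebra via \<open>\<phi>\<close>.
\<close>

definition eval_in ::
    "('a, 'b) ring_scheme \<Rightarrow> ('k \<Rightarrow> 'a) \<Rightarrow> ('v \<Rightarrow> 'a) \<Rightarrow> ('v, 'k::comm_ring_1) mpoly \<Rightarrow> 'a" where
  "eval_in S \<phi> a p =
     (\<Oplus>\<^bsub>S\<^esub>t\<in>Poly_Mapping.keys p. \<phi> (Poly_Mapping.lookup p t) \<otimes>\<^bsub>S\<^esub>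
       (\<Otimes>\<^bsub>S\<^esub>x\<in>Poly_Mapping.keys t. a x [^]\<^bsub>S\<^esub> Poly_Mapping.lookup t x))"

lemma mpoly_ring_cring: "cring (mpoly_ring X :: ('v, 'k::comm_ring_1) mpoly ring)"
proof -
  let ?R = "mpoly_ring X :: ('v, 'k) mpoly ring"
  have add: "p + q \<in> carrier ?R" if "p \<in> carrier ?R" "q \<in> carrier ?R" for p q
    using that keys_add[of p q] by (auto simp: mpoly_ring_def)
  have mult: "p * q \<in> carrier ?R" if "p \<in> carrier ?R" "q \<in> carrier ?R" for p q
  proof -
    have "Poly_Mapping.keys t \<subseteq> X" if t: "t \<in> Poly_Mapping.keys (p * q)" for t
    proof -
      obtain a b where ab: "t = a + b" "a \<in> Poly_Mapping.keys p" "b \<in> Poly_Mapping.keys q"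
        using t keys_mult[of p q] by blast
      have "Poly_Mapping.keys a \<subseteq> X" "Poly_Mapping.keys b \<subseteq> X"
        using ab that \<open>p \<in> carrier ?R\<close> \<open>q \<in> carrier ?R\<close> by (simp_all add: mpoly_ring_def)
      then show ?thesis
        using keys_add[of a b] ab(1) by blast
    qed
    then show ?thesis by (simp add: mpoly_ring_def)
  qed
  have uminus: "- p \<in> carrier ?R" if "p \<in> carrier ?R" for p
    using that by (simp add: mpoly_ring_def)
  have one: "1 \<in> carrier ?R"
    by (simp add: mpoly_ring_def flip: single_one)
  have ops: "x \<oplus>\<^bsub>?R\<^esub> y = x + y" "x \<otimes>\<^bsub>?R\<^esub> y = x * y" "\<zero>\<^bsub>?R\<^esub> = 0" "\<one>\<^bsub>?R\<^esub> = 1" for x y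
    by (simp_all add: mpoly_ring_def)
  have zero: "0 \<in> carrier ?R"
    by (simp add: mpoly_ring_def)
  have neg: "\<exists>q\<in>carrier ?R. p + q = 0" if "p \<in> carrier ?R" for p
    using uminus[OF that] by (intro bexI[of _ "- p"]) simp_all
  show ?thesis
  proof (rule cringI)
    show "abelian_group ?R"
      by (rule abelian_groupI) (simp_all only: ops add zero neg ac_simps add_0_left add_0_right)
    show "Group.comm_monoid ?R"
      by (rule Group.comm_monoidI) (simp_all only: ops mult one ac_simps mult_1_left mult_1_right)
  qed (simp_all only: ops distrib_right)
qed

section \<open>Krull dimension and Noether normalizations\<close>

text \<open>
  Supremum of the lengths of chains of prime ideals (only meant for nonzero rings).
\<close>

definition krull_dim :: "('a, 'b) ring_scheme \<Rightarrow> enat" where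
  "krull_dim S = Sup {enat n | n.
     \<exists>\<pp>. (\<forall>i\<le>n. primeideal (\<pp> i) S) \<and> (\<forall>i<n. \<pp> i \<subset> \<pp> (Suc i))}"

definition alg_independent ::
    "('a, 'b) ring_scheme \<Rightarrow> ('k::comm_ring_1 \<Rightarrow> 'a) \<Rightarrow> 'v set \<Rightarrow> ('v \<Rightarrow> 'a) \<Rightarrow> bool" where
  "alg_independent S \<phi> X a \<longleftrightarrow> inj_on (eval_in S \<phi> a) (carrier (mpoly_ring X))"

definition generated_subalgebra ::
    "('a, 'b) ring_scheme \<Rightarrow> ('k::comm_ring_1 \<Rightarrow> 'a) \<Rightarrow> 'v set \<Rightarrow> ('v \<Rightarrow> 'a) \<Rightarrow> 'a set" where
  "generated_subalgebra S \<phi> X a = eval_in S \<phi> a ` carrier (mpoly_ring X)"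

definition finite_module_over :: "('a, 'b) ring_scheme \<Rightarrow> 'a set \<Rightarrow> bool" where
  "finite_module_over S B \<longleftrightarrow> (\<exists>G. finite G \<and> G \<subseteq> carrier S \<and>
     (\<forall>s\<in>carrier S. \<exists>c. (\<forall>g\<in>G. c g \<in> B) \<and> s = (\<Oplus>\<^bsub>S\<^esub>g\<in>G. c g \<otimes>\<^bsub>S\<^esub> g)))"

definition noether_normalization ::
    "('a, 'b) ring_scheme \<Rightarrow> ('k::comm_ring_1 \<Rightarrow> 'a) \<Rightarrow> 'v set \<Rightarrow> ('v \<Rightarrow> 'a) \<Rightarrow> bool" where
  "noether_normalization S \<phi> X a \<longleftrightarrow>
     alg_independent S \<phi> X a \<and> finite_module_over S (generated_subalgebra S \<phi> X a)"

section \<open>The graded algebra \<open>A = k[x\<^sub>1,\<dots>,x\<^sub>m]/I\<close> and its reductions\<close>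

abbreviation x_ring :: "nat \<Rightarrow> (nat, 'k::comm_ring_1) mpoly ring" where
  "x_ring m \<equiv> mpoly_ring {1..m}"

definition homogeneous_ideal :: "nat \<Rightarrow> (nat, 'k::comm_ring_1) mpoly set \<Rightarrow> bool" where
  "homogeneous_ideal m I \<longleftrightarrow>
     ideal I (x_ring m) \<and> I = genideal (x_ring m) (I \<inter> (\<Union>n. forms {1..m} n))"

definition quot_alg ::
    "nat \<Rightarrow> (nat, 'k::comm_ring_1) mpoly set \<Rightarrow> (nat, 'k) mpoly set ring" where
  "quot_alg m I = x_ring m Quot I"

definition residue_class :: "nat \<Rightarrow> (nat, 'k::comm_ring_1) mpoly set \<Rightarrow>
    (nat, 'k) mpoly \<Rightarrow> (nat, 'k) mpoly set" where
  "residue_class m I p = I +>\<^bsub>x_ring m\<^esub> p"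

definition graded_part :: "nat \<Rightarrow> (nat, 'k::comm_ring_1) mpoly set \<Rightarrow>
    nat \<Rightarrow> (nat, 'k) mpoly set set" where
  "graded_part m I n = residue_class m I ` forms {1..m} n"

text \<open>For an ideal \<open>Q\<close> of \<open>A\<close>, the degree \<open>n\<close> part is \<open>Q\<^sub>n = Q \<inter> A\<^sub>n\<close>.\<close>

definition is_reduction :: "nat \<Rightarrow> (nat, 'k::comm_ring_1) mpoly set \<Rightarrow>
    (nat, 'k) mpoly set set \<Rightarrow> bool" where
  "is_reduction m I Q \<longleftrightarrow>
     (\<exists>L \<subseteq> graded_part m I 1. Q = genideal (quot_alg m I) L) \<and>
     (\<exists>n0. \<forall>n\<ge>n0. Q \<inter> graded_part m I n = graded_part m I n)"

definition reduction_number :: "nat \<Rightarrow> (nat, 'k::comm_ring_1) mpoly set \<Rightarrow>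
    (nat, 'k) mpoly set set \<Rightarrow> nat" where
  "reduction_number m I Q =
     (LEAST n. Q \<inter> graded_part m I (n + 1) = graded_part m I (n + 1))"

definition is_minimal_reduction :: "nat \<Rightarrow> (nat, 'k::comm_ring_1) mpoly set \<Rightarrow>
    (nat, 'k) mpoly set set \<Rightarrow> bool" where
  "is_minimal_reduction m I Q \<longleftrightarrow>
     is_reduction m I Q \<and> (\<forall>Q'. is_reduction m I Q' \<and> Q' \<subseteq> Q \<longrightarrow> Q' = Q)"

definition big_reduction_number :: "nat \<Rightarrow> (nat, 'k::comm_ring_1) mpoly set \<Rightarrow> nat" where
  "big_reduction_number m I = Max {reduction_number m I Q | Q. is_minimal_reduction m I Q}"

section \<open>The matrices \<open>M\<^sub>n(u)\<close> and the varieties \<open>V\<^sub>n\<close>\<close>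

text \<open>The index set of the indeterminates \<open>u\<^sub>i\<^sub>j\<close>.\<close>

abbreviation u_index :: "nat \<Rightarrow> nat \<Rightarrow> (nat \<times> nat) set" where
  "u_index d m \<equiv> {1..d} \<times> {1..m}"

abbreviation u_ring :: "nat \<Rightarrow> nat \<Rightarrow> (nat \<times> nat, 'k::comm_ring_1) mpoly ring" where
  "u_ring d m \<equiv> mpoly_ring (u_index d m)"

text \<open>
  Elements of \<open>k[u][x\<^sub>1,\<dots>,x\<^sub>m]\<close> are polynomials in \<open>x\<close> with coefficients that are polynomials
  in \<open>u\<close>.
\<close>

definition generic_form :: "nat \<Rightarrow> nat \<Rightarrow> (nat, (nat \<times> nat, 'k::comm_ring_1) mpoly) mpoly" where
  "generic_form m i = (\<Sum>j = 1..m. mpoly_const (mpoly_var (i, j)) * mpoly_var j)"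

definition lift_coeffs ::
    "(nat, 'k::comm_ring_1) mpoly \<Rightarrow> (nat, (nat \<times> nat, 'k) mpoly) mpoly" where
  "lift_coeffs p = Poly_Mapping.map mpoly_const p"

text \<open>
  The row \<open>Inl (i, g)\<close> belongs to the element \<open>z\<^sub>i g\<close>, the row \<open>Inr (j, h)\<close> to the element
  \<open>f\<^sub>j h\<close>; columns are the monomials of degree \<open>n\<close>.  Since rows and columns carry no order,
  a minor is determined only up to sign, which does not affect the ideal generated by the minors.
\<close>

type_synonym row_index = "(nat \<times> nat monom) + (nat \<times> nat monom)"

definition M_rows :: "nat \<Rightarrow> nat \<Rightarrow> nat \<Rightarrow> (nat \<Rightarrow> nat) \<Rightarrow> nat \<Rightarrow> row_index set" where
  "M_rows m d v e n =
     {Inl (i, g) | i g. i \<in> {1..d} \<and> 1 \<le> n \<and> g \<in> monomials {1..m} (n - 1)} \<union>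
     {Inr (j, h) | j h. j \<in> {1..v} \<and> e j \<le> n \<and> h \<in> monomials {1..m} (n - e j)}"

fun M_entry :: "nat \<Rightarrow> (nat \<Rightarrow> (nat, 'k::comm_ring_1) mpoly) \<Rightarrow> row_index \<Rightarrow> nat monom \<Rightarrow>
    (nat \<times> nat, 'k) mpoly" where
  "M_entry m f (Inl (i, g)) t = Poly_Mapping.lookup (generic_form m i * mpoly_mono g) t"
| "M_entry m f (Inr (j, h)) t = Poly_Mapping.lookup (lift_coeffs (f j) * mpoly_mono h) t"

definition matrix_minors :: "nat \<Rightarrow> 'r set \<Rightarrow> 'c set \<Rightarrow> ('r \<Rightarrow> 'c \<Rightarrow> 'a::comm_ring_1) \<Rightarrow> 'a set" where
  "matrix_minors N Rs Cs M =
     {Determinant.det (mat N N (\<lambda>(a, b). M (\<rho> a) (\<gamma> b))) | \<rho> \<gamma>.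
        inj_on \<rho> {..<N} \<and> \<rho> ` {..<N} \<subseteq> Rs \<and> inj_on \<gamma> {..<N} \<and> \<gamma> ` {..<N} \<subseteq> Cs}"

definition J_ideal :: "nat \<Rightarrow> nat \<Rightarrow> nat \<Rightarrow> (nat \<Rightarrow> nat) \<Rightarrow> (nat \<Rightarrow> (nat, 'k::comm_ring_1) mpoly) \<Rightarrow>
    nat \<Rightarrow> (nat \<times> nat, 'k) mpoly set" where
  "J_ideal m d v e f n = genideal (u_ring d m)
     (matrix_minors ((n + m - 1) choose (m - 1)) (M_rows m d v e n)
       (monomials {1..m} n) (M_entry m f))"

text \<open>
  The \<open>k\<close>-rational points of the projective space with homogeneous coordinates indexed by a
  set \<open>X\<close>: classes of nonzero coordinate vectors (extended by \<open>0\<close> outside \<open>X\<close>) modulo scaling.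
  There are no points if \<open>X\<close> is empty.
\<close>

definition coord_vectors :: "'v set \<Rightarrow> ('v \<Rightarrow> 'k::field) set" where
  "coord_vectors X = {a. (\<forall>x. x \<notin> X \<longrightarrow> a x = 0) \<and> (\<exists>x\<in>X. a x \<noteq> 0)}"

definition proportional :: "'v set \<Rightarrow> (('v \<Rightarrow> 'k::field) \<times> ('v \<Rightarrow> 'k)) set" where
  "proportional X = {(a, b). a \<in> coord_vectors X \<and> b \<in> coord_vectors X \<and>
     (\<exists>c. c \<noteq> 0 \<and> b = (\<lambda>x. c * a x))}"

definition proj_space :: "'v set \<Rightarrow> ('v \<Rightarrow> 'k::field) set set" where
  "proj_space X = coord_vectors X // proportional X"

definition V_variety :: "nat \<Rightarrow> nat \<Rightarrow> nat \<Rightarrow> (nat \<Rightarrow> nat) \<Rightarrow> (nat \<Rightarrow> (nat, 'k::field) mpoly) \<Rightarrow>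
    nat \<Rightarrow> (nat \<times> nat \<Rightarrow> 'k) set set" where
  "V_variety m d v e f n =
     {P \<in> proj_space (u_index d m). \<forall>\<alpha>\<in>P. \<forall>F\<in>J_ideal m d v e f n. eval_at \<alpha> F = 0}"

definition linear_form :: "nat \<Rightarrow> (nat \<times> nat \<Rightarrow> 'k::comm_ring_1) \<Rightarrow> nat \<Rightarrow> (nat, 'k) mpoly" where
  "linear_form m \<alpha> i = (\<Sum>j = 1..m. mpoly_const (\<alpha> (i, j)) * mpoly_var j)"

end

theory Submission
  imports Defs "HOL-Library.Product_Lexorder"
begin

text \<open>
  Let \<open>Q\<close> be the ideal of \<open>A\<close> generated by the linear forms \<open>y\<^sub>1,\<dots>,y\<^sub>d\<close>.  By the graded Nakayama
  argument \<open>A\<close> is finite over \<open>k[y]\<close> iff \<open>Q\<^sub>n = A\<^sub>n\<close> for some \<open>n\<close>, and for a given \<open>n \<ge> 1\<close> the latter says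
  that the specialised matrix \<open>M\<^sub>n(\<alpha>)\<close> has full rank, i.e. that \<open>J\<^sub>n\<close> does not vanish at \<open>\<alpha>\<close>.

  A chain of \<open>d\<close> strict inclusions of primes gives \<open>d\<close> algebraically independent elements of \<open>A\<close>.
  If \<open>A\<close> is finite over \<open>k[y]\<close> and \<open>y\<^sub>1,\<dots>,y\<^sub>d\<close> satisfied a relation, then \<open>A\<close> in degrees
  up to \<open>N\<close> would have dimension \<open>O(N\<^bsup>d-1\<^esup>)\<close>, which leaves no room for the monomials in those
  elements.  So finiteness implies independence, and it also implies that \<open>Q\<close> is a
  minimal reduction, since a smaller reduction would be generated by fewer linear forms.

  Finally, the reduction numbers of all reductions are bounded, so that \<open>br(A)\<close> really is an upper
  bound: every reduction is generated by \<open>m\<close> linear forms, and the zero loci of the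
  \<open>J\<^sub>n\<close> formed with \<open>m\<close> generic linear forms decrease, hence stabilise.
\<close>

section \<open>Linear systems\<close>

text \<open>The Krull dimension enters only as the existence of \<open>d\<close> algebraically
  independent elements. One counting lemma, \<open>covers_alg_independent\<close>, then yields both
  the independence of \<open>y\<close> and the minimality of \<open>(y)\<close>. It applies to
  arbitrary linear forms, zero included, which is why it can refute a family padded by zeros. The
  obstacle is \<open>br(A)\<close>: \<open>Max\<close> of an infinite set carries no information, so
  a uniform bound on reduction numbers must come before any use of \<open>br(A) + 1\<close>. That
  bound does not go through the number of generators of a minimal reduction. All reductions are
  parametrised by \<open>m\<close> linear forms, so that one space of coefficients carries them all.
  The loci consist of \<open>k\<close>-points, and \<open>k\<close> may fail to be algebraically
  closed; stabilisation is therefore proved with points and polynomials separating them. The shift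
  by one has its origin in the definition of \<open>r_Q(A)\<close>, the least \<open>n\<close> with
  \<open>Q_{n+1} = A_{n+1}\<close>; it also keeps all degrees in question positive, where the rank
  criterion for \<open>M_n\<close> is available.\<close>

lemma underdetermined_system:
  fixes c :: "'t \<Rightarrow> 's \<Rightarrow> 'k::field"
  assumes "finite S" "finite T" "card T < card S"
  shows "\<exists>l. (\<exists>s\<in>S. l s \<noteq> 0) \<and> (\<forall>t\<in>T. (\<Sum>s\<in>S. l s * c t s) = 0)"
  using assms(2,1,3)
proof (induction T arbitrary: S c rule: finite_induct)
  case empty
  then have "S \<noteq> {}" by auto
  then show ?case by (intro exI[of _ "\<lambda>_. 1"]) auto
next
  case (insert t T)
  show ?case
  proof (cases "\<forall>s\<in>S. c t s = 0")
    case True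
    then have z: "(\<Sum>s\<in>S. l s * c t s) = 0" for l by simp
    have "card T < card S" using insert by simp
    from insert.IH[OF insert.prems(1) this, of c] z show ?thesis by auto
  next
    case False
    then obtain s0 where s0: "s0 \<in> S" "c t s0 \<noteq> 0" by blast
    let ?S = "S - {s0}"
    \<comment> \<open>Equation \<open>t\<close> eliminates the unknown \<open>s0\<close> from the
      others; afterwards the value at \<open>s0\<close> is chosen so that \<open>t\<close> itself
      holds.\<close>
    let ?c = "\<lambda>t' s. c t' s - c t' s0 / c t s0 * c t s"
    have "card T < card ?S" using insert s0 by (simp add: card_Diff_singleton)
    from insert.IH[of ?S ?c, OF _ this] insert.prems obtain l
      where l: "\<exists>s\<in>?S. l s \<noteq> 0" "\<And>t'. t' \<in> T \<Longrightarrow> (\<Sum>s\<in>?S. l s * ?c t' s) = 0" by auto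
    define r where "r = (\<Sum>s\<in>?S. l s * c t s)"
    define l' where "l' = l(s0 := - r / c t s0)"
    have sumS: "(\<Sum>s\<in>S. l' s * c t' s) = - r / c t s0 * c t' s0 + (\<Sum>s\<in>?S. l s * c t' s)" for t'
      unfolding sum.remove[OF insert.prems(1) s0(1)] by (auto simp: l'_def intro!: sum.cong)
    have "(\<Sum>s\<in>S. l' s * c t' s) = 0" if "t' \<in> insert t T" for t'
    proof (cases "t' = t")
      case True
      then show ?thesis using s0 by (simp add: sumS r_def)
    next
      case False
      then have "(\<Sum>s\<in>?S. l s * ?c t' s) = 0" using l that by blast
      moreover have "(\<Sum>s\<in>?S. l s * ?c t' s) = (\<Sum>s\<in>?S. l s * c t' s) - c t' s0 / c t s0 * r"
        by (simp add: r_def algebra_simps sum_subtractf sum_distrib_left)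
      ultimately show ?thesis by (simp add: sumS)
    qed
    moreover have "\<exists>s\<in>S. l' s \<noteq> 0" using l(1) by (auto simp: l'_def)
    ultimately show ?thesis by blast
  qed
qed

text \<open>Row rank is at most the number of columns: a pivot row with a nonzero entry in column
  \<open>s\<close> joins \<open>R0\<close> and clears that column from all other rows, so each
  column costs at most one row. The selected rows have the same kernel as the whole matrix; they
  later supply the rows of a nonvanishing minor.\<close>

lemma select_rows:
  fixes w :: "'r \<Rightarrow> 's \<Rightarrow> 'k::field"
  assumes "finite S"
  shows "\<exists>R0\<subseteq>Rs. finite R0 \<and> card R0 \<le> card S \<and>
    (\<forall>l. (\<forall>r\<in>R0. (\<Sum>s\<in>S. l s * w r s) = 0) \<longrightarrow> (\<forall>r\<in>Rs. (\<Sum>s\<in>S. l s * w r s) = 0))"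
  using assms
proof (induction S arbitrary: w rule: finite_induct)
  case empty
  then show ?case by (intro exI[of _ "{}"]) auto
next
  case (insert s S)
  show ?case
  proof (cases "\<forall>r\<in>Rs. w r s = 0")
    case True
    from insert.IH[of w] obtain R0 where R0: "R0 \<subseteq> Rs" "finite R0" "card R0 \<le> card S"
      "\<And>l. \<forall>r\<in>R0. (\<Sum>s\<in>S. l s * w r s) = 0 \<Longrightarrow> \<forall>r\<in>Rs. (\<Sum>s\<in>S. l s * w r s) = 0" by blast
    have *: "(\<Sum>s\<in>insert s S. l s * w r s) = (\<Sum>s\<in>S. l s * w r s)" if "r \<in> Rs" for l r
      using insert.hyps True that by simp
    show ?thesis
    proof (intro exI[of _ R0] conjI allI impI ballI)
      show "card R0 \<le> card (insert s S)" using R0 insert.hyps by simp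
      fix l r assume l: "\<forall>r\<in>R0. (\<Sum>s\<in>insert s S. l s * w r s) = 0" and "r \<in> Rs"
      have "\<forall>r\<in>R0. (\<Sum>s\<in>S. l s * w r s) = 0" using l * R0(1) by fastforce
      then show "(\<Sum>s\<in>insert s S. l s * w r s) = 0" using R0(4) *[OF \<open>r \<in> Rs\<close>] \<open>r \<in> Rs\<close> by metis
    qed (use R0 in auto)
  next
    case False
    then obtain r0 where r0: "r0 \<in> Rs" "w r0 s \<noteq> 0" by blast
    let ?w = "\<lambda>r s'. w r s' - w r s / w r0 s * w r0 s'"
    from insert.IH[of ?w] obtain R0 where R0: "R0 \<subseteq> Rs" "finite R0" "card R0 \<le> card S"
      "\<And>l. \<forall>r\<in>R0. (\<Sum>s\<in>S. l s * ?w r s) = 0 \<Longrightarrow> \<forall>r\<in>Rs. (\<Sum>s\<in>S. l s * ?w r s) = 0" by blast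
    \<comment> \<open>For \<open>l\<close> in the kernel of the pivot row, clearing column
      \<open>s\<close> does not change the value of a row on \<open>l\<close>.\<close>
    have *: "(\<Sum>s'\<in>S. l s' * ?w r s') = (\<Sum>s\<in>insert s S. l s * w r s)"
      if "(\<Sum>s\<in>insert s S. l s * w r0 s) = 0" for l r
    proof -
      have "(\<Sum>s'\<in>S. l s' * ?w r s') =
        (\<Sum>s'\<in>S. l s' * w r s') - w r s / w r0 s * (\<Sum>s'\<in>S. l s' * w r0 s')"
        by (simp add: algebra_simps sum_subtractf sum_distrib_left)
      moreover have "(\<Sum>s'\<in>S. l s' * w r0 s') = - l s * w r0 s"
        using that insert.hyps by (simp add: eq_neg_iff_add_eq_0 add.commute)
      ultimately show ?thesis using insert.hyps r0 by simp
    qed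
    show ?thesis
    proof (intro exI[of _ "insert r0 R0"] conjI allI impI)
      show "insert r0 R0 \<subseteq> Rs" "finite (insert r0 R0)" using R0 r0 by auto
      show "card (insert r0 R0) \<le> card (insert s S)"
        using R0 insert.hyps by (simp add: card_insert_if)
      fix l assume l: "\<forall>r\<in>insert r0 R0. (\<Sum>s\<in>insert s S. l s * w r s) = 0"
      then have "(\<Sum>s\<in>insert s S. l s * w r0 s) = 0" by blast
      note * = *[OF this]
      show "\<forall>r\<in>Rs. (\<Sum>s\<in>insert s S. l s * w r s) = 0"
        using R0(4)[of l] l unfolding * by blast
    qed
  qed
qed

text \<open>The index set \<open>T\<close> of the spanning family records the pivots of an echelon form.\<close>

lemma coordinate_subspace_spanned:
  fixes C :: "('s \<Rightarrow> 'k::field) set"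
  assumes "finite S"
    and zero: "(\<lambda>_. 0) \<in> C"
    and lin: "\<And>u v a. u \<in> C \<Longrightarrow> v \<in> C \<Longrightarrow> (\<lambda>s. u s + a * v s) \<in> C"
    and supp: "\<And>u s. u \<in> C \<Longrightarrow> s \<notin> S \<Longrightarrow> u s = 0"
  shows "\<exists>T\<subseteq>S. \<exists>b. (\<forall>t\<in>T. b t \<in> C) \<and> (\<forall>u\<in>C. \<exists>c. u = (\<lambda>s. \<Sum>t\<in>T. c t * b t s)) \<and>
    (T = S \<longrightarrow> C = {u. \<forall>s. s \<notin> S \<longrightarrow> u s = 0})"
  using assms
proof (induction S arbitrary: C rule: finite_induct)
  case empty
  then have "C = {\<lambda>_. 0}" by fastforce
  then show ?case by (intro exI[of _ "{}"]) auto
next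
  case (insert s S)
  show ?case
  proof (cases "\<forall>u\<in>C. u s = 0")
    case True
    have "\<exists>T\<subseteq>S. \<exists>b. (\<forall>t\<in>T. b t \<in> C) \<and> (\<forall>u\<in>C. \<exists>c. u = (\<lambda>s. \<Sum>t\<in>T. c t * b t s)) \<and>
        (T = S \<longrightarrow> C = {u. \<forall>s. s \<notin> S \<longrightarrow> u s = 0})"
    proof (rule insert.IH)
      fix u s' assume "u \<in> C" "s' \<notin> S"
      then show "u s' = 0" using insert.prems(3)[of u s'] True by (cases "s' = s") auto
    qed (rule insert.prems(1), rule insert.prems(2))
    then obtain T b where T: "T \<subseteq> S" "\<forall>t\<in>T. b t \<in> C"
        "\<forall>u\<in>C. \<exists>c. u = (\<lambda>s. \<Sum>t\<in>T. c t * b t s)" by blast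
    have "T \<noteq> insert s S" using T insert.hyps by blast
    with T show ?thesis by blast
  next
    case False
    then obtain w where w: "w \<in> C" "w s \<noteq> 0" by blast
    let ?C = "{u\<in>C. u s = 0}"
    have "\<exists>T\<subseteq>S. \<exists>b. (\<forall>t\<in>T. b t \<in> ?C) \<and> (\<forall>u\<in>?C. \<exists>c. u = (\<lambda>s. \<Sum>t\<in>T. c t * b t s)) \<and>
        (T = S \<longrightarrow> ?C = {u. \<forall>s. s \<notin> S \<longrightarrow> u s = 0})"
    proof (rule insert.IH)
      fix u s' assume "u \<in> ?C" "s' \<notin> S"
      then show "u s' = 0" using insert.prems(3)[of u s'] by (cases "s' = s") auto
    next
      fix u v a assume "u \<in> ?C" "v \<in> ?C"
      then show "(\<lambda>s. u s + a * v s) \<in> ?C" using insert.prems(2)[of u v a] by simp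
    qed (use insert.prems(1) in simp)
    then obtain T b where T: "T \<subseteq> S" "\<forall>t\<in>T. b t \<in> ?C"
      "\<forall>u\<in>?C. \<exists>c. u = (\<lambda>s. \<Sum>t\<in>T. c t * b t s)"
      "T = S \<longrightarrow> ?C = {u. \<forall>s. s \<notin> S \<longrightarrow> u s = 0}"
      by (elim exE conjE) (rule that)
    have sT: "s \<notin> T" "finite T" using T(1) insert.hyps(2) finite_subset[OF T(1) insert.hyps(1)] by blast+
    let ?b = "b(s := w)"
    \<comment> \<open>Subtracting a multiple of the new basis vector \<open>w\<close> clears
      coordinate \<open>s\<close> and lands in the subspace handled by the induction
      hypothesis.\<close>
    have red: "(\<lambda>s'. u s' + (- (u s / w s)) * w s') \<in> ?C" if "u \<in> C" for u
      using insert.prems(2)[OF that w(1), of "- (u s / w s)"] w by simp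
    have span: "\<exists>c. u = (\<lambda>s'. \<Sum>t\<in>insert s T. c t * ?b t s')" if u: "u \<in> C" for u
    proof -
      from bspec[OF T(3) red[OF u]] obtain c where
        c: "(\<lambda>s'. u s' + (- (u s / w s)) * w s') = (\<lambda>s. \<Sum>t\<in>T. c t * b t s)" by blast
      have "u s' = (\<Sum>t\<in>insert s T. (c(s := u s / w s)) t * ?b t s')" for s'
      proof -
        have "(\<Sum>t\<in>insert s T. (c(s := u s / w s)) t * ?b t s')
            = u s / w s * w s' + (\<Sum>t\<in>T. (c(s := u s / w s)) t * ?b t s')"
          using sT by simp
        also have "(\<Sum>t\<in>T. (c(s := u s / w s)) t * ?b t s') = (\<Sum>t\<in>T. c t * b t s')"
          using sT by (intro sum.cong) auto
        also have "\<dots> = u s' + (- (u s / w s)) * w s'" using fun_cong[OF c, of s'] by simp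
        finally show ?thesis by simp
      qed
      then show ?thesis by blast
    qed
    have full: "C = {u. \<forall>s'. s' \<notin> insert s S \<longrightarrow> u s' = 0}" if eq: "insert s T = insert s S"
    proof -
      have "T = S" using insert_ident[OF sT(1) insert.hyps(2)] eq by blast
      note C = mp[OF T(4) this]
      show ?thesis
      proof (intro equalityI subsetI)
        fix u assume "u \<in> C" then show "u \<in> {u. \<forall>s'. s' \<notin> insert s S \<longrightarrow> u s' = 0}"
          using insert.prems by blast
      next
        fix u :: "'s \<Rightarrow> 'k" assume u: "u \<in> {u. \<forall>s'. s' \<notin> insert s S \<longrightarrow> u s' = 0}"
        have "(\<lambda>s'. u s' + (- (u s / w s)) * w s') \<in> {u. \<forall>s'. s' \<notin> S \<longrightarrow> u s' = 0}"
        proof (intro CollectI allI impI)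
          fix s' assume "s' \<notin> S"
          then show "u s' + (- (u s / w s)) * w s' = 0"
            using u w(2) insert.prems(3)[OF w(1), of s'] by (cases "s' = s") auto
        qed
        then have "(\<lambda>s'. u s' + (- (u s / w s)) * w s') \<in> C" using C by blast
        from insert.prems(2)[OF this w(1), of "u s / w s"] show "u \<in> C" by simp
      qed
    qed
    show ?thesis
      using T(1,2) w(1) span full by (intro exI[of _ "insert s T"] conjI exI[of _ ?b]) auto
  qed
qed

section \<open>Evaluation of polynomials\<close>

lemma mpoly_ring_simps [simp]:
  "monoid.mult (mpoly_ring X) = (*)" "one (mpoly_ring X) = 1"
  "zero (mpoly_ring X) = 0" "add (mpoly_ring X) = (+)"
  by (simp_all add: mpoly_ring_def)

lemma mem_mpoly_ring:
  "p \<in> carrier (mpoly_ring X) \<longleftrightarrow> (\<forall>t\<in>Poly_Mapping.keys p. Poly_Mapping.keys t \<subseteq> X)"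
  by (simp add: mpoly_ring_def)

lemma mpoly_add_closed:
  "p \<in> carrier (mpoly_ring X) \<Longrightarrow> q \<in> carrier (mpoly_ring X) \<Longrightarrow>
    p + q \<in> carrier (mpoly_ring X :: ('v, 'k::comm_ring_1) mpoly ring)"
  using keys_add[of p q] by (auto simp: mem_mpoly_ring)

lemma mpoly_uminus_closed:
  "p \<in> carrier (mpoly_ring X) \<Longrightarrow> - p \<in> carrier (mpoly_ring X)"
  by (simp add: mem_mpoly_ring)

lemma mpoly_diff_closed:
  "p \<in> carrier (mpoly_ring X) \<Longrightarrow> q \<in> carrier (mpoly_ring X) \<Longrightarrow>
    p - q \<in> carrier (mpoly_ring X :: ('v, 'k::comm_ring_1) mpoly ring)"
  using mpoly_add_closed[of p X "- q"] mpoly_uminus_closed[of q X] by simp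

lemma mpoly_mult_closed:
  fixes p q :: "('v, 'k::comm_ring_1) mpoly"
  assumes "p \<in> carrier (mpoly_ring X)" "q \<in> carrier (mpoly_ring X)"
  shows "p * q \<in> carrier (mpoly_ring X)"
proof -
  interpret cring "mpoly_ring X :: ('v, 'k) mpoly ring" by (rule mpoly_ring_cring)
  show ?thesis using m_closed[OF assms] by simp
qed

lemma mpoly_zero_closed: "0 \<in> carrier (mpoly_ring X)"
  by (simp add: mem_mpoly_ring)

lemma mpoly_one_closed: "1 \<in> carrier (mpoly_ring X :: ('v, 'k::comm_ring_1) mpoly ring)"
  by (simp add: mem_mpoly_ring flip: single_one)

lemma mpoly_const_closed: "mpoly_const c \<in> carrier (mpoly_ring X)"
  by (simp add: mem_mpoly_ring mpoly_const_def)

lemma mpoly_var_closed: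
  "x \<in> X \<Longrightarrow> mpoly_var x \<in> carrier (mpoly_ring X :: ('v, 'k::comm_ring_1) mpoly ring)"
  by (simp add: mem_mpoly_ring mpoly_var_def)

lemma mpoly_single_closed:
  "Poly_Mapping.keys t \<subseteq> X \<Longrightarrow> Poly_Mapping.single t c \<in> carrier (mpoly_ring X)"
  by (auto simp: mem_mpoly_ring)

lemma mpoly_mono_closed:
  "Poly_Mapping.keys t \<subseteq> X \<Longrightarrow> mpoly_mono t \<in> carrier (mpoly_ring X :: ('v, 'k::comm_ring_1) mpoly ring)"
  by (auto simp: mem_mpoly_ring mpoly_mono_def)

lemma mpoly_sum_closed:
  "(\<And>i. i \<in> A \<Longrightarrow> p i \<in> carrier (mpoly_ring X)) \<Longrightarrow>
    (\<Sum>i\<in>A. p i) \<in> carrier (mpoly_ring X :: ('v, 'k::comm_ring_1) mpoly ring)"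
  by (induction A rule: infinite_finite_induct) (auto intro: mpoly_add_closed mpoly_zero_closed)

lemma mpoly_prod_closed:
  "(\<And>i. i \<in> A \<Longrightarrow> p i \<in> carrier (mpoly_ring X)) \<Longrightarrow>
    (\<Prod>i\<in>A. p i) \<in> carrier (mpoly_ring X :: ('v, 'k::comm_ring_1) mpoly ring)"
  by (induction A rule: infinite_finite_induct) (auto intro: mpoly_mult_closed mpoly_one_closed)

lemma mpoly_power_closed:
  "p \<in> carrier (mpoly_ring X) \<Longrightarrow>
    p ^ n \<in> carrier (mpoly_ring X :: ('v, 'k::comm_ring_1) mpoly ring)"
  by (induction n) (auto intro: mpoly_mult_closed mpoly_one_closed)

lemmas mpoly_closed = mpoly_add_closed mpoly_uminus_closed mpoly_diff_closed mpoly_mult_closed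
  mpoly_zero_closed mpoly_one_closed mpoly_const_closed mpoly_var_closed mpoly_single_closed
  mpoly_mono_closed mpoly_sum_closed mpoly_prod_closed mpoly_power_closed

lemma poly_mapping_sum_single:
  fixes p :: "'a \<Rightarrow>\<^sub>0 'b::comm_monoid_add"
  shows "p = (\<Sum>t\<in>Poly_Mapping.keys p. Poly_Mapping.single t (Poly_Mapping.lookup p t))"
proof (rule poly_mapping_eqI)
  fix k
  have "Poly_Mapping.lookup (\<Sum>t\<in>Poly_Mapping.keys p. Poly_Mapping.single t (Poly_Mapping.lookup p t)) k
      = (\<Sum>t\<in>Poly_Mapping.keys p. if t = k then Poly_Mapping.lookup p t else 0)"
    unfolding lookup_sum by (intro sum.cong) (auto simp: lookup_single when_def)
  also have "\<dots> = Poly_Mapping.lookup p k" by (simp add: in_keys_iff)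
  finally show "Poly_Mapping.lookup p k =
    Poly_Mapping.lookup (\<Sum>t\<in>Poly_Mapping.keys p. Poly_Mapping.single t (Poly_Mapping.lookup p t)) k" ..
qed

lemma mpoly_mult_single:
  fixes p :: "('v, 'k::comm_ring_1) mpoly"
  shows "p * Poly_Mapping.single g c =
    (\<Sum>u\<in>Poly_Mapping.keys p. Poly_Mapping.single (u + g) (Poly_Mapping.lookup p u * c))"
  by (subst poly_mapping_sum_single[of p]) (simp add: sum_distrib_right mult_single)

lemma lookup_mult_single:
  fixes p :: "('v, 'k::comm_ring_1) mpoly"
  shows "Poly_Mapping.lookup (p * Poly_Mapping.single g c) t =
    (if \<exists>s. t = s + g then Poly_Mapping.lookup p (t - g) * c else 0)"
proof -
  have eq: "Poly_Mapping.lookup (p * Poly_Mapping.single g c) t =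
    (\<Sum>u\<in>Poly_Mapping.keys p. if u + g = t then Poly_Mapping.lookup p u * c else 0)"
    unfolding mpoly_mult_single lookup_sum
    by (intro sum.cong) (auto simp: lookup_single when_def)
  show ?thesis
  proof (cases "\<exists>s. t = s + g")
    case True
    then obtain s where s: "t = s + g" by blast
    have "(\<Sum>u\<in>Poly_Mapping.keys p. if u + g = t then Poly_Mapping.lookup p u * c else 0)
      = (\<Sum>u\<in>Poly_Mapping.keys p. if u = s then Poly_Mapping.lookup p u * c else 0)"
      by (intro sum.cong) (auto simp: s)
    also have "\<dots> = Poly_Mapping.lookup p s * c" by (simp add: in_keys_iff)
    finally show ?thesis using True eq s by simp
  next
    case False
    then show ?thesis unfolding eq by (auto intro!: sum.neutral)
  qed
qed

definition monom_value :: "('v \<Rightarrow> 'b::comm_ring_1) \<Rightarrow> 'v monom \<Rightarrow> 'b" where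
  "monom_value a t = (\<Prod>x\<in>Poly_Mapping.keys t. a x ^ Poly_Mapping.lookup t x)"

text \<open>Both evaluations that occur are instances, with \<open>h\<close> the identity for values
  in \<open>k\<close> and \<open>h = mpoly_const\<close> for substitution of polynomials, so the
  homomorphism laws are proved once. Evaluation in the record ring \<open>quot_alg m I\<close> is
  reduced to \<open>msubst\<close> by \<open>eval_in_res\<close>.\<close>

definition evalg :: "('k \<Rightarrow> 'b::comm_ring_1) \<Rightarrow> ('v \<Rightarrow> 'b) \<Rightarrow> ('v, 'k::comm_ring_1) mpoly \<Rightarrow> 'b" where
  "evalg h a p = (\<Sum>t\<in>Poly_Mapping.keys p. h (Poly_Mapping.lookup p t) * monom_value a t)"

abbreviation msubst :: "('w \<Rightarrow> ('v, 'k::comm_ring_1) mpoly) \<Rightarrow> ('w, 'k) mpoly \<Rightarrow> ('v, 'k) mpoly" where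
  "msubst \<equiv> evalg mpoly_const"

lemma eval_at_eq_evalg: "eval_at a = evalg (\<lambda>c. c) a"
  by (rule ext) (simp add: eval_at_def evalg_def monom_value_def)

lemma monom_value_superset:
  assumes "finite A" "Poly_Mapping.keys t \<subseteq> A"
  shows "monom_value a t = (\<Prod>x\<in>A. a x ^ Poly_Mapping.lookup t x)"
  unfolding monom_value_def using assms
  by (intro prod.mono_neutral_left) (auto simp: in_keys_iff)

lemma monom_value_zero [simp]: "monom_value a 0 = 1"
  by (simp add: monom_value_def)

lemma monom_value_add: "monom_value a (s + t) = monom_value a s * monom_value a t"
proof -
  let ?A = "Poly_Mapping.keys s \<union> Poly_Mapping.keys t"
  have "Poly_Mapping.keys (s + t) \<subseteq> ?A" by (rule keys_add)
  then show ?thesis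
    by (simp add: monom_value_superset[of ?A] lookup_add power_add prod.distrib)
qed

lemma monom_value_single [simp]: "monom_value a (Poly_Mapping.single x n) = a x ^ n"
  by (simp add: monom_value_def)

lemma comm_ring_hom_mpoly_const: "comm_ring_hom (mpoly_const :: 'k::comm_ring_1 \<Rightarrow> ('v, 'k) mpoly)"
  by unfold_locales (simp_all add: mpoly_const_def single_add mult_single)

lemma comm_ring_hom_ident: "comm_ring_hom (\<lambda>c::'k::comm_ring_1. c)"
  by unfold_locales auto

context comm_ring_hom
begin

lemma evalg_superset:
  assumes "finite A" "Poly_Mapping.keys p \<subseteq> A"
  shows "evalg hom a p = (\<Sum>t\<in>A. hom (Poly_Mapping.lookup p t) * monom_value a t)"
  unfolding evalg_def using assms
  by (intro sum.mono_neutral_left) (auto simp: in_keys_iff)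

lemma evalg_add: "evalg hom a (p + q) = evalg hom a p + evalg hom a q"
proof -
  let ?A = "Poly_Mapping.keys p \<union> Poly_Mapping.keys q"
  have "Poly_Mapping.keys (p + q) \<subseteq> ?A" by (rule keys_add)
  then show ?thesis
    by (simp add: evalg_superset[of ?A] lookup_add hom_add distrib_right sum.distrib)
qed

lemma evalg_zero: "evalg hom a 0 = 0"
  by (simp add: evalg_def)

lemma evalg_single: "evalg hom a (Poly_Mapping.single t c) = hom c * monom_value a t"
  by (cases "c = 0") (simp_all add: evalg_def)

lemma evalg_sum: "evalg hom a (\<Sum>i\<in>A. p i) = (\<Sum>i\<in>A. evalg hom a (p i))"
  by (induction A rule: infinite_finite_induct) (simp_all add: evalg_add evalg_zero)

lemma evalg_mult: "evalg hom a (p * q) = evalg hom a p * evalg hom a q"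
proof -
  have 1: "evalg hom a (r * Poly_Mapping.single t c) = evalg hom a r * (hom c * monom_value a t)"
    for r t c
    unfolding mpoly_mult_single
    by (simp add: evalg_sum evalg_single monom_value_add hom_mult evalg_def[of _ _ r]
        sum_distrib_left sum_distrib_right mult_ac)
  have "p * q = (\<Sum>t\<in>Poly_Mapping.keys q. p * Poly_Mapping.single t (Poly_Mapping.lookup q t))"
    by (subst poly_mapping_sum_single[of q]) (simp add: sum_distrib_left)
  then show ?thesis
    by (simp add: evalg_sum 1 evalg_def[of _ _ q] sum_distrib_left)
qed

lemma evalg_comm_ring_hom: "comm_ring_hom (evalg hom a)"
  by unfold_locales
    (simp_all add: evalg_add evalg_zero evalg_mult evalg_single flip: single_one)

end

interpretation msubst: comm_ring_hom "msubst a :: ('w, 'k::comm_ring_1) mpoly \<Rightarrow> ('v, 'k) mpoly"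
  for a by (rule comm_ring_hom.evalg_comm_ring_hom[OF comm_ring_hom_mpoly_const])

interpretation eval_at: comm_ring_hom "eval_at a :: ('v, 'k::comm_ring_1) mpoly \<Rightarrow> 'k"
  for a unfolding eval_at_eq_evalg
  by (rule comm_ring_hom.evalg_comm_ring_hom[OF comm_ring_hom_ident])

lemma msubst_single:
  "msubst a (Poly_Mapping.single t c) = mpoly_const c * monom_value a t"
  by (rule comm_ring_hom.evalg_single[OF comm_ring_hom_mpoly_const])

lemma eval_at_single: "eval_at a (Poly_Mapping.single t c) = c * monom_value a t"
  unfolding eval_at_eq_evalg by (rule comm_ring_hom.evalg_single[OF comm_ring_hom_ident])

lemma msubst_const [simp]: "msubst a (mpoly_const c) = mpoly_const c"
  unfolding mpoly_const_def[of c] msubst_single by (simp add: mpoly_const_def)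

lemma msubst_var [simp]: "msubst a (mpoly_var x) = a x"
  unfolding mpoly_var_def msubst_single by (simp add: mpoly_const_def)

lemma eval_at_const [simp]: "eval_at a (mpoly_const c) = c"
  by (simp add: mpoly_const_def eval_at_single)

lemma eval_at_var [simp]: "eval_at a (mpoly_var x) = a x"
  by (simp add: mpoly_var_def eval_at_single)

lemma monom_value_closed:
  assumes "\<And>x. x \<in> Poly_Mapping.keys t \<Longrightarrow> a x \<in> carrier (mpoly_ring X)"
  shows "monom_value a t \<in> carrier (mpoly_ring X)"
  unfolding monom_value_def using assms by (auto intro!: mpoly_closed)

lemma msubst_closed:
  assumes "\<And>x. x \<in> Y \<Longrightarrow> a x \<in> carrier (mpoly_ring X)" "p \<in> carrier (mpoly_ring Y)"
  shows "msubst a p \<in> carrier (mpoly_ring X)"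
  unfolding evalg_def using assms
  by (intro mpoly_sum_closed mpoly_mult_closed mpoly_const_closed monom_value_closed)
    (auto simp: mem_mpoly_ring)

section \<open>Degrees and homogeneous components\<close>

lemma mdeg_superset:
  assumes "finite A" "Poly_Mapping.keys t \<subseteq> A"
  shows "mdeg t = (\<Sum>x\<in>A. Poly_Mapping.lookup t x)"
  unfolding mdeg_def using assms by (intro sum.mono_neutral_left) (auto simp: in_keys_iff)

lemma mdeg_add: "mdeg (s + t) = mdeg s + mdeg t"
proof -
  let ?A = "Poly_Mapping.keys s \<union> Poly_Mapping.keys t"
  have "Poly_Mapping.keys (s + t) \<subseteq> ?A" by (rule keys_add)
  then show ?thesis by (simp add: mdeg_superset[of ?A] lookup_add sum.distrib)
qed

lemma mdeg_zero [simp]: "mdeg 0 = 0"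
  by (simp add: mdeg_def)

lemma mdeg_single [simp]: "mdeg (Poly_Mapping.single x n) = n"
  by (simp add: mdeg_def)

lemma mdeg_eq_0_iff [simp]: "mdeg t = 0 \<longleftrightarrow> t = 0"
proof
  assume "mdeg t = 0"
  then have "\<forall>x\<in>Poly_Mapping.keys t. Poly_Mapping.lookup t x = 0" by (simp add: mdeg_def)
  then have "\<forall>x. Poly_Mapping.lookup t x = 0" by (auto simp: in_keys_iff)
  then show "t = 0" by (intro poly_mapping_eqI) simp
qed simp

lemma keys_monom_add: "Poly_Mapping.keys (s + t :: 'v monom) = Poly_Mapping.keys s \<union> Poly_Mapping.keys t"
  by (auto simp: in_keys_iff lookup_add)

lemma lookup_le_mdeg: "Poly_Mapping.lookup t x \<le> mdeg t"
proof (cases "x \<in> Poly_Mapping.keys t")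
  case True
  then show ?thesis unfolding mdeg_def by (rule member_le_sum) auto
qed (simp add: in_keys_iff)

lemma forms_iff:
  "p \<in> forms X n \<longleftrightarrow> (\<forall>t\<in>Poly_Mapping.keys p. Poly_Mapping.keys t \<subseteq> X \<and> mdeg t = n)"
  by (auto simp: forms_def monomials_def)

lemma forms_subset_carrier: "forms X n \<subseteq> carrier (mpoly_ring X)"
  by (auto simp: forms_iff mem_mpoly_ring)

lemma forms_zero: "0 \<in> forms X n"
  by (simp add: forms_iff)

lemma forms_add: "p \<in> forms X n \<Longrightarrow> q \<in> forms X n \<Longrightarrow> p + q \<in> forms X n"
  using keys_add[of p q] by (auto simp: forms_iff)

lemma forms_sum: "(\<And>i. i \<in> A \<Longrightarrow> p i \<in> forms X n) \<Longrightarrow> (\<Sum>i\<in>A. p i) \<in> forms X n"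
  by (induction A rule: infinite_finite_induct) (auto intro: forms_add forms_zero)

lemma forms_mult: "p \<in> forms X a \<Longrightarrow> q \<in> forms X b \<Longrightarrow> p * q \<in> forms X (a + b)"
  using keys_mult[of p q] by (fastforce simp: forms_iff keys_monom_add mdeg_add)

lemma forms_const: "mpoly_const c \<in> forms X 0"
  by (simp add: forms_iff mpoly_const_def)

lemma forms_one: "1 \<in> forms X 0"
  by (simp add: forms_iff flip: single_one)

lemma forms_prod:
  "(\<And>i. i \<in> A \<Longrightarrow> p i \<in> forms X (n i)) \<Longrightarrow> (\<Prod>i\<in>A. p i) \<in> forms X (\<Sum>i\<in>A. n i)"
  by (induction A rule: infinite_finite_induct) (auto intro: forms_mult forms_one)

lemma forms_power: "p \<in> forms X a \<Longrightarrow> p ^ n \<in> forms X (a * n)"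
  by (induction n) (auto intro: forms_mult forms_one)

lemma forms_var: "x \<in> X \<Longrightarrow> mpoly_var x \<in> forms X 1"
  by (simp add: forms_iff mpoly_var_def)

lemma forms_mono: "t \<in> monomials X n \<Longrightarrow> mpoly_mono t \<in> forms X n"
  by (simp add: forms_def mpoly_mono_def)

lemma forms_0_const: "p \<in> forms X 0 \<Longrightarrow> p = mpoly_const (Poly_Mapping.lookup p 0)"
  by (rule poly_mapping_eqI) (auto simp: forms_iff mpoly_const_def lookup_single when_def in_keys_iff)

lemma monom_value_forms:
  assumes "\<And>x. x \<in> Poly_Mapping.keys t \<Longrightarrow> a x \<in> forms X 1"
  shows "monom_value a t \<in> forms X (mdeg t)"
  unfolding monom_value_def mdeg_def
  using forms_prod[of "Poly_Mapping.keys t" "\<lambda>x. a x ^ Poly_Mapping.lookup t x" X "Poly_Mapping.lookup t"]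
    forms_power[OF assms] by simp

lemma msubst_forms:
  assumes "\<And>x. x \<in> Y \<Longrightarrow> a x \<in> forms X 1" "p \<in> forms Y n"
  shows "msubst a p \<in> forms X n"
  unfolding evalg_def
proof (rule forms_sum)
  fix t assume "t \<in> Poly_Mapping.keys p"
  then have "Poly_Mapping.keys t \<subseteq> Y" "mdeg t = n" using assms(2) by (auto simp: forms_iff)
  then show "mpoly_const (Poly_Mapping.lookup p t) * monom_value a t \<in> forms X n"
    using forms_mult[OF forms_const monom_value_forms[of t a X]] assms(1) by auto
qed

definition hcomp :: "nat \<Rightarrow> ('v, 'k::comm_ring_1) mpoly \<Rightarrow> ('v, 'k) mpoly" where
  "hcomp n p = Poly_Mapping.mapp (\<lambda>t c. if mdeg t = n then c else 0) p"

lemma lookup_hcomp: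
  "Poly_Mapping.lookup (hcomp n p) t = (if mdeg t = n then Poly_Mapping.lookup p t else 0)"
  by (simp add: hcomp_def lookup_mapp when_def in_keys_iff)

lemma hcomp_add: "hcomp n (p + q) = hcomp n p + hcomp n q"
  by (rule poly_mapping_eqI) (simp add: lookup_hcomp lookup_add)

lemma hcomp_zero [simp]: "hcomp n 0 = 0"
  by (rule poly_mapping_eqI) (simp add: lookup_hcomp)

lemma hcomp_uminus: "hcomp n (- p) = - hcomp n p"
  by (rule poly_mapping_eqI) (simp add: lookup_hcomp)

lemma hcomp_diff: "hcomp n (p - q) = hcomp n p - hcomp n q"
  using hcomp_add[of n p "- q"] by (simp add: hcomp_uminus)

lemma hcomp_sum: "hcomp n (\<Sum>i\<in>A. p i) = (\<Sum>i\<in>A. hcomp n (p i))"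
  by (induction A rule: infinite_finite_induct) (simp_all add: hcomp_add)

lemma hcomp_form:
  assumes "p \<in> forms X j"
  shows "hcomp n p = (if n = j then p else 0)"
  using assms by (intro poly_mapping_eqI) (auto simp: lookup_hcomp forms_iff in_keys_iff)

lemma hcomp_in_forms: "p \<in> carrier (mpoly_ring X) \<Longrightarrow> hcomp n p \<in> forms X n"
  by (auto simp: forms_iff mem_mpoly_ring in_keys_iff lookup_hcomp split: if_splits)

lemma sum_hcomp:
  assumes "finite A" "mdeg ` Poly_Mapping.keys p \<subseteq> A"
  shows "p = (\<Sum>n\<in>A. hcomp n p)"
proof (rule poly_mapping_eqI)
  fix t
  show "Poly_Mapping.lookup p t = Poly_Mapping.lookup (\<Sum>n\<in>A. hcomp n p) t"
    using assms by (auto simp: lookup_sum lookup_hcomp in_keys_iff image_subset_iff)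
qed

text \<open>Multiplication by a form shifts degrees; the case distinction guards against the
  truncated \<open>n - j\<close>. This allows ideals generated by forms to be studied one degree at
  a time.\<close>

lemma hcomp_mult_form:
  fixes p q :: "('v, 'k::comm_ring_1) mpoly"
  assumes q: "q \<in> forms X j"
  shows "hcomp n (q * p) = (if j \<le> n then q * hcomp (n - j) p else 0)"
proof -
  let ?A = "mdeg ` Poly_Mapping.keys p \<union> {n - j}"
  have fin: "finite ?A" by simp
  have q': "q \<in> forms UNIV j" using q by (auto simp: forms_iff)
  have "p = (\<Sum>i\<in>?A. hcomp i p)" by (rule sum_hcomp) auto
  then have "hcomp n (q * p) = hcomp n (q * (\<Sum>i\<in>?A. hcomp i p))" by (rule arg_cong)
  also have "\<dots> = (\<Sum>i\<in>?A. hcomp n (q * hcomp i p))"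
    unfolding sum_distrib_left hcomp_sum ..
  also have "\<dots> = (\<Sum>i\<in>?A. if n = j + i then q * hcomp i p else 0)"
  proof (rule sum.cong)
    fix i
    have "hcomp i p \<in> forms UNIV i" by (rule hcomp_in_forms) (simp add: mem_mpoly_ring)
    from hcomp_form[OF forms_mult[OF q' this]]
    show "hcomp n (q * hcomp i p) = (if n = j + i then q * hcomp i p else 0)" .
  qed simp
  also have "\<dots> = (\<Sum>i\<in>?A. if i = n - j then (if j \<le> n then q * hcomp (n - j) p else 0) else 0)"
    by (intro sum.cong) auto
  also have "\<dots> = (if j \<le> n then q * hcomp (n - j) p else 0)"
    using fin by simp
  finally show ?thesis .
qed

lemma finite_monomials:
  assumes X: "finite X"
  shows "finite (monomials X n)"
proof (rule finite_imageD)
  show "inj_on Poly_Mapping.lookup (monomials X n)"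
    by (simp add: inj_on_def)
  show "finite (Poly_Mapping.lookup ` monomials X n)"
  proof (rule finite_subset)
    show "Poly_Mapping.lookup ` monomials X n \<subseteq>
      {g. \<forall>x. (x \<in> X \<longrightarrow> g x \<in> {..n}) \<and> (x \<notin> X \<longrightarrow> g x = 0)}"
    proof (safe, goal_cases)
      case (1 g t x) then show ?case using lookup_le_mdeg[of t x] by (simp add: monomials_def)
    next
      case (2 g t x) then show ?case by (auto simp: monomials_def in_keys_iff)
    qed
    show "finite {g. \<forall>x. (x \<in> X \<longrightarrow> g x \<in> {..n}) \<and> (x \<notin> X \<longrightarrow> g x = (0::nat))}"
      by (rule finite_set_of_finite_funs) (use X in auto)
  qed
qed

lemma forms_eq_sum:
  assumes "p \<in> forms X n" "finite X"
  shows "p = (\<Sum>t\<in>monomials X n. mpoly_const (Poly_Mapping.lookup p t) * mpoly_mono t)"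
proof -
  have "p = (\<Sum>t\<in>Poly_Mapping.keys p. Poly_Mapping.single t (Poly_Mapping.lookup p t))"
    by (rule poly_mapping_sum_single)
  also have "\<dots> = (\<Sum>t\<in>monomials X n. Poly_Mapping.single t (Poly_Mapping.lookup p t))"
    using assms finite_monomials[OF assms(2)]
    by (intro sum.mono_neutral_left) (auto simp: forms_def in_keys_iff)
  also have "\<dots> = (\<Sum>t\<in>monomials X n. mpoly_const (Poly_Mapping.lookup p t) * mpoly_mono t)"
    by (intro sum.cong) (auto simp: mpoly_const_def mpoly_mono_def mult_single)
  finally show ?thesis .
qed

section \<open>Noetherianity\<close>

lemma nat_seq_mono_subseq:
  fixes f :: "nat \<Rightarrow> nat"
  shows "\<exists>r::nat \<Rightarrow> nat. strict_mono r \<and> (\<forall>i j. i \<le> j \<longrightarrow> f (r i) \<le> f (r j))"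
proof -
  obtain g :: "nat \<Rightarrow> nat" where g: "strict_mono g" "monoseq (\<lambda>n. f (g n))"
    using seq_monosub[of f] by blast
  show ?thesis
  proof (cases "\<forall>i j. i \<le> j \<longrightarrow> f (g i) \<le> f (g j)")
    case True
    show ?thesis by (rule exI[of _ g], rule conjI[OF g(1) True])
  next
    case False
    with g(2) have dec: "\<forall>i j. i \<le> j \<longrightarrow> f (g j) \<le> f (g i)"
      unfolding monoseq_def by (elim disjE) simp_all
    \<comment> \<open>A decreasing sequence of natural numbers is constant from an index of its
      minimum on, so the subsequence starts there.\<close>
    obtain n0 where n0: "\<And>n. f (g n0) \<le> f (g n)"
      using ex_has_least_nat[of "\<lambda>_. True" 0 "\<lambda>n. f (g n)"] by blast
    let ?r = "\<lambda>n. g (n + n0)"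
    have eq: "f (?r n) = f (g n0)" for n
      using n0[of "n + n0"] dec[rule_format, of n0 "n + n0"] by simp
    have "strict_mono ?r" using g(1) by (simp add: strict_mono_def)
    with eq show ?thesis by (intro exI[of _ ?r]) simp
  qed
qed

text \<open>One variable at a time: a further subsequence makes the next exponent monotone and keeps
  the earlier ones monotone.\<close>

lemma monom_seq_mono_subseq:
  fixes t :: "nat \<Rightarrow> 'v monom"
  assumes "finite X"
  shows "\<exists>r::nat \<Rightarrow> nat. strict_mono r \<and> (\<forall>x\<in>X. \<forall>i j. i \<le> j \<longrightarrow>
    Poly_Mapping.lookup (t (r i)) x \<le> Poly_Mapping.lookup (t (r j)) x)"
  using assms
proof (induction X rule: finite_induct)
  case empty
  then show ?case by (intro exI[of _ id]) (simp add: strict_mono_def)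
next
  case (insert x X)
  from insert.IH obtain r :: "nat \<Rightarrow> nat" where r: "strict_mono r"
    "\<forall>x\<in>X. \<forall>i j. i \<le> j \<longrightarrow> Poly_Mapping.lookup (t (r i)) x \<le> Poly_Mapping.lookup (t (r j)) x"
    by (elim exE conjE)
  from nat_seq_mono_subseq[of "\<lambda>i. Poly_Mapping.lookup (t (r i)) x"]
  obtain r' :: "nat \<Rightarrow> nat" where r': "strict_mono r'"
    "\<forall>i j. i \<le> j \<longrightarrow> Poly_Mapping.lookup (t (r (r' i))) x \<le> Poly_Mapping.lookup (t (r (r' j))) x"
    by (elim exE conjE)
  have "strict_mono (r \<circ> r')" using r(1) r'(1) by (rule strict_mono_o)
  moreover have "Poly_Mapping.lookup (t ((r \<circ> r') i)) y \<le> Poly_Mapping.lookup (t ((r \<circ> r') j)) y"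
    if "y \<in> insert x X" "i \<le> j" for y i j
    using that r'(2)[rule_format, of i j] r(2)[rule_format, of y "r' i" "r' j"] strict_mono_less_eq[OF r'(1), of i j] by auto
  ultimately show ?case by (intro exI[of _ "r \<circ> r'"]) (simp add: o_def)
qed

lemma monom_le_imp_add:
  fixes s t :: "'v monom"
  assumes "\<And>x. Poly_Mapping.lookup s x \<le> Poly_Mapping.lookup t x"
  shows "t = s + (t - s)"
  using assms by (intro poly_mapping_eqI) (simp add: lookup_add lookup_minus)

lemma dickson:
  fixes t :: "nat \<Rightarrow> 'v monom"
  assumes "finite X" "\<And>i. Poly_Mapping.keys (t i) \<subseteq> X"
  obtains i j s where "i < j" "t j = t i + s"
proof -
  from monom_seq_mono_subseq[OF assms(1), of t] obtain r :: "nat \<Rightarrow> nat" where r: "strict_mono r"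
    "\<forall>x\<in>X. \<forall>i j. i \<le> j \<longrightarrow> Poly_Mapping.lookup (t (r i)) x \<le> Poly_Mapping.lookup (t (r j)) x"
    by (elim exE conjE)
  have "Poly_Mapping.lookup (t (r 0)) x \<le> Poly_Mapping.lookup (t (r 1)) x" for x
  proof (cases "x \<in> X")
    case False
    then have "Poly_Mapping.lookup (t (r 0)) x = 0" using assms(2)[of "r 0"] by (auto simp: in_keys_iff)
    then show ?thesis by simp
  qed (simp add: r(2))
  from monom_le_imp_add[OF this] have "t (r 1) = t (r 0) + (t (r 1) - t (r 0))" .
  moreover have "r 0 < r 1" using r(1) by (simp add: strict_mono_def)
  ultimately show ?thesis using that by blast
qed

text \<open>The order on finitely supported functions is lexicographic and compatible with addition.
  Exponents are natural numbers, so \<open>0\<close> is its least element, which makes it a monomial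
  order. For the variables \<open>u_ij\<close> the pairs are ordered by
  \<open>Product_Lexorder\<close>.\<close>

lemma monom_zero_le: "0 \<le> (t :: 'v::linorder monom)"
proof (rule ccontr)
  assume "\<not> 0 \<le> t"
  then have "t < 0" by simp
  then have "less_fun (Poly_Mapping.lookup t) (Poly_Mapping.lookup 0)" by (simp add: less_poly_mapping.rep_eq)
  then show False by (simp add: less_fun_def)
qed

lemma monom_le_add: "s \<le> s + (t :: 'v::linorder monom)"
  using add_left_mono[OF monom_zero_le[of t], of s] by simp

text \<open>In a descending chain Dickson's lemma finds a later monomial that is a multiple of an
  earlier one, hence not smaller. Only the smaller member of a pair is confined to \<open>X\<close>,
  so the chain is inspected from its second term on.\<close>

lemma wf_monom_less:
  assumes "finite X"
  shows "wf {(s, t :: 'v::linorder monom). Poly_Mapping.keys s \<subseteq> X \<and> s < t}"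
  unfolding wf_iff_no_infinite_down_chain
proof
  assume "\<exists>f. \<forall>i. (f (Suc i), f i) \<in> {(s, t :: 'v monom). Poly_Mapping.keys s \<subseteq> X \<and> s < t}"
  then obtain f :: "nat \<Rightarrow> 'v monom" where
    f: "\<And>i. Poly_Mapping.keys (f (Suc i)) \<subseteq> X" "\<And>i. f (Suc i) < f i" by blast
  obtain i j s where ij: "i < j" "f (Suc j) = f (Suc i) + s"
    using dickson[of X "\<lambda>i. f (Suc i)"] assms f(1) by blast
  obtain n where n: "j = Suc (i + n)" using less_imp_Suc_add[OF ij(1)] by blast
  have "f (Suc (Suc (i + n))) < f (Suc i)"
    by (induction n) (auto intro: f(2) less_trans)
  then have "f (Suc j) < f (Suc i)" by (simp add: n)
  then show False using ij(2) monom_le_add[of "f (Suc i)" s] by simp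
qed

text \<open>
  Hilbert's basis theorem in geometric form.  The ideals
  \<open>{G. G vanishes at a j for all j > i}\<close> increase strictly with \<open>i\<close>; choosing
  an element with minimal leading monomial in each difference contradicts Dickson's lemma.
\<close>

lemma no_infinite_separating_sequence:
  fixes F :: "nat \<Rightarrow> ('v::linorder, 'k::field) mpoly" and a :: "nat \<Rightarrow> 'v \<Rightarrow> 'k"
  assumes X: "finite X" and F: "\<And>i. F i \<in> carrier (mpoly_ring X)"
    and nz: "\<And>i. eval_at (a i) (F i) \<noteq> 0"
    and van: "\<And>i j. i < j \<Longrightarrow> eval_at (a j) (F i) = 0"
  shows False
proof -
  \<comment> \<open>The difference of two consecutive ideals of the chain: \<open>F i\<close>
    belongs to it.\<close>
  define B where "B i = {G \<in> carrier (mpoly_ring X). (\<forall>j>i. eval_at (a j) G = 0) \<and> eval_at (a i) G \<noteq> 0}" for i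
  define lm where "lm G = Max (Poly_Mapping.keys G)" for G :: "('v, 'k) mpoly"
  have B0: "G \<noteq> 0" if "G \<in> B i" for G i using that by (auto simp: B_def)
  have lm_in: "lm G \<in> Poly_Mapping.keys G" if "G \<noteq> 0" for G
    unfolding lm_def using that by (intro Max_in) auto
  have lm_ge: "t \<le> lm G" if "t \<in> Poly_Mapping.keys G" for G t
    unfolding lm_def using that by simp
  have lm_X: "Poly_Mapping.keys (lm G) \<subseteq> X" if "G \<in> B i" for G i
    using lm_in[OF B0[OF that]] that by (auto simp: B_def mem_mpoly_ring)
  have "\<exists>G\<in>B i. \<forall>H\<in>B i. \<not> lm H < lm G" for i
  proof -
    have "F i \<in> B i" using F nz van by (simp add: B_def)
    from wfE_min[OF wf_monom_less[OF X] imageI[OF this, of lm]]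
    obtain z where "z \<in> lm ` B i"
      "\<And>y. (y, z) \<in> {(s, t). Poly_Mapping.keys s \<subseteq> X \<and> s < t} \<Longrightarrow> y \<notin> lm ` B i" by blast
    then show ?thesis using lm_X by blast
  qed
  then obtain G where G: "\<And>i. G i \<in> B i" "\<And>i H. H \<in> B i \<Longrightarrow> \<not> lm H < lm (G i)" by metis
  obtain i j s where ij: "i < j" "lm (G j) = lm (G i) + s"
    using dickson[of X "\<lambda>i. lm (G i)"] X lm_X[OF G(1)] by blast
  define c where "c = Poly_Mapping.lookup (G j) (lm (G j)) / Poly_Mapping.lookup (G i) (lm (G i))"
  \<comment> \<open>Cancels the leading term of \<open>G j\<close> by a multiple of
    \<open>G i\<close>. As \<open>i < j\<close>, \<open>G i\<close> vanishes at \<open>a j\<close>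
    and at all later points, so \<open>H\<close> stays in \<open>B j\<close> while its leading
    monomial drops.\<close>
  define H where "H = G j - G i * Poly_Mapping.single s c"
  have s: "Poly_Mapping.keys s \<subseteq> X" using lm_X[OF G(1)[of j]] ij(2) by (auto simp: keys_monom_add)
  have lead: "Poly_Mapping.lookup (G i) (lm (G i)) \<noteq> 0"
    using lm_in[OF B0[OF G(1)[of i]]] by (simp add: in_keys_iff)
  have HB: "H \<in> B j"
  proof -
    have "H \<in> carrier (mpoly_ring X)"
      unfolding H_def using G(1)[of i] G(1)[of j] s by (auto simp: B_def intro!: mpoly_closed)
    moreover have "eval_at (a l) (G i) = 0" if "l \<ge> j" for l
      using G(1)[of i] ij(1) that by (simp add: B_def)
    ultimately show ?thesis using G(1)[of j]
      by (simp add: B_def H_def eval_at.hom_minus eval_at.hom_mult)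
  qed
  have "t \<le> lm (G j) \<and> t \<noteq> lm (G j)" if t: "t \<in> Poly_Mapping.keys H" for t
  proof
    have "t \<in> Poly_Mapping.keys (G j) \<or> t \<in> Poly_Mapping.keys (G i * Poly_Mapping.single s c)"
      using t keys_diff[of "G j" "G i * Poly_Mapping.single s c"] by (auto simp: H_def)
    then show "t \<le> lm (G j)"
    proof
      assume "t \<in> Poly_Mapping.keys (G i * Poly_Mapping.single s c)"
      then obtain u where "t = u + s" "u \<in> Poly_Mapping.keys (G i)"
        using keys_mult[of "G i" "Poly_Mapping.single s c"] by (auto split: if_splits)
      then show ?thesis using lm_ge ij(2) by (simp add: add_right_mono)
    qed (rule lm_ge)
    have "Poly_Mapping.lookup H (lm (G j)) = 0"
      using lead by (auto simp: H_def lookup_minus lookup_mult_single ij(2) c_def)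
    then show "t \<noteq> lm (G j)" using t by (auto simp: in_keys_iff)
  qed
  then have "lm H < lm (G j)" using lm_in[OF B0[OF HB]] by (simp add: order_less_le)
  then show False using G(2)[OF HB] by blast
qed

text \<open>Each strict drop from \<open>Z (N k)\<close> to \<open>Z (N (Suc k))\<close> gives a
  point and a polynomial that does not vanish there; all later points lie in
  \<open>Z (N (Suc k))\<close>, so these data form a separating sequence. Inclusions are assumed for
  the loci only, since those between the ideals \<open>J n\<close> would have to be read off from
  minors.\<close>

lemma zero_loci_stabilise:
  fixes Z :: "nat \<Rightarrow> ('v::linorder \<Rightarrow> 'k::field) set" and J :: "nat \<Rightarrow> ('v, 'k) mpoly set"
  assumes X: "finite X" and J: "\<And>n. J n \<subseteq> carrier (mpoly_ring X)"
    and Z: "\<And>n. Z n = {a. \<forall>F\<in>J n. eval_at a F = 0}"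
    and dec: "\<And>n. Z (Suc n) \<subseteq> Z n"
  shows "\<exists>n0. \<forall>n\<ge>n0. Z n = Z n0"
proof (rule ccontr)
  assume contr: "\<not> ?thesis"
  have anti: "Z n \<subseteq> Z m" if "m \<le> n" for m n
    using lift_Suc_antimono_le[of Z m n] dec that by blast
  have "\<exists>n'>n. \<exists>a. a \<in> Z n \<and> a \<notin> Z n'" for n
  proof -
    obtain n' where "n' \<ge> n" "Z n' \<noteq> Z n" using contr by blast
    then show ?thesis using anti[of n n'] by (metis order_le_less subsetI subset_antisym)
  qed
  then obtain g a where g: "\<And>n. g n > n" "\<And>n. a n \<in> Z n" "\<And>n. a n \<notin> Z (g n)" by metis
  define N where "N k = (g ^^ k) 0" for k
  have NS: "N (Suc k) = g (N k)" for k by (simp add: N_def)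
  have "\<exists>F\<in>J (N (Suc k)). eval_at (a (N k)) F \<noteq> 0" for k
    using g(3)[of "N k"] by (auto simp: NS Z)
  then obtain F where F: "\<And>k. F k \<in> J (N (Suc k))" "\<And>k. eval_at (a (N k)) (F k) \<noteq> 0" by metis
  have mono: "strict_mono N" using g(1) by (simp add: strict_mono_Suc_iff NS)
  show False
  proof (rule no_infinite_separating_sequence[OF X, of F "\<lambda>k. a (N k)"])
    show "F i \<in> carrier (mpoly_ring X)" for i using F(1) J by blast
    show "eval_at (a (N i)) (F i) \<noteq> 0" for i by (rule F(2))
    show "eval_at (a (N j)) (F i) = 0" if "i < j" for i j
    proof -
      have "N (Suc i) \<le> N j" using mono that by (simp add: strict_mono_less_eq)
      then have "a (N j) \<in> Z (N (Suc i))" using anti g(2) by blast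
      then show ?thesis using F(1)[of i] by (simp add: Z)
    qed
  qed
qed

declare One_nat_def [simp del]

section \<open>Graded quotients and ideals generated by linear forms\<close>

lemma (in cring) idealI_cring:
  assumes "K \<subseteq> carrier R" "\<zero> \<in> K"
    and "\<And>a b. a \<in> K \<Longrightarrow> b \<in> K \<Longrightarrow> a \<oplus> b \<in> K"
    and mult: "\<And>a x. a \<in> K \<Longrightarrow> x \<in> carrier R \<Longrightarrow> x \<otimes> a \<in> K"
  shows "ideal K R"
proof (rule idealI)
  show "ring R" by (rule ring_axioms)
  show "subgroup K (add_monoid R)"
  proof (rule group.subgroupI)
    show "Group.group (add_monoid R)" by (rule a_group)
    show "K \<subseteq> carrier (add_monoid R)" "K \<noteq> {}" using assms by auto
    fix a b assume a: "a \<in> K" and b: "b \<in> K"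
    show "a \<otimes>\<^bsub>add_monoid R\<^esub> b \<in> K" using assms(3)[OF a b] by simp
    have "\<ominus> a = (\<ominus> \<one>) \<otimes> a" using a assms(1) by (simp add: l_minus subset_iff)
    then show "inv\<^bsub>add_monoid R\<^esub> a \<in> K" using mult[OF a, of "\<ominus> \<one>"] by (simp add: a_inv_def)
  qed
  fix a x assume a: "a \<in> K" and x: "x \<in> carrier R"
  show "x \<otimes> a \<in> K" using mult[OF a x] .
  then show "a \<otimes> x \<in> K" using a x assms(1) m_comm[of a x] by auto
qed

lemma mpoly_ring_a_inv:
  fixes p :: "('v, 'k::comm_ring_1) mpoly"
  assumes "p \<in> carrier (mpoly_ring X)"
  shows "\<ominus>\<^bsub>mpoly_ring X\<^esub> p = - p"
proof -
  interpret cring "mpoly_ring X :: ('v, 'k) mpoly ring" by (rule mpoly_ring_cring)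
  show ?thesis using minus_equality[of "- p" p] assms mpoly_uminus_closed[OF assms] by simp
qed

lemma mpoly_genideal_family:
  fixes f :: "'i \<Rightarrow> ('v, 'k::comm_ring_1) mpoly"
  assumes T: "finite T" and f: "\<And>j. j \<in> T \<Longrightarrow> f j \<in> carrier (mpoly_ring X)"
  shows "genideal (mpoly_ring X) (f ` T) =
    {p. \<exists>q. (\<forall>j. q j \<in> carrier (mpoly_ring X)) \<and> p = (\<Sum>j\<in>T. f j * q j)}" (is "_ = ?K")
proof
  interpret cring "mpoly_ring X :: ('v, 'k) mpoly ring" by (rule mpoly_ring_cring)
  have sub: "f ` T \<subseteq> carrier (mpoly_ring X)" using f by auto
  show "genideal (mpoly_ring X) (f ` T) \<subseteq> ?K"
  proof (rule genideal_minimal)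
    show "ideal ?K (mpoly_ring X)"
    proof (rule idealI_cring)
      show "?K \<subseteq> carrier (mpoly_ring X)" using f by (auto intro!: mpoly_closed)
      show "\<zero>\<^bsub>mpoly_ring X\<^esub> \<in> ?K"
        by (intro CollectI exI[of _ "\<lambda>_. 0"]) (simp add: mpoly_zero_closed)
    next
      fix a b :: "('v, 'k) mpoly" assume "a \<in> ?K" "b \<in> ?K"
      then obtain q r where "\<forall>j. q j \<in> carrier (mpoly_ring X)" "a = (\<Sum>j\<in>T. f j * q j)"
        "\<forall>j. r j \<in> carrier (mpoly_ring X)" "b = (\<Sum>j\<in>T. f j * r j)" by blast
      then show "a \<oplus>\<^bsub>mpoly_ring X\<^esub> b \<in> ?K"
        by (intro CollectI exI[of _ "\<lambda>j. q j + r j"])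
          (simp add: distrib_left sum.distrib mpoly_add_closed)
    next
      fix a x :: "('v, 'k) mpoly" assume "a \<in> ?K" and x: "x \<in> carrier (mpoly_ring X)"
      then obtain q where "\<forall>j. q j \<in> carrier (mpoly_ring X)" "a = (\<Sum>j\<in>T. f j * q j)" by blast
      then show "x \<otimes>\<^bsub>mpoly_ring X\<^esub> a \<in> ?K" using x
        by (intro CollectI exI[of _ "\<lambda>j. x * q j"])
          (simp add: sum_distrib_left mult_ac mpoly_mult_closed)
    qed
    show "f ` T \<subseteq> ?K"
    proof
      fix p assume "p \<in> f ` T"
      then obtain i where i: "i \<in> T" "p = f i" by blast
      have "p = (\<Sum>j\<in>T. f j * (if j = i then 1 else 0))"
        using T i by (simp add: if_distrib cong: if_cong)
      then show "p \<in> ?K"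
        by (intro CollectI exI[of _ "\<lambda>j. if j = i then 1 else 0"])
          (simp add: mpoly_one_closed mpoly_zero_closed)
    qed
  qed
  show "?K \<subseteq> genideal (mpoly_ring X) (f ` T)"
  proof
    fix p assume "p \<in> ?K"
    then obtain q where q: "\<forall>j. q j \<in> carrier (mpoly_ring X)" and p: "p = (\<Sum>j\<in>T. f j * q j)" by blast
    interpret K: ideal "genideal (mpoly_ring X) (f ` T)" "mpoly_ring X"
      by (rule genideal_ideal[OF sub])
    have "(\<Sum>j\<in>S. f j * q j) \<in> genideal (mpoly_ring X) (f ` T)" if "S \<subseteq> T" for S
      using finite_subset[OF that T] that
    proof (induction S rule: finite_induct)
      case empty
      then show ?case using K.zero_closed by simp
    next
      case (insert j S)
      have "f j \<in> genideal (mpoly_ring X) (f ` T)" using insert.prems genideal_self[OF sub] by auto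
      then have "f j * q j \<in> genideal (mpoly_ring X) (f ` T)"
        using K.I_r_closed[of "f j" "q j"] q by simp
      then show ?case using insert K.a_closed[of "f j * q j" "\<Sum>j\<in>S. f j * q j"] by simp
    qed
    then show "p \<in> genideal (mpoly_ring X) (f ` T)" using p by blast
  qed
qed

lemma mpoly_mono_add: "mpoly_mono (s + t) = mpoly_mono s * (mpoly_mono t :: ('v, 'k::comm_ring_1) mpoly)"
  by (simp add: mpoly_mono_def mult_single)

lemma mpoly_mono_single: "mpoly_mono (Poly_Mapping.single x 1) = mpoly_var x"
  by (simp add: mpoly_mono_def mpoly_var_def)

lemma monomials_Suc_split:
  assumes "t \<in> monomials X (Suc n)"
  obtains x s where "x \<in> X" "s \<in> monomials X n" "t = Poly_Mapping.single x 1 + s"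
proof -
  have "t \<noteq> 0" using assms by (auto simp: monomials_def)
  then obtain x where x: "x \<in> Poly_Mapping.keys t" by fastforce
  then have "Poly_Mapping.lookup t x \<ge> 1" by (simp add: in_keys_iff)
  then have "Poly_Mapping.lookup (Poly_Mapping.single x 1) y \<le> Poly_Mapping.lookup t y" for y
    by (cases "x = y") (simp_all add: lookup_single)
  from monom_le_imp_add[OF this]
  have t: "t = Poly_Mapping.single x 1 + (t - Poly_Mapping.single x 1)" .
  define s where "s = t - Poly_Mapping.single x 1"
  have ts: "t = Poly_Mapping.single x 1 + s" using t by (simp add: s_def)
  have "mdeg t = 1 + mdeg s" "Poly_Mapping.keys t = {x} \<union> Poly_Mapping.keys s"
    unfolding ts by (simp_all add: mdeg_add keys_monom_add)
  then have "s \<in> monomials X n" "x \<in> X" using assms by (auto simp: monomials_def)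
  with ts that show ?thesis by blast
qed

text \<open>The degrees \<open>e\<close> are data because the zero polynomial is a form of every
  degree. Homogeneity of \<open>I\<close> takes the shape of generation by the forms
  \<open>f j\<close>.\<close>

locale homogeneous_presentation =
  fixes m v :: nat and e :: "nat \<Rightarrow> nat" and f :: "nat \<Rightarrow> (nat, 'k::field) mpoly"
    and I :: "(nat, 'k) mpoly set"
  assumes f_forms: "\<And>j. j \<in> {1..v} \<Longrightarrow> f j \<in> forms {1..m} (e j)"
    and I_gen: "I = genideal (x_ring m) (f ` {1..v})"
    and I_proper: "I \<noteq> carrier (x_ring m)"
begin

lemma f_closed: "j \<in> {1..v} \<Longrightarrow> f j \<in> carrier (x_ring m)"
  using f_forms forms_subset_carrier by blast

sublocale R: cring "x_ring m :: (nat, 'k) mpoly ring"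
  by (rule mpoly_ring_cring)

sublocale I: ideal I "x_ring m"
  unfolding I_gen using f_closed by (intro R.genideal_ideal) auto

lemma I_iff: "p \<in> I \<longleftrightarrow> (\<exists>q. (\<forall>j. q j \<in> carrier (x_ring m)) \<and> p = (\<Sum>j\<in>{1..v}. f j * q j))"
  unfolding I_gen by (subst mpoly_genideal_family) (auto intro: f_closed)

lemma I_carr: "p \<in> I \<Longrightarrow> p \<in> carrier (x_ring m)"
  using I.a_subset by blast

lemma I_zero: "0 \<in> I"
  using I.zero_closed by simp

lemma I_add: "p \<in> I \<Longrightarrow> q \<in> I \<Longrightarrow> p + q \<in> I"
  using I.a_closed[of p q] by simp

lemma I_mult: "r \<in> carrier (x_ring m) \<Longrightarrow> p \<in> I \<Longrightarrow> r * p \<in> I"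
  using I.I_l_closed[of p r] by simp

lemma I_sum: "(\<And>i. i \<in> A \<Longrightarrow> p i \<in> I) \<Longrightarrow> (\<Sum>i\<in>A. p i) \<in> I"
  by (induction A rule: infinite_finite_induct) (auto intro: I_add I_zero)

text \<open>Taking components commutes, up to a degree shift, with multiplication by each
  \<open>f j\<close>. This is how homogeneity of \<open>I\<close> enters the degreewise
  arguments.\<close>

lemma hcomp_I:
  assumes "p \<in> I"
  shows "hcomp n p \<in> I"
proof -
  obtain q where q: "\<forall>j. q j \<in> carrier (x_ring m)" "p = (\<Sum>j\<in>{1..v}. f j * q j)"
    using assms by (auto simp: I_iff)
  have "hcomp n p = (\<Sum>j\<in>{1..v}. hcomp n (f j * q j))" unfolding q(2) by (rule hcomp_sum)
  also have "\<dots> = (\<Sum>j\<in>{1..v}. f j * (if e j \<le> n then hcomp (n - e j) (q j) else 0))"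
    by (intro sum.cong) (simp_all add: hcomp_mult_form[OF f_forms])
  finally have eq: "hcomp n p = (\<Sum>j\<in>{1..v}. f j * (if e j \<le> n then hcomp (n - e j) (q j) else 0))" .
  have "hcomp i (q j) \<in> carrier (x_ring m)" for i j
    using hcomp_in_forms[of "q j"] q(1) forms_subset_carrier by blast
  then show ?thesis unfolding I_iff
    by (intro exI[of _ "\<lambda>j. if e j \<le> n then hcomp (n - e j) (q j) else 0"] conjI eq)
      (simp add: mpoly_zero_closed)
qed

sublocale A: cring "quot_alg m I"
  unfolding quot_alg_def by (rule I.quotient_is_cring[OF mpoly_ring_cring])

sublocale res: ring_hom_cring "x_ring m" "quot_alg m I" "residue_class m I"
proof -
  have "residue_class m I = (+>\<^bsub>x_ring m\<^esub>) I" by (rule ext) (simp add: residue_class_def)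
  then show "ring_hom_cring (x_ring m) (quot_alg m I) (residue_class m I)"
    unfolding quot_alg_def using I.rcos_ring_hom_cring[OF mpoly_ring_cring] by simp
qed

lemma res_eq_iff:
  assumes "p \<in> carrier (x_ring m)" "q \<in> carrier (x_ring m)"
  shows "residue_class m I p = residue_class m I q \<longleftrightarrow> p - q \<in> I"
  using R.quotient_eq_iff_same_a_r_cos[OF I.is_ideal assms] mpoly_ring_a_inv[OF assms(2)]
  by (simp add: residue_class_def a_minus_def)

lemma carrier_quot: "carrier (quot_alg m I) = residue_class m I ` carrier (x_ring m)"
  by (auto simp: quot_alg_def residue_class_def FactRing_def A_RCOSETS_def' image_iff)

lemma res_zero: "residue_class m I 0 = \<zero>\<^bsub>quot_alg m I\<^esub>"
  using res.hom_zero by simp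

lemma res_one: "residue_class m I 1 = \<one>\<^bsub>quot_alg m I\<^esub>"
  using res.hom_one by simp

lemma res_add: "p \<in> carrier (x_ring m) \<Longrightarrow> q \<in> carrier (x_ring m) \<Longrightarrow>
    residue_class m I (p + q) = residue_class m I p \<oplus>\<^bsub>quot_alg m I\<^esub> residue_class m I q"
  using res.hom_add[of p q] by simp

lemma res_mult: "p \<in> carrier (x_ring m) \<Longrightarrow> q \<in> carrier (x_ring m) \<Longrightarrow>
    residue_class m I (p * q) = residue_class m I p \<otimes>\<^bsub>quot_alg m I\<^esub> residue_class m I q"
  using res.hom_mult[of p q] by simp

text \<open>The preimage in the polynomial ring of the ideal of \<open>A\<close> generated by \<open>y\<^sub>1,\<dots>,y\<^sub>d\<close>.\<close>

definition gen :: "nat \<Rightarrow> (nat \<Rightarrow> (nat, 'k) mpoly) \<Rightarrow> (nat, 'k) mpoly set" where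
  "gen d y = {p \<in> carrier (x_ring m). \<exists>q. (\<forall>i. q i \<in> carrier (x_ring m)) \<and>
     p - (\<Sum>i\<in>{1..d}. y i * q i) \<in> I}"

lemma gen_carr: "p \<in> gen d y \<Longrightarrow> p \<in> carrier (x_ring m)"
  by (simp add: gen_def)

lemma genI:
  "p \<in> carrier (x_ring m) \<Longrightarrow> (\<And>i. q i \<in> carrier (x_ring m)) \<Longrightarrow>
    p - (\<Sum>i\<in>{1..d}. y i * q i) \<in> I \<Longrightarrow> p \<in> gen d y"
  unfolding gen_def by (auto intro!: exI[of _ q])

lemma genE:
  assumes "p \<in> gen d y"
  obtains q where "\<forall>i. q i \<in> carrier (x_ring m)" "p - (\<Sum>i\<in>{1..d}. y i * q i) \<in> I"
proof -
  from assms have "\<exists>q. (\<forall>i. q i \<in> carrier (x_ring m)) \<and> p - (\<Sum>i\<in>{1..d}. y i * q i) \<in> I"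
    by (simp add: gen_def)
  then obtain q where q: "(\<forall>i. q i \<in> carrier (x_ring m)) \<and> p - (\<Sum>i\<in>{1..d}. y i * q i) \<in> I"
    by (rule exE)
  show ?thesis by (rule that[of q]) (use q in blast)+
qed

lemma gen_I: "p \<in> I \<Longrightarrow> p \<in> gen d y"
  by (rule genI[of p "\<lambda>_. 0"]) (simp_all add: I_carr mpoly_zero_closed)

lemma gen_self:
  assumes "i \<in> {1..d}" "y i \<in> carrier (x_ring m)"
  shows "y i \<in> gen d y"
proof (rule genI[of _ "\<lambda>j. if j = i then 1 else 0"])
  have "(\<Sum>j\<in>{1..d}. y j * (if j = i then 1 else 0)) = y i"
    using assms(1) by (simp add: if_distrib cong: if_cong)
  then show "y i - (\<Sum>j\<in>{1..d}. y j * (if j = i then 1 else 0)) \<in> I" by (simp add: I_zero)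
qed (simp_all add: assms mpoly_one_closed mpoly_zero_closed)

lemma gen_add:
  assumes "p \<in> gen d y" "p' \<in> gen d y"
  shows "p + p' \<in> gen d y"
proof -
  obtain q where q: "\<forall>i. q i \<in> carrier (x_ring m)" "p - (\<Sum>i\<in>{1..d}. y i * q i) \<in> I"
    using assms(1) by (rule genE)
  obtain q' where q': "\<forall>i. q' i \<in> carrier (x_ring m)" "p' - (\<Sum>i\<in>{1..d}. y i * q' i) \<in> I"
    using assms(2) by (rule genE)
  have "p + p' - (\<Sum>i\<in>{1..d}. y i * (q i + q' i)) =
      (p - (\<Sum>i\<in>{1..d}. y i * q i)) + (p' - (\<Sum>i\<in>{1..d}. y i * q' i))"
    by (simp add: distrib_left sum.distrib)
  then have "p + p' - (\<Sum>i\<in>{1..d}. y i * (q i + q' i)) \<in> I" using I_add[OF q(2) q'(2)] by (simp only:)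
  then show ?thesis
    using genI[where p = "p + p'" and q = "\<lambda>i. q i + q' i" and d = d and y = y] q q' gen_carr[OF assms(1)] gen_carr[OF assms(2)]
    by (simp add: mpoly_add_closed)
qed

lemma gen_mult:
  assumes "p \<in> gen d y" "r \<in> carrier (x_ring m)"
  shows "r * p \<in> gen d y"
proof -
  obtain q where q: "\<forall>i. q i \<in> carrier (x_ring m)" "p - (\<Sum>i\<in>{1..d}. y i * q i) \<in> I"
    using assms(1) by (rule genE)
  have "r * p - (\<Sum>i\<in>{1..d}. y i * (r * q i)) = r * (p - (\<Sum>i\<in>{1..d}. y i * q i))"
    by (simp add: right_diff_distrib sum_distrib_left mult_ac)
  then have "r * p - (\<Sum>i\<in>{1..d}. y i * (r * q i)) \<in> I" using I_mult[OF assms(2) q(2)] by (simp only:)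
  then show ?thesis
    using genI[where p = "r * p" and q = "\<lambda>i. r * q i" and d = d and y = y] q gen_carr[OF assms(1)] assms(2)
    by (simp add: mpoly_mult_closed)
qed

lemma gen_sum: "(\<And>i. i \<in> B \<Longrightarrow> p i \<in> gen d y) \<Longrightarrow> (\<Sum>i\<in>B. p i) \<in> gen d y"
  by (induction B rule: infinite_finite_induct) (auto intro: gen_add gen_I I_zero)

lemma gen_cong_I:
  assumes "p \<in> gen d y" "r \<in> carrier (x_ring m)" "r - p \<in> I"
  shows "r \<in> gen d y"
  using gen_add[OF assms(1) gen_I[OF assms(3)]] by simp

lemma gen_subsetI:
  assumes "\<And>i. i \<in> {1..d} \<Longrightarrow> y i \<in> gen d' y'"
  shows "gen d y \<subseteq> gen d' y'"
proof
  fix p assume p: "p \<in> gen d y"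
  from p obtain q where q: "\<forall>i. q i \<in> carrier (x_ring m)" "p - (\<Sum>i\<in>{1..d}. y i * q i) \<in> I"
    by (rule genE)
  have "(\<Sum>i\<in>{1..d}. q i * y i) \<in> gen d' y'"
    using assms q(1) by (intro gen_sum gen_mult) auto
  then show "p \<in> gen d' y'"
    using gen_cong_I[OF _ gen_carr[OF p], of "\<Sum>i\<in>{1..d}. y i * q i"] q(2) by (simp add: mult.commute)
qed

lemma res_sum_in_ideal:
  assumes K: "ideal K (quot_alg m I)" and y: "\<And>i. i \<in> T \<Longrightarrow> y i \<in> carrier (x_ring m)"
    and yK: "\<And>i. i \<in> T \<Longrightarrow> residue_class m I (y i) \<in> K"
    and q: "\<And>i. q i \<in> carrier (x_ring m)"
  shows "residue_class m I (\<Sum>i\<in>T. y i * q i) \<in> K"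
proof -
  interpret K: ideal K "quot_alg m I" by (rule K)
  show ?thesis using y yK
  proof (induction T rule: infinite_finite_induct)
    case (insert i T)
    have c: "y i * q i \<in> carrier (x_ring m)" "(\<Sum>i\<in>T. y i * q i) \<in> carrier (x_ring m)"
      using insert.prems q by (auto intro!: mpoly_closed)
    have "residue_class m I (y i * q i) \<in> K"
      using K.I_r_closed[of "residue_class m I (y i)" "residue_class m I (q i)"] insert.prems q
        res.hom_closed[OF q] by (simp add: res_mult)
    then show ?case using insert c by (simp add: res_add K.a_closed)
  qed (use K.zero_closed in \<open>simp_all add: res_zero\<close>)
qed

lemma ideal_res_gen: "ideal (residue_class m I ` gen d y) (quot_alg m I)"
proof (rule A.idealI_cring)
  show "residue_class m I ` gen d y \<subseteq> carrier (quot_alg m I)"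
    using gen_carr by (auto simp: carrier_quot)
  show "\<zero>\<^bsub>quot_alg m I\<^esub> \<in> residue_class m I ` gen d y"
    using gen_I[OF I_zero] by (auto simp flip: res_zero)
next
  fix a b assume "a \<in> residue_class m I ` gen d y" "b \<in> residue_class m I ` gen d y"
  then obtain p r where "p \<in> gen d y" "r \<in> gen d y"
    "a = residue_class m I p" "b = residue_class m I r" by blast
  then show "a \<oplus>\<^bsub>quot_alg m I\<^esub> b \<in> residue_class m I ` gen d y"
    using gen_add[of p d y r] by (auto simp: gen_carr simp flip: res_add)
next
  fix a x assume "a \<in> residue_class m I ` gen d y" "x \<in> carrier (quot_alg m I)"
  then obtain p r where "p \<in> gen d y" "r \<in> carrier (x_ring m)"
    "a = residue_class m I p" "x = residue_class m I r" by (auto simp: carrier_quot)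
  then show "x \<otimes>\<^bsub>quot_alg m I\<^esub> a \<in> residue_class m I ` gen d y"
    using gen_mult[of p d y r] by (auto simp: gen_carr simp flip: res_mult)
qed

lemma genideal_res_family:
  assumes y: "\<And>i. i \<in> {1..d} \<Longrightarrow> y i \<in> carrier (x_ring m)"
  shows "genideal (quot_alg m I) ((\<lambda>i. residue_class m I (y i)) ` {1..d}) = residue_class m I ` gen d y"
proof
  let ?Y = "(\<lambda>i. residue_class m I (y i)) ` {1..d}"
  have sub: "?Y \<subseteq> carrier (quot_alg m I)" using y by (auto simp: carrier_quot)
  show "genideal (quot_alg m I) ?Y \<subseteq> residue_class m I ` gen d y"
    by (rule A.genideal_minimal[OF ideal_res_gen]) (use gen_self y in auto)
  have idl: "ideal (genideal (quot_alg m I) ?Y) (quot_alg m I)" by (rule A.genideal_ideal[OF sub])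
  show "residue_class m I ` gen d y \<subseteq> genideal (quot_alg m I) ?Y"
  proof
    fix a assume "a \<in> residue_class m I ` gen d y"
    then obtain p where p: "p \<in> gen d y" "a = residue_class m I p" by blast
    obtain q where q: "\<forall>i. q i \<in> carrier (x_ring m)" "p - (\<Sum>i\<in>{1..d}. y i * q i) \<in> I"
      using p(1) by (rule genE)
    have "(\<Sum>i\<in>{1..d}. y i * q i) \<in> carrier (x_ring m)"
      using q y by (auto intro!: mpoly_sum_closed mpoly_mult_closed)
    then have "a = residue_class m I (\<Sum>i\<in>{1..d}. y i * q i)"
      using q(2) gen_carr[OF p(1)] p(2) by (simp add: res_eq_iff)
    moreover have "\<dots> \<in> genideal (quot_alg m I) ?Y"
      by (rule res_sum_in_ideal[OF idl]) (use y q(1) A.genideal_self[OF sub] in auto)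
    ultimately show "a \<in> genideal (quot_alg m I) ?Y" by simp
  qed
qed

lemma res_in_res_gen:
  assumes "p \<in> carrier (x_ring m)"
  shows "residue_class m I p \<in> residue_class m I ` gen d y \<longleftrightarrow> p \<in> gen d y"
proof
  assume "residue_class m I p \<in> residue_class m I ` gen d y"
  then obtain r where r: "r \<in> gen d y" "residue_class m I p = residue_class m I r" by blast
  then have "p - r \<in> I" using res_eq_iff[OF assms gen_carr[OF r(1)]] by simp
  then show "p \<in> gen d y" by (rule gen_cong_I[OF r(1) assms])
qed blast

text \<open>Expresses \<open>Q_n = A_n\<close> on representatives, for the ideal \<open>Q\<close> of
  \<open>A\<close> generated by the residue classes of \<open>y 1, ..., y d\<close>; see
  \<open>res_gen_degree_part\<close>.\<close>

definition covers :: "nat \<Rightarrow> (nat \<Rightarrow> (nat, 'k) mpoly) \<Rightarrow> nat \<Rightarrow> bool" where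
  "covers d y n \<longleftrightarrow> forms {1..m} n \<subseteq> gen d y"

lemma res_gen_degree_part:
  "residue_class m I ` gen d y \<inter> graded_part m I n = graded_part m I n \<longleftrightarrow> covers d y n"
proof -
  have "residue_class m I p \<in> residue_class m I ` gen d y \<longleftrightarrow> p \<in> gen d y"
    if "p \<in> forms {1..m} n" for p :: "(nat, 'k) mpoly"
    using that forms_subset_carrier by (intro res_in_res_gen) blast
  then show ?thesis unfolding graded_part_def covers_def
    by (simp add: inf.absorb_iff2[symmetric] image_subset_iff) blast
qed

text \<open>The component of degree \<open>Suc n\<close> of a representation fixes \<open>p\<close>,
  stays in \<open>I\<close> and replaces the coefficients by forms of degree
  \<open>n\<close>.\<close>

lemma gen_homogeneous:
  assumes y: "\<And>i. i \<in> {1..d} \<Longrightarrow> y i \<in> forms {1..m} 1"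
    and p: "p \<in> gen d y" "p \<in> forms {1..m} (Suc n)"
  obtains q where "\<forall>i. q i \<in> forms {1..m} n" "p - (\<Sum>i\<in>{1..d}. y i * q i) \<in> I"
proof -
  obtain q where q: "\<forall>i. q i \<in> carrier (x_ring m)" "p - (\<Sum>i\<in>{1..d}. y i * q i) \<in> I"
    using p(1) by (rule genE)
  have "hcomp (Suc n) (p - (\<Sum>i\<in>{1..d}. y i * q i)) = p - (\<Sum>i\<in>{1..d}. hcomp (Suc n) (y i * q i))"
    using hcomp_form[OF p(2)] by (simp add: hcomp_diff hcomp_sum)
  also have "(\<Sum>i\<in>{1..d}. hcomp (Suc n) (y i * q i)) = (\<Sum>i\<in>{1..d}. y i * hcomp n (q i))"
    by (intro sum.cong) (simp_all add: hcomp_mult_form[OF y])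
  finally have "p - (\<Sum>i\<in>{1..d}. y i * hcomp n (q i)) \<in> I" using hcomp_I[OF q(2), of "Suc n"] by simp
  moreover have "\<forall>i. hcomp n (q i) \<in> forms {1..m} n" using q(1) hcomp_in_forms by blast
  ultimately show ?thesis by (intro that[of "\<lambda>i. hcomp n (q i)"])
qed

text \<open>A monomial of degree \<open>Suc n\<close> is a variable times one of degree
  \<open>n\<close>. Hence "for all large \<open>n\<close>" in the definition of a reduction may be
  read as "for some \<open>n\<close>", and the loci of the \<open>J_n\<close> with
  \<open>n \<ge> 1\<close> decrease.\<close>

lemma covers_Suc:
  assumes "covers d y n"
  shows "covers d y (Suc n)"
  unfolding covers_def
proof
  fix p :: "(nat, 'k) mpoly"
  assume p: "p \<in> forms {1..m} (Suc n)"
  have "mpoly_mono t \<in> gen d y" if t: "t \<in> monomials {1..m} (Suc n)" for t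
  proof -
    obtain x s where s: "x \<in> {1..m}" "s \<in> monomials {1..m} n" "t = Poly_Mapping.single x 1 + s"
      using t by (rule monomials_Suc_split)
    have "mpoly_mono s \<in> gen d y" using assms forms_mono[OF s(2)] unfolding covers_def by blast
    from gen_mult[OF this mpoly_var_closed[OF s(1)]] show ?thesis
      unfolding s(3) mpoly_mono_add mpoly_mono_single .
  qed
  then have "(\<Sum>t\<in>monomials {1..m} (Suc n). mpoly_const (Poly_Mapping.lookup p t) * mpoly_mono t) \<in> gen d y"
    by (intro gen_sum gen_mult mpoly_const_closed)
  then show "p \<in> gen d y" using forms_eq_sum[OF p] by simp
qed

lemma covers_mono:
  assumes "covers d y n" "n \<le> n'"
  shows "covers d y n'"
  using assms(2,1) by (induction n' rule: dec_induct) (auto intro: covers_Suc)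

end

section \<open>Growth of finite extensions\<close>

lemma lookup_sum_single:
  assumes "finite T"
  shows "Poly_Mapping.lookup (\<Sum>x\<in>T. Poly_Mapping.single x (g x)) y = (if y \<in> T then g y else 0)"
proof -
  have "Poly_Mapping.lookup (\<Sum>x\<in>T. Poly_Mapping.single x (g x)) y = (\<Sum>x\<in>T. if x = y then g x else 0)"
    unfolding lookup_sum by (intro sum.cong) (auto simp: lookup_single when_def)
  then show ?thesis using assms by simp
qed

text \<open>The bounds vary with the variable because, besides cubes, boxes are counted in which one
  side is cut down to an exponent of a leading monomial.\<close>

lemma card_monomial_box:
  fixes b :: "'v \<Rightarrow> nat"
  assumes T: "finite T"
  defines "B \<equiv> {t :: 'v monom. Poly_Mapping.keys t \<subseteq> T \<and> (\<forall>x\<in>T. Poly_Mapping.lookup t x < b x)}"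
  shows "finite B" "card B = (\<Prod>x\<in>T. b x)"
proof -
  let ?h = "\<lambda>t. restrict (Poly_Mapping.lookup t) T"
  let ?g = "\<lambda>g. \<Sum>x\<in>T. Poly_Mapping.single x (g x)"
  have bij: "bij_betw ?h B (PiE T (\<lambda>x. {..<b x}))"
  proof (rule bij_betw_byWitness[where f' = ?g])
    show "\<forall>t\<in>B. ?g (?h t) = t"
    proof
      fix t assume "t \<in> B"
      then have "Poly_Mapping.lookup t y = 0" if "y \<notin> T" for y
        using that by (auto simp: B_def in_keys_iff)
      then show "?g (?h t) = t"
        by (intro poly_mapping_eqI) (simp add: lookup_sum_single[OF T])
    qed
    show "\<forall>g\<in>PiE T (\<lambda>x. {..<b x}). ?h (?g g) = g"
      by (auto simp: lookup_sum_single[OF T] PiE_iff extensional_def restrict_def)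
    show "?h ` B \<subseteq> PiE T (\<lambda>x. {..<b x})" by (auto simp: B_def)
    show "?g ` PiE T (\<lambda>x. {..<b x}) \<subseteq> B"
      by (auto simp: B_def lookup_sum_single[OF T] PiE_iff in_keys_iff split: if_splits)
  qed
  have "finite (PiE T (\<lambda>x. {..<b x}))" using T by (intro finite_PiE) auto
  then show "finite B" using bij_betw_finite[OF bij] by simp
  show "card B = (\<Prod>x\<in>T. b x)" using bij_betw_same_card[OF bij] T by (simp add: card_PiE)
qed

lemma hcomp_msubst:
  assumes y: "\<And>x. x \<in> Y \<Longrightarrow> y x \<in> forms X 1" and F: "F \<in> carrier (mpoly_ring Y)"
  shows "hcomp n (msubst y F) = msubst y (hcomp n F)"
proof -
  let ?A = "insert n (mdeg ` Poly_Mapping.keys F)"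
  have "F = (\<Sum>j\<in>?A. hcomp j F)" by (rule sum_hcomp) auto
  then have "hcomp n (msubst y F) = hcomp n (msubst y (\<Sum>j\<in>?A. hcomp j F))" by (rule arg_cong)
  also have "\<dots> = (\<Sum>j\<in>?A. hcomp n (msubst y (hcomp j F)))"
    unfolding msubst.hom_sum hcomp_sum ..
  also have "\<dots> = (\<Sum>j\<in>?A. if j = n then msubst y (hcomp n F) else 0)"
  proof (rule sum.cong)
    fix j
    have "msubst y (hcomp j F) \<in> forms X j"
      by (rule msubst_forms[OF y hcomp_in_forms[OF F]])
    from hcomp_form[OF this, of n]
    show "hcomp n (msubst y (hcomp j F)) = (if j = n then msubst y (hcomp n F) else 0)" by auto
  qed simp
  also have "\<dots> = msubst y (hcomp n F)" by simp
  finally show ?thesis .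
qed

definition deg_le :: "nat \<Rightarrow> ('v, 'k::comm_ring_1) mpoly \<Rightarrow> bool" where
  "deg_le n p \<longleftrightarrow> (\<forall>t\<in>Poly_Mapping.keys p. mdeg t \<le> n)"

lemma deg_le_mult: "deg_le a p \<Longrightarrow> deg_le b q \<Longrightarrow> deg_le (a + b) (p * q)"
  using keys_mult[of p q] by (fastforce simp: deg_le_def mdeg_add intro: add_mono)

lemma deg_le_one: "deg_le 0 1"
  by (simp add: deg_le_def flip: single_one)

lemma deg_le_power: "deg_le a p \<Longrightarrow> deg_le (a * n) (p ^ n)"
  by (induction n) (auto intro: deg_le_mult deg_le_one)

lemma deg_le_prod: "(\<And>i. i \<in> A \<Longrightarrow> deg_le (n i) (p i)) \<Longrightarrow> deg_le (\<Sum>i\<in>A. n i) (\<Prod>i\<in>A. p i)"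
  by (induction A rule: infinite_finite_induct) (auto intro: deg_le_mult deg_le_one)

lemma deg_le_monom_value:
  assumes "\<And>x. x \<in> Poly_Mapping.keys t \<Longrightarrow> deg_le c (a x)"
  shows "deg_le (c * mdeg t) (monom_value a t)"
  unfolding monom_value_def mdeg_def sum_distrib_left
  by (intro deg_le_prod deg_le_power assms)

lemma ex_deg_le:
  assumes "finite T"
  shows "\<exists>c. \<forall>i\<in>T. deg_le c (a i)"
proof -
  have "finite (\<Union>i\<in>T. mdeg ` Poly_Mapping.keys (a i))" using assms by simp
  then obtain c where "(\<Union>i\<in>T. mdeg ` Poly_Mapping.keys (a i)) \<subseteq> {..c}"
    unfolding finite_nat_set_iff_bounded_le by auto
  then show ?thesis by (intro exI[of _ c]) (auto simp: deg_le_def)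
qed

section \<open>Spans modulo \<open>I\<close> and the dimension count\<close>

context homogeneous_presentation
begin

definition span_mod :: "(nat, 'k) mpoly set \<Rightarrow> (nat, 'k) mpoly set" where
  "span_mod B = {p. \<exists>c. p - (\<Sum>b\<in>B. mpoly_const (c b) * b) \<in> I}"

lemma span_modE:
  assumes "p \<in> span_mod B"
  obtains c where "p - (\<Sum>b\<in>B. mpoly_const (c b) * b) \<in> I"
  using assms unfolding span_mod_def by blast

lemma span_mod_base:
  assumes "finite B" "b \<in> B"
  shows "b \<in> span_mod B"
proof -
  have "mpoly_const (if b' = b then 1 else 0) * b' = (if b' = b then b else 0)" for b' :: "(nat, 'k) mpoly"
    by (simp add: mpoly_const_def)
  then have "(\<Sum>b'\<in>B. mpoly_const (if b' = b then 1 else 0) * b') = b" using assms by simp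
  then have "b - (\<Sum>b'\<in>B. mpoly_const (if b' = b then 1 else 0) * b') \<in> I" by (simp add: I_zero)
  then show ?thesis unfolding span_mod_def by (intro CollectI exI[of _ "\<lambda>b'. if b' = b then 1 else 0"])
qed

lemma span_mod_I:
  assumes "p \<in> I"
  shows "p \<in> span_mod B"
  unfolding span_mod_def using assms
  by (intro CollectI exI[of _ "\<lambda>_. 0"]) (simp add: mpoly_const_def)

lemma span_mod_add:
  assumes "p \<in> span_mod B" "q \<in> span_mod B"
  shows "p + q \<in> span_mod B"
proof -
  obtain c where c: "p - (\<Sum>b\<in>B. mpoly_const (c b) * b) \<in> I"
    using assms(1) by (rule span_modE)
  obtain c' where c': "q - (\<Sum>b\<in>B. mpoly_const (c' b) * b) \<in> I"
    using assms(2) by (rule span_modE)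
  have "mpoly_const (c b + c' b) = mpoly_const (c b) + (mpoly_const (c' b) :: (nat, 'k) mpoly)" for b
    by (simp add: mpoly_const_def single_add)
  then have "p + q - (\<Sum>b\<in>B. mpoly_const (c b + c' b) * b) =
      (p - (\<Sum>b\<in>B. mpoly_const (c b) * b)) + (q - (\<Sum>b\<in>B. mpoly_const (c' b) * b))"
    by (simp add: distrib_right sum.distrib)
  then have "p + q - (\<Sum>b\<in>B. mpoly_const (c b + c' b) * b) \<in> I"
    using I_add[OF c c'] by (simp only:)
  then show ?thesis unfolding span_mod_def by (intro CollectI exI[of _ "\<lambda>b. c b + c' b"])
qed

lemma span_mod_scale:
  assumes "p \<in> span_mod B"
  shows "mpoly_const a * p \<in> span_mod B"
proof -
  obtain c where c: "p - (\<Sum>b\<in>B. mpoly_const (c b) * b) \<in> I"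
    using assms by (rule span_modE)
  have "mpoly_const (a * c b) = mpoly_const a * (mpoly_const (c b) :: (nat, 'k) mpoly)" for b
    by (simp add: mpoly_const_def mult_single)
  then have "mpoly_const a * p - (\<Sum>b\<in>B. mpoly_const (a * c b) * b) =
      mpoly_const a * (p - (\<Sum>b\<in>B. mpoly_const (c b) * b))"
    by (simp add: right_diff_distrib sum_distrib_left mult_ac)
  then have "mpoly_const a * p - (\<Sum>b\<in>B. mpoly_const (a * c b) * b) \<in> I"
    using I_mult[OF mpoly_const_closed c] by (simp only:)
  then show ?thesis unfolding span_mod_def by (intro CollectI exI[of _ "\<lambda>b. a * c b"])
qed

lemma span_mod_sum: "(\<And>i. i \<in> A \<Longrightarrow> p i \<in> span_mod B) \<Longrightarrow> (\<Sum>i\<in>A. p i) \<in> span_mod B"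
  by (induction A rule: infinite_finite_induct) (auto intro: span_mod_add span_mod_I I_zero)

lemma span_mod_cong:
  assumes "p \<in> span_mod B" "r - p \<in> I"
  shows "r \<in> span_mod B"
  using span_mod_add[OF assms(1) span_mod_I[OF assms(2)]] by simp

text \<open>The number of monomials \<open>a\<^sup>\<nu>\<close> with exponents below \<open>n\<close> would exceed the
  number of elements spanning the part of degree at most \<open>N\<close>.\<close>

lemma no_small_spanning_sets:
  assumes a: "\<And>i. i \<in> {1..d} \<Longrightarrow> a i \<in> carrier (x_ring m)"
    and indep: "\<And>F. F \<in> carrier (mpoly_ring {1..d}) \<Longrightarrow> msubst a F \<in> I \<Longrightarrow> F = 0"
    and B: "finite B" "card B < n ^ d"
    and span: "\<And>p. p \<in> carrier (x_ring m) \<Longrightarrow> deg_le N p \<Longrightarrow> p \<in> span_mod B"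
    and deg: "\<And>i. i \<in> {1..d} \<Longrightarrow> deg_le c (a i)" and N: "c * (d * n) \<le> N"
  shows False
proof -
  define S where "S = {t :: nat monom. Poly_Mapping.keys t \<subseteq> {1..d} \<and> (\<forall>x\<in>{1..d}. Poly_Mapping.lookup t x < n)}"
  have S: "finite S" "card S = n ^ d"
    using card_monomial_box[of "{1..d}" "\<lambda>_. n"] by (simp_all add: S_def)
  have "\<forall>t\<in>S. \<exists>c. monom_value a t - (\<Sum>b\<in>B. mpoly_const (c b) * b) \<in> I"
  proof
    fix t assume t: "t \<in> S"
    have k: "Poly_Mapping.keys t \<subseteq> {1..d}" using t by (simp add: S_def)
    have "mdeg t = (\<Sum>x\<in>{1..d}. Poly_Mapping.lookup t x)" using k by (intro mdeg_superset) auto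
    also have "\<dots> \<le> (\<Sum>x\<in>{1..d}. n)" using t by (intro sum_mono) (auto simp: S_def intro: less_imp_le)
    finally have "mdeg t \<le> d * n" by simp
    then have "c * mdeg t \<le> N" using le_trans[OF mult_le_mono2 N] by blast
    moreover have "deg_le (c * mdeg t) (monom_value a t)" using k deg by (intro deg_le_monom_value) auto
    ultimately have "deg_le N (monom_value a t)" unfolding deg_le_def using le_trans by blast
    moreover have "monom_value a t \<in> carrier (x_ring m)" using k a by (intro monom_value_closed) auto
    ultimately have "monom_value a t \<in> span_mod B" using span by blast
    then show "\<exists>c. monom_value a t - (\<Sum>b\<in>B. mpoly_const (c b) * b) \<in> I"
      unfolding span_mod_def by simp
  qed
  from bchoice[OF this] obtain C
    where C: "\<forall>t\<in>S. monom_value a t - (\<Sum>b\<in>B. mpoly_const (C t b) * b) \<in> I" by (rule exE)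
  have "card B < card S" using S B by simp
  \<comment> \<open>The coordinate vectors of \<open>n ^ d\<close> monomials with respect to fewer
    spanning elements are linearly dependent; the dependency supplies the coefficients of a nonzero
    relation \<open>G\<close>.\<close>
  from underdetermined_system[OF S(1) B(1) this, of "\<lambda>b t. C t b"]
  obtain l where l: "\<exists>t\<in>S. l t \<noteq> 0" "\<forall>b\<in>B. (\<Sum>t\<in>S. l t * C t b) = 0"
    by (elim exE conjE)
  define G where "G = (\<Sum>t\<in>S. Poly_Mapping.single t (l t))"
  have lookG: "Poly_Mapping.lookup G t = (if t \<in> S then l t else 0)" for t
    unfolding G_def by (rule lookup_sum_single[OF S(1)])
  have "G \<in> carrier (mpoly_ring {1..d})"
    unfolding G_def by (intro mpoly_sum_closed mpoly_single_closed) (simp add: S_def)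
  moreover have "msubst a G \<in> I"
  proof -
    have hs: "mpoly_const (\<Sum>t\<in>S. g t) = (\<Sum>t\<in>S. mpoly_const (g t) :: (nat, 'k) mpoly)" for g
      by (rule poly_mapping_eqI) (simp add: mpoly_const_def lookup_sum lookup_single when_def)
    have hm: "mpoly_const (x * y) = mpoly_const x * (mpoly_const y :: (nat, 'k) mpoly)" for x y
      by (simp add: mpoly_const_def mult_single)
    have "(\<Sum>t\<in>S. mpoly_const (l t) * (\<Sum>b\<in>B. mpoly_const (C t b) * b)) =
        (\<Sum>b\<in>B. mpoly_const (\<Sum>t\<in>S. l t * C t b) * b)"
      unfolding hs hm sum_distrib_left sum_distrib_right mult.assoc by (rule sum.swap)
    also have "\<dots> = 0" using l(2) by (simp add: mpoly_const_def)
    finally have "msubst a G = (\<Sum>t\<in>S. mpoly_const (l t) * monom_value a t) -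
        (\<Sum>t\<in>S. mpoly_const (l t) * (\<Sum>b\<in>B. mpoly_const (C t b) * b))"
      unfolding G_def msubst.hom_sum msubst_single by simp
    also have "\<dots> = (\<Sum>t\<in>S. mpoly_const (l t) *
        (monom_value a t - (\<Sum>b\<in>B. mpoly_const (C t b) * b)))"
      by (simp add: right_diff_distrib sum_subtractf)
    finally show ?thesis using C by (simp only:) (intro I_sum I_mult mpoly_const_closed, blast)
  qed
  ultimately have "G = 0" by (rule indep)
  then show False using l(1) lookG by (metis lookup_zero)
qed

text \<open>A homogeneous component \<open>G\<close> of a relation, with leading monomial
  \<open>t\<close>, rewrites the \<open>y\<close>-monomial of \<open>t\<close> by smaller ones. So
  only \<open>y\<close>-monomials not divisible by \<open>t\<close> are needed, and those with
  exponents up to \<open>N\<close> number at most \<open>mdeg t * (N + 1) ^ (d - 1)\<close>.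
  Multiplied by the finitely many \<open>x\<close>-monomials of degree at most \<open>n0\<close>
  they span everything of degree up to \<open>N\<close> modulo \<open>I\<close>, too few elements
  for the monomials in the independent family \<open>a\<close>.\<close>

lemma covers_alg_independent:
  assumes y: "\<And>i. i \<in> {1..d} \<Longrightarrow> y i \<in> forms {1..m} 1"
    and cov: "covers d y n0"
    and a: "\<And>i. i \<in> {1..d} \<Longrightarrow> a i \<in> carrier (x_ring m)"
    and indep: "\<And>F. F \<in> carrier (mpoly_ring {1..d}) \<Longrightarrow> msubst a F \<in> I \<Longrightarrow> F = 0"
    and F: "F \<in> carrier (mpoly_ring {1..d})" "msubst y F \<in> I"
  shows "F = 0"
proof (rule ccontr)
  assume "F \<noteq> 0"
  then obtain t0 where t0: "t0 \<in> Poly_Mapping.keys F" by fastforce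
  \<comment> \<open>Homogeneity ensures that rewriting by \<open>G\<close> preserves degrees, hence
    the bound \<open>N\<close>.\<close>
  define G where "G = hcomp (mdeg t0) F"
  define t where "t = Max (Poly_Mapping.keys G)"
  have "Poly_Mapping.lookup G t0 \<noteq> 0" using t0 by (simp add: G_def lookup_hcomp in_keys_iff)
  then have "Poly_Mapping.keys G \<noteq> {}" by auto
  then have tG: "t \<in> Poly_Mapping.keys G" unfolding t_def by (intro Max_in) auto
  have t_max: "u < t" if "u \<in> Poly_Mapping.keys G - {t}" for u
    using that Max_ge[of "Poly_Mapping.keys G" u] by (auto simp: t_def order_less_le)
  have Gf: "G \<in> forms {1..d} (mdeg t0)" unfolding G_def by (rule hcomp_in_forms[OF F(1)])
  have "msubst y G = hcomp (mdeg t0) (msubst y F)"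
    unfolding G_def by (rule hcomp_msubst[OF y F(1), symmetric])
  then have GI: "msubst y G \<in> I" using hcomp_I[OF F(2), of "mdeg t0"] by (simp only:)
  have Gk: "Poly_Mapping.keys u \<subseteq> {1..d}" "mdeg u = mdeg t" if "u \<in> Poly_Mapping.keys G" for u
    using Gf that tG by (auto simp: forms_iff)
  have yc: "y i \<in> carrier (x_ring m)" if "i \<in> {1..d}" for i
    using y[OF that] forms_subset_carrier by blast
  have mvc: "monom_value y u \<in> carrier (x_ring m)" if "Poly_Mapping.keys u \<subseteq> {1..d}" for u
    using that yc by (intro monom_value_closed) auto

  define lc where "lc = Poly_Mapping.lookup G t"
  have lc: "lc \<noteq> 0" using tG by (simp add: lc_def in_keys_iff)
  \<comment> \<open>The rewriting rule for \<open>t\<close>, solved from the relation by dividing by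
    its leading coefficient.\<close>
  define red where "red u = - Poly_Mapping.lookup G u / lc" for u
  have reduce: "monom_value y t - (\<Sum>u\<in>Poly_Mapping.keys G - {t}. mpoly_const (red u) * monom_value y u) \<in> I"
  proof -
    have c: "mpoly_const (1 / lc) * mpoly_const (Poly_Mapping.lookup G u) =
        (if u = t then 1 else - mpoly_const (red u) :: (nat, 'k) mpoly)" for u
      using lc by (simp add: mpoly_const_def mult_single red_def single_uminus[symmetric] lc_def)
    have "mpoly_const (1 / lc) * msubst y G =
        (\<Sum>u\<in>Poly_Mapping.keys G. (if u = t then 1 else - mpoly_const (red u)) * monom_value y u)"
      unfolding evalg_def sum_distrib_left mult.assoc[symmetric] c ..
    also have "\<dots> = monom_value y t +
        (\<Sum>u\<in>Poly_Mapping.keys G - {t}. (if u = t then 1 else - mpoly_const (red u)) * monom_value y u)"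
      using tG by (subst sum.remove[of _ t]) auto
    also have "(\<Sum>u\<in>Poly_Mapping.keys G - {t}. (if u = t then 1 else - mpoly_const (red u)) * monom_value y u)
        = - (\<Sum>u\<in>Poly_Mapping.keys G - {t}. mpoly_const (red u) * monom_value y u)"
      unfolding sum_negf[symmetric] by (intro sum.cong) auto
    finally show ?thesis using I_mult[OF mpoly_const_closed GI, of "1 / lc"] by simp
  qed

  \<comment> \<open>Starting at \<open>Suc n0\<close> makes every degree from \<open>n1\<close> on a
    successor, as \<open>gen_homogeneous\<close> requires.\<close>
  define n1 where "n1 = Suc n0"
  have cov1: "covers d y j" if "j \<ge> n1" for j
    using covers_mono[OF cov, of j] that by (simp add: n1_def)
  define M where "M = (\<Union>j<n1. monomials {1..m} j)"
  have M: "finite M" unfolding M_def using finite_monomials by auto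
  \<comment> \<open>A monomial not divisible by \<open>t\<close> has some exponent \<open>i\<close>
    below that of \<open>t\<close>. For fixed \<open>i\<close> this is a box with
    \<open>lookup t i * Suc N ^ (d - 1)\<close> elements, and these numbers add up to
    \<open>K N\<close>.\<close>
  define E where "E N = {\<mu> :: nat monom. Poly_Mapping.keys \<mu> \<subseteq> {1..d} \<and>
      (\<forall>x\<in>{1..d}. Poly_Mapping.lookup \<mu> x < Suc N) \<and> \<not> (\<exists>s. \<mu> = t + s)}" for N
  define K where "K N = mdeg t * Suc N ^ (d - 1)" for N
  have E: "finite (E N) \<and> card (E N) \<le> K N" for N
  proof -
    let ?b = "\<lambda>i x. if x = i then Poly_Mapping.lookup t i else Suc N"
    let ?D = "\<lambda>i. {\<mu> :: nat monom. Poly_Mapping.keys \<mu> \<subseteq> {1..d} \<and> (\<forall>x\<in>{1..d}. Poly_Mapping.lookup \<mu> x < ?b i x)}"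
    have D: "finite (?D i)" "card (?D i) = Poly_Mapping.lookup t i * Suc N ^ (d - 1)" if "i \<in> {1..d}" for i
    proof -
      show "finite (?D i)" by (rule card_monomial_box) simp
      have "card (?D i) = (\<Prod>x\<in>{1..d}. ?b i x)" by (rule card_monomial_box) simp
      also have "\<dots> = Poly_Mapping.lookup t i * (\<Prod>x\<in>{1..d} - {i}. ?b i x)"
        using that by (subst prod.remove[of _ i]) auto
      also have "(\<Prod>x\<in>{1..d} - {i}. ?b i x) = (\<Prod>x\<in>{1..d} - {i}. Suc N)" by (intro prod.cong) auto
      finally show "card (?D i) = Poly_Mapping.lookup t i * Suc N ^ (d - 1)" using that by simp
    qed
    have "E N \<subseteq> (\<Union>i\<in>{1..d}. ?D i)"
    proof
      fix \<mu> assume \<mu>: "\<mu> \<in> E N"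
      have "\<exists>i\<in>{1..d}. Poly_Mapping.lookup \<mu> i < Poly_Mapping.lookup t i"
      proof (rule ccontr)
        assume "\<not> ?thesis"
        then have le: "\<forall>x\<in>{1..d}. Poly_Mapping.lookup t x \<le> Poly_Mapping.lookup \<mu> x"
          by (simp add: not_less)
        have "Poly_Mapping.lookup t x \<le> Poly_Mapping.lookup \<mu> x" for x
        proof (cases "x \<in> {1..d}")
          case False
          then have "x \<notin> Poly_Mapping.keys t" using Gk(1)[OF tG] by blast
          then show ?thesis by (simp add: in_keys_iff)
        qed (use le in blast)
        from monom_le_imp_add[OF this] show False using \<mu> unfolding E_def by blast
      qed
      then obtain i where "i \<in> {1..d}" "Poly_Mapping.lookup \<mu> i < Poly_Mapping.lookup t i" by blast
      then have "\<mu> \<in> ?D i" using \<mu> by (simp add: E_def)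
      then show "\<mu> \<in> (\<Union>i\<in>{1..d}. ?D i)" using \<open>i \<in> {1..d}\<close> by blast
    qed
    moreover have "finite (\<Union>i\<in>{1..d}. ?D i)" using D by blast
    moreover have "card (\<Union>i\<in>{1..d}. ?D i) \<le> (\<Sum>i\<in>{1..d}. card (?D i))" by (rule card_UN_le) simp
    moreover have "(\<Sum>i\<in>{1..d}. card (?D i)) = K N"
      using D(2) mdeg_superset[of "{1..d}" t] Gk(1)[OF tG] by (simp add: K_def sum_distrib_right)
    ultimately show ?thesis using card_mono finite_subset by (metis (no_types, lifting) le_trans)
  qed
  define B where "B N = (\<lambda>(\<mu>, g). monom_value y \<mu> * mpoly_mono g) ` (E N \<times> M)" for N
  have B: "finite (B N)" "card (B N) \<le> K N * card M" for N
  proof -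
    show "finite (B N)" unfolding B_def using E M by blast
    have "card (B N) \<le> card (E N \<times> M)" unfolding B_def using E M by (intro card_image_le) blast
    also have "\<dots> \<le> K N * card M" using E[of N] by (simp add: card_cartesian_product)
    finally show "card (B N) \<le> K N * card M" .
  qed

  \<comment> \<open>Induction along the monomial order: replacing a factor \<open>t\<close> produces
    only smaller monomials of the same degree.\<close>
  have small: "monom_value y \<mu> * mpoly_mono g \<in> span_mod (B N)"
    if "Poly_Mapping.keys \<mu> \<subseteq> {1..d}" "mdeg \<mu> \<le> N" "g \<in> M" for \<mu> g N
    using that(1,2)
  proof (induction \<mu> rule: wf_induct_rule[OF wf_monom_less[of "{1..d}", simplified]])
    case (1 \<mu>)
    show ?case
    proof (cases "\<exists>s. \<mu> = t + s")
      case False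
      have "Poly_Mapping.lookup \<mu> x < Suc N" for x using lookup_le_mdeg[of \<mu> x] 1(3) by simp
      then have "\<mu> \<in> E N" using False 1(2) by (simp add: E_def)
      then have "monom_value y \<mu> * mpoly_mono g \<in> B N" unfolding B_def using that(3) by force
      then show ?thesis by (rule span_mod_base[OF B(1)])
    next
      case True
      then obtain s where s: "\<mu> = t + s" by blast
      have sk: "Poly_Mapping.keys s \<subseteq> {1..d}" using 1(2) by (simp add: s keys_monom_add)
      let ?U = "Poly_Mapping.keys G - {t}"
      have g: "mpoly_mono g \<in> carrier (x_ring m)"
        using that(3) by (auto simp: M_def monomials_def intro!: mpoly_mono_closed)
      have "monom_value y (u + s) * mpoly_mono g \<in> span_mod (B N)" if u: "u \<in> ?U" for u
      proof -
        have "u + s < \<mu>" using t_max[OF u] by (simp add: s)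
        moreover have "Poly_Mapping.keys (u + s) \<subseteq> {1..d}" using Gk(1)[of u] u sk by (simp add: keys_monom_add)
        moreover have "mdeg (u + s) \<le> N" using Gk(2)[of u] u 1(3) by (simp add: s mdeg_add)
        ultimately show ?thesis using 1(1)[of "u + s"] by blast
      qed
      then have sp: "(\<Sum>u\<in>?U. mpoly_const (red u) * (monom_value y (u + s) * mpoly_mono g)) \<in> span_mod (B N)"
        by (intro span_mod_sum span_mod_scale)
      have "monom_value y \<mu> * mpoly_mono g - (\<Sum>u\<in>?U. mpoly_const (red u) * (monom_value y (u + s) * mpoly_mono g))
        = (monom_value y s * mpoly_mono g) * (monom_value y t - (\<Sum>u\<in>?U. mpoly_const (red u) * monom_value y u))"
        by (simp add: s monom_value_add right_diff_distrib sum_distrib_left mult_ac)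
      also have "\<dots> \<in> I" by (rule I_mult[OF mpoly_mult_closed[OF mvc[OF sk] g] reduce])
      finally show ?thesis by (rule span_mod_cong[OF sp])
    qed
  qed

  \<comment> \<open>Induction on the degree of \<open>g\<close>: from \<open>n1\<close> on,
    \<open>g\<close> can be rewritten through the \<open>y i\<close>, which moves one degree into
    the \<open>y\<close>-monomial and keeps the total.\<close>
  have big: "monom_value y \<mu> * g \<in> span_mod (B N)"
    if "Poly_Mapping.keys \<mu> \<subseteq> {1..d}" "g \<in> forms {1..m} j" "mdeg \<mu> + j \<le> N" for \<mu> g j N
    using that
  proof (induction j arbitrary: \<mu> g rule: less_induct)
    case (less j)
    show ?case
    proof (cases "j < n1")
      case True
      have "monom_value y \<mu> * g = monom_value y \<mu> *
          (\<Sum>u\<in>monomials {1..m} j. mpoly_const (Poly_Mapping.lookup g u) * mpoly_mono u)"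
        using forms_eq_sum[OF less.prems(2)] by simp
      also have "\<dots> = (\<Sum>u\<in>monomials {1..m} j. mpoly_const (Poly_Mapping.lookup g u) *
          (monom_value y \<mu> * mpoly_mono u))"
        by (simp add: sum_distrib_left mult_ac)
      also have "\<dots> \<in> span_mod (B N)"
        using True less.prems by (intro span_mod_sum span_mod_scale small) (auto simp: M_def)
      finally show ?thesis .
    next
      case False
      then obtain j' where j': "j = Suc j'" by (cases j) (auto simp: n1_def)
      have gg: "g \<in> gen d y" using cov1[of j] False less.prems(2) unfolding covers_def by auto
      obtain q where q: "\<forall>i. q i \<in> forms {1..m} j'" "g - (\<Sum>i\<in>{1..d}. y i * q i) \<in> I"
        by (rule gen_homogeneous[OF y gg less.prems(2)[unfolded j']])
      have "monom_value y (\<mu> + Poly_Mapping.single i 1) * q i \<in> span_mod (B N)" if "i \<in> {1..d}" for i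
        using less.prems(1,3) that q(1) by (intro less.IH[of j']) (auto simp: j' keys_monom_add mdeg_add)
      then have sp: "(\<Sum>i\<in>{1..d}. monom_value y (\<mu> + Poly_Mapping.single i 1) * q i) \<in> span_mod (B N)"
        by (rule span_mod_sum)
      have "monom_value y \<mu> * g - (\<Sum>i\<in>{1..d}. monom_value y (\<mu> + Poly_Mapping.single i 1) * q i)
          = monom_value y \<mu> * (g - (\<Sum>i\<in>{1..d}. y i * q i))"
        by (simp add: monom_value_add right_diff_distrib sum_distrib_left mult_ac)
      also have "\<dots> \<in> I" by (rule I_mult[OF mvc[OF less.prems(1)] q(2)])
      finally show ?thesis by (rule span_mod_cong[OF sp])
    qed
  qed

  have span: "p \<in> span_mod (B N)" if p: "p \<in> carrier (x_ring m)" "deg_le N p" for p N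
  proof -
    have "hcomp j p \<in> span_mod (B N)" if "j \<in> {..N}" for j
      using big[of 0 "hcomp j p" j N] hcomp_in_forms[OF p(1)] that by simp
    then have "(\<Sum>j\<in>{..N}. hcomp j p) \<in> span_mod (B N)" by (rule span_mod_sum)
    moreover have "p = (\<Sum>j\<in>{..N}. hcomp j p)"
      using p(2) by (intro sum_hcomp) (auto simp: deg_le_def)
    ultimately show ?thesis by simp
  qed

  obtain c where c: "\<And>i. i \<in> {1..d} \<Longrightarrow> deg_le c (a i)" using ex_deg_le[of "{1..d}" a] by blast
  \<comment> \<open>For \<open>d > 0\<close>, \<open>N + 1 \<le> (c * d + 1) * n\<close> bounds
    \<open>card (B N)\<close> by \<open>(n - 1) * n ^ (d - 1) < n ^ d\<close>. The value of
    \<open>N\<close> bounds the degrees of the monomials in the \<open>a i\<close> with exponents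
    below \<open>n\<close>.\<close>
  define n where "n = Suc (mdeg t * Suc (c * d) ^ (d - 1) * card M)"
  define N where "N = c * (d * n)"
  have "card (B N) < n ^ d"
  proof (cases d)
    case 0
    then have "t = 0" using Gk(1)[OF tG] by simp
    then show ?thesis using B(2)[of N] 0 by (simp add: K_def)
  next
    case (Suc d')
    have "1 \<le> n" by (simp add: n_def)
    then have "Suc N \<le> Suc (c * d) * n" by (simp add: N_def mult.assoc)
    then have "Suc N ^ d' \<le> (Suc (c * d) * n) ^ d'" by (rule power_mono) simp
    then have "K N * card M \<le> mdeg t * (Suc (c * d) * n) ^ d' * card M"
      by (simp add: K_def Suc)
    also have "\<dots> = (mdeg t * Suc (c * d) ^ d' * card M) * n ^ d'" unfolding power_mult_distrib by (simp only: mult_ac)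
    also have "\<dots> < n * n ^ d'" by (rule mult_strict_right_mono) (simp_all add: n_def Suc)
    finally show ?thesis using B(2)[of N] by (simp add: Suc)
  qed
  then show False
    using no_small_spanning_sets[where a = a and d = d and B = "B N" and n = n and N = N and c = c]
      a indep B(1) span c by (simp add: N_def)
qed

end

section \<open>Chains of primes and algebraic independence\<close>

lemma msubst_cong:
  assumes "\<And>x. x \<in> X \<Longrightarrow> a x = b x" "p \<in> carrier (mpoly_ring X)"
  shows "msubst a p = msubst b p"
  unfolding evalg_def monom_value_def
  using assms by (intro sum.cong prod.cong refl arg_cong2[of _ _ _ _ "(*)"])
    (auto simp: mem_mpoly_ring subset_iff intro!: prod.cong)

text \<open>Division with remainder by the variable \<open>x\<close>. The exponent bound is strict
  so that an induction on it ends at \<open>0\<close>, where no monomial is left.\<close>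

lemma split_variable:
  fixes F :: "('v, 'k::comm_ring_1) mpoly"
  assumes F: "F \<in> carrier (mpoly_ring (insert x X))"
    and deg: "\<forall>t\<in>Poly_Mapping.keys F. Poly_Mapping.lookup t x < Suc N"
  obtains F0 F1 where "F0 \<in> carrier (mpoly_ring X)" "F1 \<in> carrier (mpoly_ring (insert x X))"
    "\<forall>t\<in>Poly_Mapping.keys F1. Poly_Mapping.lookup t x < N" "F = F0 + mpoly_var x * F1"
proof -
  let ?A = "{t \<in> Poly_Mapping.keys F. Poly_Mapping.lookup t x = 0}"
  let ?B = "{t \<in> Poly_Mapping.keys F. Poly_Mapping.lookup t x \<noteq> 0}"
  let ?e = "Poly_Mapping.single x (1::nat)"
  define F0 where "F0 = (\<Sum>t\<in>?A. Poly_Mapping.single t (Poly_Mapping.lookup F t))"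
  define F1 where "F1 = (\<Sum>t\<in>?B. Poly_Mapping.single (t - ?e) (Poly_Mapping.lookup F t))"
  have te: "t = ?e + (t - ?e)" if "t \<in> ?B" for t
    using that by (intro monom_le_imp_add) (auto simp: lookup_single when_def One_nat_def)
  have "F0 \<in> carrier (mpoly_ring X)"
    unfolding F0_def
  proof (rule mpoly_sum_closed[OF mpoly_single_closed])
    fix t assume t: "t \<in> ?A"
    then have "x \<notin> Poly_Mapping.keys t" by (simp add: in_keys_iff)
    then show "Poly_Mapping.keys t \<subseteq> X" using t F by (auto simp: mem_mpoly_ring)
  qed
  moreover have "F1 \<in> carrier (mpoly_ring (insert x X))"
    unfolding F1_def
  proof (rule mpoly_sum_closed[OF mpoly_single_closed])
    fix t assume t: "t \<in> ?B"
    have "Poly_Mapping.keys (t - ?e) \<subseteq> Poly_Mapping.keys t"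
      by (subst (2) te[OF t]) (auto simp: keys_monom_add)
    then show "Poly_Mapping.keys (t - ?e) \<subseteq> insert x X" using t F by (auto simp: mem_mpoly_ring)
  qed
  moreover have "\<forall>t\<in>Poly_Mapping.keys F1. Poly_Mapping.lookup t x < N"
  proof
    fix s assume "s \<in> Poly_Mapping.keys F1"
    then have "\<exists>t\<in>?B. s = t - ?e"
      using keys_sum[of "\<lambda>t. Poly_Mapping.single (t - ?e) (Poly_Mapping.lookup F t)" ?B]
      by (auto simp: F1_def split: if_splits)
    then obtain t where t: "t \<in> ?B" "s = t - ?e" by blast
    have "Poly_Mapping.lookup t x = 1 + Poly_Mapping.lookup s x"
      by (subst te[OF t(1)]) (simp add: lookup_add t(2))
    then show "Poly_Mapping.lookup s x < N" using t(1) deg by auto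
  qed
  moreover have "F = F0 + mpoly_var x * F1"
  proof -
    have "mpoly_var x * F1 = (\<Sum>t\<in>?B. Poly_Mapping.single (?e + (t - ?e)) (Poly_Mapping.lookup F t))"
      by (simp add: F1_def mpoly_var_def sum_distrib_left mult_single)
    also have "\<dots> = (\<Sum>t\<in>?B. Poly_Mapping.single t (Poly_Mapping.lookup F t))"
      by (intro sum.cong refl) (simp flip: te)
    finally have "F0 + mpoly_var x * F1 = (\<Sum>t\<in>?A \<union> ?B. Poly_Mapping.single t (Poly_Mapping.lookup F t))"
      by (subst sum.union_disjoint) (auto simp: F0_def)
    also have "?A \<union> ?B = Poly_Mapping.keys F" by blast
    finally show ?thesis using poly_mapping_sum_single[of F] by simp
  qed
  ultimately show ?thesis by (rule that)
qed

context homogeneous_presentation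
begin

text \<open>
  Going down from \<open>\<pp> (Suc i)\<close> to \<open>\<pp> i\<close>, any element of the difference can be added to a
  family that is algebraically independent modulo \<open>\<pp> (Suc i)\<close>.
\<close>

lemma prime_chain_alg_independent:
  assumes prime: "\<And>i. i \<le> n \<Longrightarrow> primeideal (\<pp> i) (quot_alg m I)"
    and chain: "\<And>i. i < n \<Longrightarrow> \<pp> i \<subset> \<pp> (Suc i)"
    and "j \<le> n"
  shows "\<exists>a. (\<forall>i. a i \<in> carrier (x_ring m)) \<and>
    (\<forall>F\<in>carrier (mpoly_ring {1..j}). residue_class m I (msubst a F) \<in> \<pp> (n - j) \<longrightarrow> F = 0)"
  using \<open>j \<le> n\<close>
proof (induction j)
  case 0
  interpret P: primeideal "\<pp> n" "quot_alg m I" by (rule prime) simp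
  \<comment> \<open>A relation without variables is a constant, and a nonzero constant is a unit,
    which no prime ideal contains.\<close>
  have "F = 0" if F: "F \<in> carrier (mpoly_ring {})" and FP: "residue_class m I (msubst (\<lambda>_. 0) F) \<in> \<pp> n"
    for F :: "(nat, 'k) mpoly"
  proof (rule ccontr)
    assume "F \<noteq> 0"
    define c where "c = Poly_Mapping.lookup F 0"
    have Fc: "F = mpoly_const c"
      using F unfolding c_def by (intro forms_0_const[of _ "{}"]) (auto simp: forms_iff mem_mpoly_ring)
    then have c: "c \<noteq> 0" using \<open>F \<noteq> 0\<close> by (auto simp: mpoly_const_def)
    have "mpoly_const (1 / c) * mpoly_const c = (1 :: (nat, 'k) mpoly)"
      using c by (simp add: mpoly_const_def mult_single)
    then have "\<one>\<^bsub>quot_alg m I\<^esub> = residue_class m I (mpoly_const (1 / c)) \<otimes>\<^bsub>quot_alg m I\<^esub> residue_class m I (mpoly_const c)"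
      by (simp add: mpoly_const_closed flip: res_mult res_one)
    moreover have "residue_class m I (mpoly_const c) \<in> \<pp> n" using FP by (simp add: Fc)
    ultimately have "\<one>\<^bsub>quot_alg m I\<^esub> \<in> \<pp> n"
      using P.I_l_closed res.hom_closed[OF mpoly_const_closed] by simp
    then show False using P.one_imp_carrier P.I_notcarr by simp
  qed
  then show ?case by (intro exI[of _ "\<lambda>_. 0"]) (simp add: mpoly_zero_closed)
next
  case (Suc j)
  from Suc.IH[OF Suc_leD[OF Suc.prems]] obtain a where a: "\<forall>i. a i \<in> carrier (x_ring m)"
    "\<forall>F\<in>carrier (mpoly_ring {1..j}). residue_class m I (msubst a F) \<in> \<pp> (n - j) \<longrightarrow> F = 0"
    by (elim exE conjE)
  define P where "P = \<pp> (n - Suc j)"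
  define Q where "Q = \<pp> (n - j)"
  have PQ: "P \<subset> Q" using chain[of "n - Suc j"] Suc.prems by (simp add: P_def Q_def Suc_diff_Suc)
  interpret P: primeideal P "quot_alg m I" unfolding P_def by (rule prime) simp
  interpret Q: primeideal Q "quot_alg m I" unfolding Q_def by (rule prime) simp
  obtain z where z: "z \<in> Q" "z \<notin> P" using PQ by blast
  then have "z \<in> carrier (quot_alg m I)" using Q.a_subset by blast
  then obtain a0 where a0: "a0 \<in> carrier (x_ring m)" "z = residue_class m I a0"
    unfolding carrier_quot by blast
  define b where "b = a(Suc j := a0)"
  have b: "b i \<in> carrier (x_ring m)" for i using a(1) a0(1) by (simp add: b_def)
  have bc: "msubst b F \<in> carrier (x_ring m)" if "F \<in> carrier (mpoly_ring X)" for F X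
    using msubst_closed[OF _ that] b by blast
  have ins: "{1..Suc j} = insert (Suc j) {1..j}" by (auto simp: One_nat_def)
  \<comment> \<open>Induction on the degree in the new element. Its class lies in \<open>Q\<close>,
    so \<open>F0\<close> is a relation of the old family modulo \<open>Q\<close> and must be
    \<open>0\<close>. Then \<open>a0\<close> times the value of \<open>F1\<close> lies in the prime
    \<open>P\<close>, which does not contain the class of \<open>a0\<close>, and \<open>F1\<close>
    is a relation of smaller degree.\<close>
  have main: "F = 0" if "F \<in> carrier (mpoly_ring {1..Suc j})"
    "\<forall>t\<in>Poly_Mapping.keys F. Poly_Mapping.lookup t (Suc j) < N" "residue_class m I (msubst b F) \<in> P" for N F
    using that
  proof (induction N arbitrary: F)
    case 0
    then have "Poly_Mapping.keys F = {}" by auto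
    then show ?case by simp
  next
    case (Suc N)
    obtain F0 F1 where F0: "F0 \<in> carrier (mpoly_ring {1..j})"
      and F1: "F1 \<in> carrier (mpoly_ring {1..Suc j})" "\<forall>t\<in>Poly_Mapping.keys F1. Poly_Mapping.lookup t (Suc j) < N"
      and F: "F = F0 + mpoly_var (Suc j) * F1"
      using split_variable[OF Suc.prems(1)[unfolded ins] Suc.prems(2)] unfolding ins by blast
    have F0': "F0 \<in> carrier (mpoly_ring {1..Suc j})" using F0 unfolding ins by (auto simp: mem_mpoly_ring)
    have sF: "msubst b F = msubst b F0 + a0 * msubst b F1"
      by (simp add: F msubst.hom_add msubst.hom_mult b_def)
    have "residue_class m I (a0 * msubst b F1) \<in> Q"
      using Q.I_r_closed[OF z(1)] bc[OF F1(1)] res.hom_closed[OF bc[OF F1(1)]] a0 by (simp add: res_mult)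
    moreover have "residue_class m I (msubst b F) \<in> Q" using Suc.prems(3) PQ by blast
    moreover have "residue_class m I (msubst b F0) =
        residue_class m I (msubst b F) \<ominus>\<^bsub>quot_alg m I\<^esub> residue_class m I (a0 * msubst b F1)"
      unfolding sF using bc[OF F0'] bc[OF F1(1)] a0(1) res.hom_closed[OF bc[OF F0']]
        res.hom_closed[OF mpoly_mult_closed[OF a0(1) bc[OF F1(1)]]]
      by (simp add: res_add mpoly_mult_closed a_minus_def A.a_assoc A.r_neg)
    ultimately have "residue_class m I (msubst b F0) \<in> Q"
      unfolding a_minus_def using Q.a_closed Q.a_inv_closed by simp
    moreover have "msubst b F0 = msubst a F0"
      by (rule msubst_cong[OF _ F0]) (simp add: b_def)
    ultimately have F00: "F0 = 0" using a(2) F0 by (simp add: Q_def)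
    then have "residue_class m I a0 \<otimes>\<^bsub>quot_alg m I\<^esub> residue_class m I (msubst b F1) \<in> P"
      using Suc.prems(3) sF bc[OF F1(1)] a0(1) by (simp flip: res_mult)
    then have "residue_class m I (msubst b F1) \<in> P"
      using P.I_prime[of "residue_class m I a0" "residue_class m I (msubst b F1)"] z(2) a0
        res.hom_closed[OF bc[OF F1(1)]] res.hom_closed[OF a0(1)] by auto
    then have "F1 = 0" using Suc.IH F1 by blast
    then show ?case by (simp add: F F00)
  qed
  show ?case
  proof (intro exI[of _ b] conjI allI ballI impI b)
    fix F assume F: "F \<in> carrier (mpoly_ring {1..Suc j})" "residue_class m I (msubst b F) \<in> \<pp> (n - Suc j)"
    have "finite ((\<lambda>t. Poly_Mapping.lookup t (Suc j)) ` Poly_Mapping.keys F)" by simp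
    then obtain N where "(\<lambda>t. Poly_Mapping.lookup t (Suc j)) ` Poly_Mapping.keys F \<subseteq> {..<N}"
      unfolding finite_nat_set_iff_bounded by auto
    then show "F = 0" using main[of F N] F by (auto simp: P_def)
  qed
qed

lemma krull_dim_alg_independent:
  assumes dim: "krull_dim (quot_alg m I) = enat d" and d: "1 \<le> d"
  obtains a where "\<forall>i. a i \<in> carrier (x_ring m)"
    "\<forall>F\<in>carrier (mpoly_ring {1..d}). msubst a F \<in> I \<longrightarrow> F = 0"
proof -
  let ?C = "\<lambda>n \<pp>. (\<forall>i\<le>n. primeideal (\<pp> i) (quot_alg m I)) \<and> (\<forall>i<n. \<pp> i \<subset> \<pp> (Suc i))"
  \<comment> \<open>If every chain were shorter than \<open>d\<close>, the supremum would be at most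
    \<open>d - 1\<close>, which is less than \<open>d\<close> because \<open>1 \<le> d\<close>. A
    longer chain is cut off after \<open>d\<close> steps.\<close>
  have "\<exists>n \<pp>. d \<le> n \<and> ?C n \<pp>"
  proof (rule ccontr)
    assume "\<not> ?thesis"
    then have lt: "n < d" if "\<exists>\<pp>. ?C n \<pp>" for n using that not_less by blast
    have "x \<le> enat (d - 1)" if "x \<in> {enat n | n. \<exists>\<pp>. ?C n \<pp>}" for x
    proof -
      from that obtain n where n: "x = enat n \<and> (\<exists>\<pp>. ?C n \<pp>)"
        unfolding mem_Collect_eq by (rule exE)
      have "n < d" using n by (intro lt) (rule conjunct2)
      then show ?thesis using n by simp
    qed
    then have "krull_dim (quot_alg m I) \<le> enat (d - 1)"
      unfolding krull_dim_def by (rule Sup_least)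
    then show False using dim d by simp
  qed
  then obtain n \<pp> where n: "d \<le> n" and C1: "\<forall>i\<le>n. primeideal (\<pp> i) (quot_alg m I)"
    and C2: "\<forall>i<n. \<pp> i \<subset> \<pp> (Suc i)" by (elim exE conjE)
  have p0: "primeideal (\<pp> 0) (quot_alg m I)" by (rule C1[rule_format]) simp
  then have zero: "\<zero>\<^bsub>quot_alg m I\<^esub> \<in> \<pp> 0"
    using additive_subgroup.zero_closed ideal.axioms(1) primeideal.axioms(1) by blast
  have "\<exists>a. (\<forall>i. a i \<in> carrier (x_ring m)) \<and>
    (\<forall>F\<in>carrier (mpoly_ring {1..d}). residue_class m I (msubst a F) \<in> \<pp> (d - d) \<longrightarrow> F = 0)"
  proof (rule prime_chain_alg_independent)
    show "primeideal (\<pp> i) (quot_alg m I)" if "i \<le> d" for i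
      using that n by (intro C1[rule_format]) simp
    show "\<pp> i \<subset> \<pp> (Suc i)" if "i < d" for i
      using that n by (intro C2[rule_format]) simp
  qed simp
  then obtain a where a: "\<forall>i. a i \<in> carrier (x_ring m)"
    "\<forall>F\<in>carrier (mpoly_ring {1..d}). residue_class m I (msubst a F) \<in> \<pp> (d - d) \<longrightarrow> F = 0"
    by (elim exE conjE)
  have "F = 0" if "F \<in> carrier (mpoly_ring {1..d})" "msubst a F \<in> I" for F
  proof -
    have "residue_class m I (msubst a F) = residue_class m I 0"
      using that(2) by (subst res_eq_iff) (simp_all add: I_carr mpoly_zero_closed)
    then show ?thesis using a(2) that(1) zero by (simp add: res_zero)
  qed
  then show ?thesis using that[of a] a(1) by blast
qed

end

section \<open>Noether normalizations and reductions\<close>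

lemma mpoly_const_add: "mpoly_const (a + b) = mpoly_const a + mpoly_const b"
  by (simp add: mpoly_const_def single_add)

lemma mpoly_const_mult: "mpoly_const (a * b) = mpoly_const a * (mpoly_const b :: ('v, 'k::comm_ring_1) mpoly)"
  by (simp add: mpoly_const_def mult_single)

lemma mpoly_const_zero [simp]: "mpoly_const 0 = 0"
  by (simp add: mpoly_const_def)

lemma mpoly_const_one [simp]: "mpoly_const 1 = 1"
  by (simp add: mpoly_const_def)

lemma mpoly_const_sum:
  "mpoly_const (\<Sum>i\<in>A. c i) = (\<Sum>i\<in>A. mpoly_const (c i) :: ('v, 'k::comm_ring_1) mpoly)"
  by (induction A rule: infinite_finite_induct) (simp_all add: mpoly_const_add)

lemma forms_1_sum:
  fixes p :: "(nat, 'k::comm_ring_1) mpoly"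
  assumes p: "p \<in> forms {1..m} 1"
  shows "p = (\<Sum>i\<in>{1..m}. mpoly_const (Poly_Mapping.lookup p (Poly_Mapping.single i 1)) * mpoly_var i)"
proof (rule poly_mapping_eqI)
  fix t
  let ?s = "\<lambda>i. Poly_Mapping.single i (1::nat)"
  have "Poly_Mapping.lookup (\<Sum>i\<in>{1..m}. mpoly_const (Poly_Mapping.lookup p (?s i)) * mpoly_var i) t =
      (\<Sum>i\<in>{1..m}. if ?s i = t then Poly_Mapping.lookup p t else 0)"
    unfolding lookup_sum
    by (intro sum.cong) (auto simp: mpoly_const_def mpoly_var_def mult_single lookup_single when_def)
  also have "\<dots> = Poly_Mapping.lookup p t"
  proof (cases "t \<in> Poly_Mapping.keys p")
    case True
    then have "t \<in> monomials {1..m} (Suc 0)" using p by (auto simp: forms_def One_nat_def)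
    then obtain x s where xs: "x \<in> {1..m}" "s \<in> monomials {1..m} 0" "t = ?s x + s"
      by (rule monomials_Suc_split)
    then have t: "t = ?s x" by (simp add: monomials_def)
    have "?s i = t \<longleftrightarrow> i = x" for i unfolding t
      by (metis keys_single singleton_inject zero_neq_one)
    then show ?thesis using xs(1) by simp
  next
    case False
    then show ?thesis by (auto simp: in_keys_iff intro!: sum.neutral)
  qed
  finally show "Poly_Mapping.lookup p t =
    Poly_Mapping.lookup (\<Sum>i\<in>{1..m}. mpoly_const (Poly_Mapping.lookup p (?s i)) * mpoly_var i) t" ..
qed

section \<open>Evaluation in \<open>A\<close> and finiteness over \<open>k[y]\<close>\<close>

context homogeneous_presentation
begin

lemma res_closed: "p \<in> carrier (x_ring m) \<Longrightarrow> residue_class m I p \<in> carrier (quot_alg m I)"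
  by (rule res.hom_closed)

lemma res_pow:
  assumes "p \<in> carrier (x_ring m)"
  shows "residue_class m I (p ^ n) = residue_class m I p [^]\<^bsub>quot_alg m I\<^esub> (n::nat)"
proof (induction n)
  case 0
  then show ?case by (simp add: res_one)
next
  case (Suc n)
  have "residue_class m I (p ^ Suc n) = residue_class m I p \<otimes>\<^bsub>quot_alg m I\<^esub> residue_class m I (p ^ n)"
    using assms by (simp add: res_mult mpoly_power_closed)
  then show ?case using Suc res_closed[OF assms] by (simp add: A.m_comm)
qed

lemma res_prod:
  assumes "finite S" "\<And>i. i \<in> S \<Longrightarrow> p i \<in> carrier (x_ring m)"
  shows "residue_class m I (\<Prod>i\<in>S. p i) = (\<Otimes>\<^bsub>quot_alg m I\<^esub>i\<in>S. residue_class m I (p i))"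
  using assms
proof (induction S rule: finite_induct)
  case empty
  then show ?case by (simp add: res_one)
next
  case (insert i S)
  then show ?case
    by (simp add: res_mult mpoly_prod_closed A.finprod_insert res_closed)
qed

lemma res_sum:
  assumes "finite S" "\<And>i. i \<in> S \<Longrightarrow> p i \<in> carrier (x_ring m)"
  shows "residue_class m I (\<Sum>i\<in>S. p i) = (\<Oplus>\<^bsub>quot_alg m I\<^esub>i\<in>S. residue_class m I (p i))"
  using assms
proof (induction S rule: finite_induct)
  case empty
  then show ?case by (simp add: res_zero)
next
  case (insert i S)
  then show ?case
    by (simp add: res_add mpoly_sum_closed A.finsum_insert res_closed)
qed

abbreviation "res_const \<equiv> \<lambda>c. residue_class m I (mpoly_const c)"

text \<open>Translates evaluation in the record ring \<open>A\<close> into substitution of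
  representatives, so that independence and generated subalgebras become statements modulo
  \<open>I\<close>.\<close>

lemma eval_in_res:
  assumes w: "\<And>x. x \<in> X \<Longrightarrow> w x \<in> carrier (x_ring m)" and p: "p \<in> carrier (mpoly_ring X)"
  shows "eval_in (quot_alg m I) res_const (\<lambda>x. residue_class m I (w x)) p = residue_class m I (msubst w p)"
proof -
  have k: "w x \<in> carrier (x_ring m)" if "t \<in> Poly_Mapping.keys p" "x \<in> Poly_Mapping.keys t" for t x
    using that w p by (auto simp: mem_mpoly_ring)
  have mv: "monom_value w t \<in> carrier (x_ring m)" if "t \<in> Poly_Mapping.keys p" for t
    using k[OF that] by (rule monom_value_closed)
  have m1: "residue_class m I (monom_value w t) =
      (\<Otimes>\<^bsub>quot_alg m I\<^esub>x\<in>Poly_Mapping.keys t. residue_class m I (w x) [^]\<^bsub>quot_alg m I\<^esub> Poly_Mapping.lookup t x)"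
    if t: "t \<in> Poly_Mapping.keys p" for t
  proof -
    have "residue_class m I (monom_value w t) =
        (\<Otimes>\<^bsub>quot_alg m I\<^esub>x\<in>Poly_Mapping.keys t. residue_class m I (w x ^ Poly_Mapping.lookup t x))"
      unfolding monom_value_def using k[OF t] by (intro res_prod mpoly_power_closed) auto
    also have "\<dots> = (\<Otimes>\<^bsub>quot_alg m I\<^esub>x\<in>Poly_Mapping.keys t. residue_class m I (w x) [^]\<^bsub>quot_alg m I\<^esub> Poly_Mapping.lookup t x)"
      using k[OF t] by (intro A.finprod_cong') (auto simp: res_pow res_closed)
    finally show ?thesis .
  qed
  have "residue_class m I (msubst w p) = (\<Oplus>\<^bsub>quot_alg m I\<^esub>t\<in>Poly_Mapping.keys p.
      residue_class m I (mpoly_const (Poly_Mapping.lookup p t) * monom_value w t))"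
    unfolding evalg_def using mv by (intro res_sum mpoly_mult_closed mpoly_const_closed) auto
  also have "\<dots> = eval_in (quot_alg m I) res_const (\<lambda>x. residue_class m I (w x)) p"
    unfolding eval_in_def using mv
    by (intro A.finsum_cong') (auto simp: res_mult mpoly_const_closed res_closed simp flip: m1)
  finally show ?thesis ..
qed

lemma alg_independentI:
  assumes y: "\<And>i. i \<in> X \<Longrightarrow> y i \<in> carrier (x_ring m)"
    and indep: "\<And>F. F \<in> carrier (mpoly_ring X) \<Longrightarrow> msubst y F \<in> I \<Longrightarrow> F = 0"
  shows "alg_independent (quot_alg m I) res_const X (\<lambda>i. residue_class m I (y i))"
  unfolding alg_independent_def
proof (rule inj_onI)
  fix F G assume FG: "F \<in> carrier (mpoly_ring X)" "G \<in> carrier (mpoly_ring X)"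
    and "eval_in (quot_alg m I) res_const (\<lambda>i. residue_class m I (y i)) F =
      eval_in (quot_alg m I) res_const (\<lambda>i. residue_class m I (y i)) G"
  then have "residue_class m I (msubst y F) = residue_class m I (msubst y G)"
    using FG by (simp only: eval_in_res[of X y, OF y])
  then have "msubst y F - msubst y G \<in> I"
    using FG by (simp add: res_eq_iff msubst_closed[OF y])
  then have "msubst y (F - G) \<in> I" by (simp add: msubst.hom_minus)
  then have "F - G = 0" using FG by (intro indep mpoly_diff_closed)
  then show "F = G" by simp
qed

lemma gen_hcomp:
  assumes y: "\<And>i. i \<in> {1..d} \<Longrightarrow> y i \<in> forms {1..m} 1" and p: "p \<in> gen d y"
  shows "hcomp (Suc n) p \<in> gen d y"
proof -
  obtain q where q: "\<forall>i. q i \<in> carrier (x_ring m)" "p - (\<Sum>i\<in>{1..d}. y i * q i) \<in> I"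
    using p by (rule genE)
  have "hcomp (Suc n) (p - (\<Sum>i\<in>{1..d}. y i * q i)) = hcomp (Suc n) p - (\<Sum>i\<in>{1..d}. hcomp (Suc n) (y i * q i))"
    by (simp add: hcomp_diff hcomp_sum)
  also have "(\<Sum>i\<in>{1..d}. hcomp (Suc n) (y i * q i)) = (\<Sum>i\<in>{1..d}. y i * hcomp n (q i))"
    by (intro sum.cong) (simp_all add: hcomp_mult_form[OF y])
  finally have "hcomp (Suc n) p - (\<Sum>i\<in>{1..d}. y i * hcomp n (q i)) \<in> I"
    using hcomp_I[OF q(2), of "Suc n"] by simp
  moreover have "hcomp j r \<in> carrier (x_ring m)" if "r \<in> carrier (x_ring m)" for j r
    using hcomp_in_forms[OF that, of j] forms_subset_carrier by blast
  ultimately show ?thesis using q(1) gen_carr[OF p] by (intro genI[of _ "\<lambda>i. hcomp n (q i)"]) auto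
qed

text \<open>Monomials in \<open>y\<close> of positive degree lie in the ideal \<open>(y)\<close>, so
  modulo it an element of \<open>k[y]\<close> is a scalar. The Nakayama argument rests on
  this.\<close>

lemma msubst_minus_const_in_gen:
  assumes y: "\<And>i. i \<in> {1..d} \<Longrightarrow> y i \<in> carrier (x_ring m)" and F: "F \<in> carrier (mpoly_ring {1..d})"
  shows "msubst y F - mpoly_const (Poly_Mapping.lookup F 0) \<in> gen d y"
proof -
  have mv: "monom_value y t \<in> gen d y" if t: "t \<in> Poly_Mapping.keys F - {0}" for t
  proof -
    have "mdeg t \<noteq> 0" using t by simp
    then have "mdeg t = Suc (mdeg t - 1)" by (intro Suc_pred') (simp only: neq0_conv)
    then have "t \<in> monomials {1..d} (Suc (mdeg t - 1))"
      using t F by (auto simp: monomials_def mem_mpoly_ring)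
    then obtain x s where xs: "x \<in> {1..d}" "s \<in> monomials {1..d} (mdeg t - 1)" "t = Poly_Mapping.single x 1 + s"
      by (rule monomials_Suc_split)
    have "monom_value y s \<in> carrier (x_ring m)"
      using xs(2) y by (intro monom_value_closed) (auto simp: monomials_def)
    then have "monom_value y s * y x \<in> gen d y" using xs(1) y by (intro gen_mult gen_self)
    then show ?thesis by (simp add: xs(3) monom_value_add mult.commute)
  qed
  have "msubst y F = (\<Sum>t\<in>insert 0 (Poly_Mapping.keys F). mpoly_const (Poly_Mapping.lookup F t) * monom_value y t)"
    by (rule comm_ring_hom.evalg_superset[OF comm_ring_hom_mpoly_const]) auto
  also have "\<dots> = mpoly_const (Poly_Mapping.lookup F 0) +
      (\<Sum>t\<in>Poly_Mapping.keys F - {0}. mpoly_const (Poly_Mapping.lookup F t) * monom_value y t)"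
    by (subst sum.insert_remove) auto
  finally have "msubst y F - mpoly_const (Poly_Mapping.lookup F 0) =
      (\<Sum>t\<in>Poly_Mapping.keys F - {0}. mpoly_const (Poly_Mapping.lookup F t) * monom_value y t)" by simp
  also have "\<dots> \<in> gen d y" by (intro gen_sum gen_mult mv mpoly_const_closed)
  finally show ?thesis .
qed

text \<open>Let \<open>N\<close> bound the degrees of representatives of the module generators.
  Modulo \<open>(y)\<close> the coefficients collapse to constants, so a form of degree
  \<open>Suc N\<close> is congruent to an element of degree at most \<open>N\<close>. The component
  of degree \<open>Suc N\<close> of this congruence puts the form into \<open>(y)\<close>.\<close>

lemma finite_module_imp_covers:
  assumes y: "\<And>i. i \<in> {1..d} \<Longrightarrow> y i \<in> forms {1..m} 1"
    and fin: "finite_module_over (quot_alg m I)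
      (generated_subalgebra (quot_alg m I) res_const {1..d} (\<lambda>i. residue_class m I (y i)))"
  shows "\<exists>n. covers d y n"
proof -
  let ?B = "generated_subalgebra (quot_alg m I) res_const {1..d} (\<lambda>i. residue_class m I (y i))"
  have yc: "y i \<in> carrier (x_ring m)" if "i \<in> {1..d}" for i
    using y[OF that] forms_subset_carrier by blast
  have ev: "eval_in (quot_alg m I) res_const (\<lambda>i. residue_class m I (y i)) b = residue_class m I (msubst y b)"
    if "b \<in> carrier (mpoly_ring {1..d})" for b
    by (rule eval_in_res[OF yc that])
  from fin obtain G where G: "finite G" "G \<subseteq> carrier (quot_alg m I)"
    and sp: "\<forall>s\<in>carrier (quot_alg m I). \<exists>c. (\<forall>g\<in>G. c g \<in> ?B) \<and> s = (\<Oplus>\<^bsub>quot_alg m I\<^esub>g\<in>G. c g \<otimes>\<^bsub>quot_alg m I\<^esub> g)"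
    unfolding finite_module_over_def by (elim exE conjE)
  have "\<forall>g\<in>G. \<exists>h. h \<in> carrier (x_ring m) \<and> g = residue_class m I h"
    using G(2) by (auto simp: carrier_quot)
  from bchoice[OF this] obtain h where h: "\<forall>g\<in>G. h g \<in> carrier (x_ring m) \<and> g = residue_class m I (h g)"
    by (rule exE)
  obtain N where N: "\<forall>g\<in>G. deg_le N (h g)" using ex_deg_le[OF G(1), of h] by (rule exE)
  have "covers d y (Suc N)"
    unfolding covers_def
  proof
    fix p :: "(nat, 'k) mpoly"
    assume p: "p \<in> forms {1..m} (Suc N)"
    then have pc: "p \<in> carrier (x_ring m)" using forms_subset_carrier by blast
    from bspec[OF sp res_closed[OF pc]] obtain c where c: "\<forall>g\<in>G. c g \<in> ?B"
      "residue_class m I p = (\<Oplus>\<^bsub>quot_alg m I\<^esub>g\<in>G. c g \<otimes>\<^bsub>quot_alg m I\<^esub> g)"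
      by (elim exE conjE)
    have "\<forall>g\<in>G. \<exists>b. b \<in> carrier (mpoly_ring {1..d}) \<and> c g = residue_class m I (msubst y b)"
    proof
      fix g assume "g \<in> G"
      then have "c g \<in> ?B" using c(1) by blast
      then obtain b where "b \<in> carrier (mpoly_ring {1..d})"
        "c g = eval_in (quot_alg m I) res_const (\<lambda>i. residue_class m I (y i)) b"
        unfolding generated_subalgebra_def by (rule imageE)
      then show "\<exists>b. b \<in> carrier (mpoly_ring {1..d}) \<and> c g = residue_class m I (msubst y b)"
        by (intro exI[of _ b]) (simp add: ev)
    qed
    from bchoice[OF this] obtain b where
      b: "\<forall>g\<in>G. b g \<in> carrier (mpoly_ring {1..d}) \<and> c g = residue_class m I (msubst y (b g))" by (rule exE)
    have bc: "msubst y (b g) \<in> carrier (x_ring m)" if "g \<in> G" for g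
      using b that by (intro msubst_closed[of "{1..d}" y]) (auto intro: yc)
    have "residue_class m I (\<Sum>g\<in>G. msubst y (b g) * h g) =
        (\<Oplus>\<^bsub>quot_alg m I\<^esub>g\<in>G. residue_class m I (msubst y (b g) * h g))"
      using bc h by (intro res_sum G(1) mpoly_mult_closed) auto
    also have "\<dots> = (\<Oplus>\<^bsub>quot_alg m I\<^esub>g\<in>G. c g \<otimes>\<^bsub>quot_alg m I\<^esub> g)"
    proof (rule A.finsum_cong')
      show "(\<lambda>g. c g \<otimes>\<^bsub>quot_alg m I\<^esub> g) \<in> G \<rightarrow> carrier (quot_alg m I)"
        using b G(2) bc by (auto simp: res_closed)
      show "residue_class m I (msubst y (b g) * h g) = c g \<otimes>\<^bsub>quot_alg m I\<^esub> g" if "g \<in> G" for g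
        using b h bc[OF that] that by (simp add: res_mult)
    qed simp
    finally have "residue_class m I p = residue_class m I (\<Sum>g\<in>G. msubst y (b g) * h g)"
      using c(2) by simp
    then have pI: "p - (\<Sum>g\<in>G. msubst y (b g) * h g) \<in> I"
      using res_eq_iff[OF pc, of "\<Sum>g\<in>G. msubst y (b g) * h g"] bc h
      by (simp add: mpoly_sum_closed mpoly_mult_closed)
    let ?c = "\<lambda>g. mpoly_const (Poly_Mapping.lookup (b g) 0) :: (nat, 'k) mpoly"
    let ?r = "p - (\<Sum>g\<in>G. ?c g * h g)"
    have "h g * (msubst y (b g) - ?c g) \<in> gen d y" if "g \<in> G" for g
      using b h that by (intro gen_mult msubst_minus_const_in_gen[OF yc]) auto
    then have s: "(\<Sum>g\<in>G. h g * (msubst y (b g) - ?c g)) \<in> gen d y" by (rule gen_sum)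
    have "?r - (\<Sum>g\<in>G. h g * (msubst y (b g) - ?c g)) = p - (\<Sum>g\<in>G. msubst y (b g) * h g)"
      by (simp add: right_diff_distrib sum_subtractf mult.commute)
    then have rI: "?r - (\<Sum>g\<in>G. h g * (msubst y (b g) - ?c g)) \<in> I" using pI by (simp only:)
    have rc: "?r \<in> carrier (x_ring m)"
      using pc h by (intro mpoly_diff_closed mpoly_sum_closed mpoly_mult_closed mpoly_const_closed) auto
    have hr: "hcomp (Suc N) ?r \<in> gen d y" by (rule gen_hcomp[OF y gen_cong_I[OF s rc rI]])
    have "hcomp (Suc N) (?c g * h g) = 0" if "g \<in> G" for g
    proof -
      have "hcomp (Suc N) (h g) = 0"
        using N that by (intro poly_mapping_eqI) (force simp: lookup_hcomp deg_le_def in_keys_iff)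
      then show ?thesis by (simp add: hcomp_mult_form[OF forms_const])
    qed
    then have "hcomp (Suc N) ?r = p" using hcomp_form[OF p] by (simp add: hcomp_diff hcomp_sum)
    then show "p \<in> gen d y" using hr by simp
  qed
  then show ?thesis by (rule exI)
qed

text \<open>The monomials of degree at most \<open>n0\<close> generate: in higher degrees a form is,
  modulo \<open>I\<close>, a combination of the \<open>y i\<close> with coefficients of smaller
  degree.\<close>

lemma covers_imp_finite_module:
  assumes y: "\<And>i. i \<in> {1..d} \<Longrightarrow> y i \<in> forms {1..m} 1" and cov: "covers d y n0"
  shows "finite_module_over (quot_alg m I)
      (generated_subalgebra (quot_alg m I) res_const {1..d} (\<lambda>i. residue_class m I (y i)))"
proof -
  let ?B = "generated_subalgebra (quot_alg m I) res_const {1..d} (\<lambda>i. residue_class m I (y i))"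
  have yc: "y i \<in> carrier (x_ring m)" if "i \<in> {1..d}" for i
    using y[OF that] forms_subset_carrier by blast
  have ev: "eval_in (quot_alg m I) res_const (\<lambda>i. residue_class m I (y i)) b = residue_class m I (msubst y b)"
    if "b \<in> carrier (mpoly_ring {1..d})" for b
    by (rule eval_in_res[OF yc that])
  define n1 where "n1 = Suc n0"
  have cov1: "covers d y j" if "j \<ge> n1" for j
    using covers_mono[OF cov, of j] that by (simp add: n1_def)
  define M where "M = (\<Union>j<n1. monomials {1..m} j)"
  have M: "finite M" unfolding M_def using finite_monomials by auto
  let ?\<mu> = "\<lambda>g. residue_class m I (mpoly_mono g)"
  \<comment> \<open>\<open>finite_module_over\<close> sums over a set of elements of
    \<open>A\<close>, and distinct monomials may have equal residue classes; one monomial per class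
    is kept.\<close>
  have "\<exists>M'\<subseteq>M. inj_on ?\<mu> M' \<and> ?\<mu> ` M = ?\<mu> ` M'"
    using subset_image_inj[of "?\<mu> ` M" ?\<mu> M] by simp
  then obtain M' where M': "M' \<subseteq> M" "inj_on ?\<mu> M'" "?\<mu> ` M = ?\<mu> ` M'" by (elim exE conjE)
  have finM': "finite M'" using M M'(1) finite_subset by blast
  have mc: "mpoly_mono g \<in> carrier (x_ring m)" if "g \<in> M" for g
    using that by (auto simp: M_def monomials_def intro!: mpoly_mono_closed)
  \<comment> \<open>The preimage of the \<open>k[y]\<close>-submodule of \<open>A\<close> generated
    by the monomials that were kept.\<close>
  define W where "W = {p. \<exists>b. (\<forall>g. b g \<in> carrier (mpoly_ring {1..d})) \<and>
      p - (\<Sum>g\<in>M'. msubst y (b g) * mpoly_mono g) \<in> I}"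
  have WI: "p \<in> W" if "\<forall>g. b g \<in> carrier (mpoly_ring {1..d})"
    "p - (\<Sum>g\<in>M'. msubst y (b g) * mpoly_mono g) \<in> I" for p b
    using that unfolding W_def by (intro CollectI exI[of _ b] conjI)
  have WE: "\<exists>b. (\<forall>g. b g \<in> carrier (mpoly_ring {1..d})) \<and>
      p - (\<Sum>g\<in>M'. msubst y (b g) * mpoly_mono g) \<in> I" if "p \<in> W" for p
    using that unfolding W_def by (rule CollectD)
  have W_I: "p \<in> W" if "p \<in> I" for p
    by (rule WI[of "\<lambda>_. 0"]) (simp_all add: that mpoly_zero_closed)
  have W_add: "p + q \<in> W" if pq: "p \<in> W" "q \<in> W" for p q
  proof -
    from WE[OF pq(1)] obtain b where b: "\<forall>g. b g \<in> carrier (mpoly_ring {1..d})"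
      "p - (\<Sum>g\<in>M'. msubst y (b g) * mpoly_mono g) \<in> I" by (elim exE conjE)
    from WE[OF pq(2)] obtain b' where b': "\<forall>g. b' g \<in> carrier (mpoly_ring {1..d})"
      "q - (\<Sum>g\<in>M'. msubst y (b' g) * mpoly_mono g) \<in> I" by (elim exE conjE)
    have "p + q - (\<Sum>g\<in>M'. msubst y (b g + b' g) * mpoly_mono g) =
        (p - (\<Sum>g\<in>M'. msubst y (b g) * mpoly_mono g)) + (q - (\<Sum>g\<in>M'. msubst y (b' g) * mpoly_mono g))"
      by (simp add: msubst.hom_add distrib_right sum.distrib)
    then have "p + q - (\<Sum>g\<in>M'. msubst y (b g + b' g) * mpoly_mono g) \<in> I"
      using I_add[OF b(2) b'(2)] by (simp only:)
    then show ?thesis using b(1) b'(1) by (intro WI[of "\<lambda>g. b g + b' g"]) (simp_all add: mpoly_add_closed)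
  qed
  have W_mult: "msubst y c * p \<in> W" if p: "p \<in> W" and c: "c \<in> carrier (mpoly_ring {1..d})" for p c
  proof -
    from WE[OF p] obtain b where b: "\<forall>g. b g \<in> carrier (mpoly_ring {1..d})"
      "p - (\<Sum>g\<in>M'. msubst y (b g) * mpoly_mono g) \<in> I" by (elim exE conjE)
    have "msubst y c * p - (\<Sum>g\<in>M'. msubst y (c * b g) * mpoly_mono g) =
        msubst y c * (p - (\<Sum>g\<in>M'. msubst y (b g) * mpoly_mono g))"
      by (simp add: msubst.hom_mult right_diff_distrib sum_distrib_left mult.assoc)
    then have "msubst y c * p - (\<Sum>g\<in>M'. msubst y (c * b g) * mpoly_mono g) \<in> I"
      using I_mult[OF msubst_closed[OF yc c] b(2)] by (simp only:)
    then show ?thesis using b(1) c by (intro WI[of "\<lambda>g. c * b g"]) (simp_all add: mpoly_mult_closed)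
  qed
  have W_sum: "(\<Sum>i\<in>S. p i) \<in> W" if "\<And>i. i \<in> S \<Longrightarrow> p i \<in> W" for S :: "'z set" and p
    using that by (induction S rule: infinite_finite_induct) (auto intro: W_add W_I I_zero)
  have W_mono': "mpoly_mono g \<in> W" if g: "g \<in> M'" for g
  proof (rule WI[of "\<lambda>g'. if g' = g then 1 else 0"])
    have "(\<Sum>g'\<in>M'. msubst y (if g' = g then 1 else 0) * mpoly_mono g') =
        (\<Sum>g'\<in>M'. if g' = g then mpoly_mono g else 0)"
      by (intro sum.cong) auto
    then have "(\<Sum>g'\<in>M'. msubst y (if g' = g then 1 else 0) * mpoly_mono g') = mpoly_mono g"
      using finM' g by simp
    then show "mpoly_mono g - (\<Sum>g'\<in>M'. msubst y (if g' = g then 1 else 0) * mpoly_mono g') \<in> I"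
      by (simp only: diff_self I_zero)
  qed (simp add: mpoly_one_closed mpoly_zero_closed)
  have W_mono: "mpoly_mono g \<in> W" if g: "g \<in> M" for g
  proof -
    have "?\<mu> g \<in> ?\<mu> ` M'" using g M'(3) by blast
    then obtain g' where g': "g' \<in> M'" "?\<mu> g = ?\<mu> g'" by (elim imageE)
    have "mpoly_mono g - mpoly_mono g' \<in> I"
      using g' M'(1) g mc by (subst res_eq_iff[symmetric]) auto
    from W_add[OF W_I[OF this] W_mono'[OF g'(1)]] show ?thesis by simp
  qed
  have W_forms: "p \<in> W" if "p \<in> forms {1..m} j" for p j
    using that
  proof (induction j arbitrary: p rule: less_induct)
    case (less j)
    show ?case
    proof (cases "j < n1")
      case True
      have "msubst y (mpoly_const (Poly_Mapping.lookup p u)) * mpoly_mono u \<in> W" if "u \<in> monomials {1..m} j" for u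
        using True that by (intro W_mult W_mono mpoly_const_closed) (auto simp: M_def)
      then have "(\<Sum>u\<in>monomials {1..m} j. mpoly_const (Poly_Mapping.lookup p u) * mpoly_mono u) \<in> W"
        by (intro W_sum) simp
      then show ?thesis using forms_eq_sum[OF less.prems] by simp
    next
      case False
      then obtain j' where j': "j = Suc j'" by (cases j) (auto simp: n1_def)
      have pg: "p \<in> gen d y" using cov1[of j] False less.prems unfolding covers_def by auto
      obtain q where q: "\<forall>i. q i \<in> forms {1..m} j'" "p - (\<Sum>i\<in>{1..d}. y i * q i) \<in> I"
        by (rule gen_homogeneous[OF y pg less.prems[unfolded j']])
      have "msubst y (mpoly_var i) * q i \<in> W" if "i \<in> {1..d}" for i
        using q(1) that by (intro W_mult less.IH[of j'] mpoly_var_closed) (auto simp: j')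
      then have "(\<Sum>i\<in>{1..d}. y i * q i) \<in> W" by (intro W_sum) simp
      from W_add[OF this W_I[OF q(2)]] show ?thesis by simp
    qed
  qed
  have W_all: "p \<in> W" if "p \<in> carrier (x_ring m)" for p
  proof -
    have "p = (\<Sum>j\<in>mdeg ` Poly_Mapping.keys p. hcomp j p)" by (rule sum_hcomp) auto
    moreover have "(\<Sum>j\<in>mdeg ` Poly_Mapping.keys p. hcomp j p) \<in> W"
      by (rule W_sum) (rule W_forms[OF hcomp_in_forms[OF that]])
    ultimately show ?thesis by simp
  qed
  show ?thesis
    unfolding finite_module_over_def
  proof (intro exI[of _ "?\<mu> ` M'"] conjI ballI)
    show "finite (?\<mu> ` M')" using finM' by simp
    show "?\<mu> ` M' \<subseteq> carrier (quot_alg m I)" using M'(1) mc by (auto intro: res_closed)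
    fix s assume "s \<in> carrier (quot_alg m I)"
    then obtain p where p: "s = residue_class m I p" "p \<in> carrier (x_ring m)"
      unfolding carrier_quot by (rule imageE)
    from WE[OF W_all[OF p(2)]] obtain b where b: "\<forall>g. b g \<in> carrier (mpoly_ring {1..d})"
      "p - (\<Sum>g\<in>M'. msubst y (b g) * mpoly_mono g) \<in> I" by (elim exE conjE)
    have bc: "msubst y (b g) \<in> carrier (x_ring m)" for g
      using b(1) by (intro msubst_closed[of "{1..d}" y]) (auto intro: yc)
    have mc': "mpoly_mono g \<in> carrier (x_ring m)" if "g \<in> M'" for g using that M'(1) mc by blast
    define c where "c s = residue_class m I (msubst y (b (the_inv_into M' ?\<mu> s)))" for s
    have c: "c (?\<mu> g) = residue_class m I (msubst y (b g))" if "g \<in> M'" for g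
      using that by (simp add: c_def the_inv_into_f_f[OF M'(2)])
    have e: "residue_class m I (msubst y (b g) * mpoly_mono g) = c (?\<mu> g) \<otimes>\<^bsub>quot_alg m I\<^esub> ?\<mu> g"
      if "g \<in> M'" for g unfolding c[OF that] by (rule res_mult[OF bc mc'[OF that]])
    have cl: "c (?\<mu> g) \<otimes>\<^bsub>quot_alg m I\<^esub> ?\<mu> g \<in> carrier (quot_alg m I)" if "g \<in> M'" for g
      unfolding c[OF that] by (intro A.m_closed res_closed bc mc' that)
    have "s = residue_class m I (\<Sum>g\<in>M'. msubst y (b g) * mpoly_mono g)"
      unfolding p(1) using b(2) p(2) bc mc'
      by (subst res_eq_iff) (auto intro!: mpoly_sum_closed mpoly_mult_closed)
    also have "\<dots> = (\<Oplus>\<^bsub>quot_alg m I\<^esub>g\<in>M'. residue_class m I (msubst y (b g) * mpoly_mono g))"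
      using bc mc' by (intro res_sum finM' mpoly_mult_closed) auto
    also have "\<dots> = (\<Oplus>\<^bsub>quot_alg m I\<^esub>g\<in>M'. c (?\<mu> g) \<otimes>\<^bsub>quot_alg m I\<^esub> ?\<mu> g)"
      using e cl by (intro A.finsum_cong') auto
    also have "\<dots> = (\<Oplus>\<^bsub>quot_alg m I\<^esub>z\<in>?\<mu> ` M'. c z \<otimes>\<^bsub>quot_alg m I\<^esub> z)"
      using cl by (intro A.finsum_reindex[symmetric] M'(2)) auto
    finally have s: "s = (\<Oplus>\<^bsub>quot_alg m I\<^esub>z\<in>?\<mu> ` M'. c z \<otimes>\<^bsub>quot_alg m I\<^esub> z)" .
    have "c z \<in> ?B" if "z \<in> ?\<mu> ` M'" for z
    proof -
      from that obtain g where g: "z = ?\<mu> g" "g \<in> M'" by (rule imageE)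
      have "c z = eval_in (quot_alg m I) res_const (\<lambda>i. residue_class m I (y i)) (b g)"
        using b(1) by (simp add: g c ev)
      then show ?thesis unfolding generated_subalgebra_def using b(1) by blast
    qed
    then show "\<exists>c. (\<forall>z\<in>?\<mu> ` M'. c z \<in> ?B) \<and> s = (\<Oplus>\<^bsub>quot_alg m I\<^esub>z\<in>?\<mu> ` M'. c z \<otimes>\<^bsub>quot_alg m I\<^esub> z)"
      using s by (intro exI[of _ c] conjI ballI)
  qed
qed

lemma noether_normalization_iff_covers:
  assumes dim: "krull_dim (quot_alg m I) = enat d" "1 \<le> d"
    and y: "\<And>i. i \<in> {1..d} \<Longrightarrow> y i \<in> forms {1..m} 1"
  shows "noether_normalization (quot_alg m I) res_const {1..d} (\<lambda>i. residue_class m I (y i)) \<longleftrightarrow>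
    (\<exists>n. covers d y n)"
proof
  assume "noether_normalization (quot_alg m I) res_const {1..d} (\<lambda>i. residue_class m I (y i))"
  then show "\<exists>n. covers d y n"
    unfolding noether_normalization_def by (intro finite_module_imp_covers y) auto
next
  assume "\<exists>n. covers d y n"
  then obtain n where n: "covers d y n" by (rule exE)
  obtain a where a: "\<forall>i. a i \<in> carrier (x_ring m)"
    "\<forall>F\<in>carrier (mpoly_ring {1..d}). msubst a F \<in> I \<longrightarrow> F = 0"
    by (rule krull_dim_alg_independent[OF dim])
  have yc: "y i \<in> carrier (x_ring m)" if "i \<in> {1..d}" for i
    using y[OF that] forms_subset_carrier by blast
  have "alg_independent (quot_alg m I) res_const {1..d} (\<lambda>i. residue_class m I (y i))"
  proof (rule alg_independentI[OF yc])
    fix F assume "F \<in> carrier (mpoly_ring {1..d})" "msubst y F \<in> I"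
    then show "F = 0" using covers_alg_independent[of d y n a F] y n a by blast
  qed
  then show "noether_normalization (quot_alg m I) res_const {1..d} (\<lambda>i. residue_class m I (y i))"
    unfolding noether_normalization_def using covers_imp_finite_module[OF y n] by blast
qed

end

lemma linear_form_forms: "linear_form m \<alpha> i \<in> forms {1..m} 1"
  unfolding linear_form_def
proof (rule forms_sum)
  fix j assume "j \<in> {1..m}"
  then show "mpoly_const (\<alpha> (i, j)) * mpoly_var j \<in> forms {1..m} 1"
    using forms_mult[OF forms_const forms_var] by (simp only: add_0)
qed

lemma mpoly_var_nonzero: "mpoly_var x \<noteq> (0 :: ('v, 'k::comm_ring_1) mpoly)"
proof
  assume "mpoly_var x = (0 :: ('v, 'k) mpoly)"
  then have "Poly_Mapping.lookup (mpoly_var x :: ('v, 'k) mpoly) (Poly_Mapping.single x 1) = 0" by simp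
  then show False by (simp add: mpoly_var_def)
qed

section \<open>Reductions as ideals generated by linear forms\<close>

context homogeneous_presentation
begin

lemma gen_reduction:
  assumes y: "\<And>i. i \<in> {1..d} \<Longrightarrow> y i \<in> forms {1..m} 1"
  shows "is_reduction m I (residue_class m I ` gen d y) \<longleftrightarrow> (\<exists>n. covers d y n)"
proof -
  have yc: "y i \<in> carrier (x_ring m)" if "i \<in> {1..d}" for i
    using y[OF that] forms_subset_carrier by blast
  have "\<exists>L\<subseteq>graded_part m I 1. residue_class m I ` gen d y = genideal (quot_alg m I) L"
    using y genideal_res_family[OF yc, symmetric]
    by (intro exI[of _ "(\<lambda>i. residue_class m I (y i)) ` {1..d}"]) (auto simp: graded_part_def)
  moreover have "(\<exists>n0. \<forall>n\<ge>n0. covers d y n) \<longleftrightarrow> (\<exists>n. covers d y n)"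
    using covers_mono by blast
  ultimately show ?thesis unfolding is_reduction_def res_gen_degree_part by blast
qed

lemma reduction_number_gen:
  "reduction_number m I (residue_class m I ` gen d y) = (LEAST n. covers d y (n + 1))"
  unfolding reduction_number_def res_gen_degree_part ..

text \<open>The set \<open>L\<close> may be infinite; an echelon form of the space of coefficient
  vectors replaces it by \<open>d\<close> generators, with zeros at the non-pivots. The dichotomy is
  what matters: either some generator is zero or every \<open>y i\<close> lies in the ideal. It is
  applied to \<open>y\<close> for minimality and to the variables for parametrising all
  reductions.\<close>

lemma linear_ideal_parametrisation:
  assumes y: "\<And>i. i \<in> {1..d} \<Longrightarrow> y i \<in> forms {1..m} 1"
    and L: "L \<subseteq> carrier (quot_alg m I)"
    and lin: "\<And>l. l \<in> L \<Longrightarrow> \<exists>c. l = residue_class m I (\<Sum>i\<in>{1..d}. mpoly_const (c i) * y i)"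
  shows "\<exists>T\<subseteq>{1..d}. \<exists>\<beta>. (\<forall>i\<in>{1..d} - T. \<forall>j. \<beta> (i, j) = 0) \<and>
    genideal (quot_alg m I) L = residue_class m I ` gen d (\<lambda>i. \<Sum>j\<in>{1..d}. mpoly_const (\<beta> (i, j)) * y j) \<and>
    (T = {1..d} \<longrightarrow> (\<forall>i\<in>{1..d}. residue_class m I (y i) \<in> genideal (quot_alg m I) L))"
proof -
  let ?Q = "genideal (quot_alg m I) L"
  let ?lc = "\<lambda>c. \<Sum>i\<in>{1..d}. mpoly_const (c i) * y i"
  have yc: "y i \<in> carrier (x_ring m)" if "i \<in> {1..d}" for i
    using y[OF that] forms_subset_carrier by blast
  have lcc: "?lc c \<in> carrier (x_ring m)" for c
    using yc by (intro mpoly_sum_closed mpoly_mult_closed mpoly_const_closed)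
  interpret Q: ideal ?Q "quot_alg m I" by (rule A.genideal_ideal[OF L])
  \<comment> \<open>The coefficient vectors of combinations of \<open>y\<close> lying in the ideal;
    they form a subspace even if the classes of the \<open>y i\<close> are linearly
    dependent.\<close>
  define C where "C = {c :: nat \<Rightarrow> 'k. (\<forall>i. i \<notin> {1..d} \<longrightarrow> c i = 0) \<and> residue_class m I (?lc c) \<in> ?Q}"
  have "\<exists>T\<subseteq>{1..d}. \<exists>b. (\<forall>t\<in>T. b t \<in> C) \<and> (\<forall>u\<in>C. \<exists>c. u = (\<lambda>s. \<Sum>t\<in>T. c t * b t s)) \<and>
    (T = {1..d} \<longrightarrow> C = {u. \<forall>s. s \<notin> {1..d} \<longrightarrow> u s = 0})"
  proof (rule coordinate_subspace_spanned)
    show "(\<lambda>_. 0) \<in> C" using Q.zero_closed by (simp add: C_def res_zero)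
    show "u s = 0" if "u \<in> C" "s \<notin> {1..d}" for u s using that unfolding C_def by blast
    fix u v a assume u: "u \<in> C" and v: "v \<in> C"
    have "?lc (\<lambda>s. u s + a * v s) = ?lc u + mpoly_const a * ?lc v"
      by (simp add: mpoly_const_add mpoly_const_mult distrib_right sum.distrib sum_distrib_left mult.assoc)
    then have "residue_class m I (?lc (\<lambda>s. u s + a * v s)) =
        residue_class m I (?lc u) \<oplus>\<^bsub>quot_alg m I\<^esub> (residue_class m I (mpoly_const a) \<otimes>\<^bsub>quot_alg m I\<^esub> residue_class m I (?lc v))"
      using lcc by (simp only: res_add res_mult mpoly_mult_closed mpoly_const_closed)
    also have "\<dots> \<in> ?Q"
      using u v by (intro Q.a_closed Q.I_l_closed res_closed mpoly_const_closed) (simp_all add: C_def)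
    finally show "(\<lambda>s. u s + a * v s) \<in> C" using u v by (simp add: C_def)
  qed simp
  then obtain T b where T: "T \<subseteq> {1..d}" and b: "\<forall>t\<in>T. b t \<in> C"
    and span: "\<forall>u\<in>C. \<exists>c. u = (\<lambda>s. \<Sum>t\<in>T. c t * b t s)"
    and full: "T = {1..d} \<longrightarrow> C = {u. \<forall>s. s \<notin> {1..d} \<longrightarrow> u s = 0}"
    by (elim exE conjE)
  define \<beta> where "\<beta> = (\<lambda>(i, j). if i \<in> T then b i j else 0)"
  let ?w = "\<lambda>i. ?lc (\<lambda>j. \<beta> (i, j))"
  have wT: "?w i = ?lc (b i)" if "i \<in> T" for i using that by (simp add: \<beta>_def)
  have w0: "?w i = 0" if "i \<notin> T" for i using that by (simp add: \<beta>_def)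
  have wc: "?w i \<in> carrier (x_ring m)" for i by (rule lcc)
  have finT: "finite T" using T finite_subset by blast
  have "?Q \<subseteq> residue_class m I ` gen d ?w"
  proof (rule A.genideal_minimal[OF ideal_res_gen], rule subsetI)
    fix l assume l: "l \<in> L"
    from lin[OF l] obtain c0 where c0: "l = residue_class m I (?lc c0)" by (rule exE)
    define c where "c i = (if i \<in> {1..d} then c0 i else 0)" for i
    have lcc0: "?lc c = ?lc c0" by (intro sum.cong) (simp_all add: c_def)
    have lQ: "l \<in> ?Q" using l A.genideal_self[OF L] by blast
    have "c \<in> C" unfolding C_def mem_Collect_eq lcc0 c0[symmetric] using lQ by (simp add: c_def)
    from bspec[OF span this] obtain a where a: "c = (\<lambda>s. \<Sum>t\<in>T. a t * b t s)" by (rule exE)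
    have "?lc c = (\<Sum>t\<in>T. mpoly_const (a t) * ?lc (b t))"
      unfolding a mpoly_const_sum mpoly_const_mult sum_distrib_left sum_distrib_right mult.assoc
      by (rule sum.swap)
    also have "\<dots> = (\<Sum>t\<in>T. mpoly_const (a t) * ?w t)" by (intro sum.cong) (simp_all only: wT)
    also have "\<dots> \<in> gen d ?w"
    proof (rule gen_sum)
      fix t assume "t \<in> T"
      then have "?w t \<in> gen d ?w" using T by (intro gen_self wc) blast
      then show "mpoly_const (a t) * ?w t \<in> gen d ?w" by (rule gen_mult[OF _ mpoly_const_closed])
    qed
    finally show "l \<in> residue_class m I ` gen d ?w" unfolding c0 lcc0[symmetric] by (rule imageI)
  qed
  moreover have "residue_class m I ` gen d ?w \<subseteq> ?Q"
    unfolding genideal_res_family[of d ?w, OF wc, symmetric]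
  proof (rule A.genideal_minimal[OF Q.is_ideal], rule image_subsetI)
    fix i
    show "residue_class m I (?w i) \<in> ?Q"
    proof (cases "i \<in> T")
      case True
      then have "b i \<in> C" using b by blast
      then show ?thesis unfolding wT[OF True] C_def by blast
    next
      case False
      show ?thesis unfolding w0[OF False] res_zero by (rule Q.zero_closed)
    qed
  qed
  ultimately have eq: "?Q = residue_class m I ` gen d ?w" by (rule subset_antisym)
  have "residue_class m I (y i) \<in> ?Q" if TT: "T = {1..d}" and i: "i \<in> {1..d}" for i
  proof -
    let ?u = "\<lambda>j. if j = i then 1 else (0 :: 'k)"
    have "?u \<in> {u. \<forall>s. s \<notin> {1..d} \<longrightarrow> u s = 0}" using i by auto
    then have uC: "?u \<in> C" using full TT by simp
    have "?lc ?u = (\<Sum>j\<in>{1..d}. if j = i then y i else 0)" by (intro sum.cong) auto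
    then have "?lc ?u = y i" using i by simp
    moreover have "residue_class m I (?lc ?u) \<in> ?Q" using uC unfolding C_def by blast
    ultimately show ?thesis by simp
  qed
  then show ?thesis using T eq
    by (intro exI[of _ T] conjI exI[of _ \<beta>]) (auto simp: \<beta>_def)
qed

text \<open>A reduction strictly inside \<open>(y\<^sub>1,\<dots>,y\<^sub>d)\<close> would be generated by fewer than \<open>d\<close> linear forms;
  padded by zeros they would be algebraically dependent.\<close>

lemma minimal_reduction:
  assumes dim: "krull_dim (quot_alg m I) = enat d" "1 \<le> d"
    and y: "\<And>i. i \<in> {1..d} \<Longrightarrow> y i \<in> forms {1..m} 1" and cov: "covers d y n"
  shows "is_minimal_reduction m I (residue_class m I ` gen d y)"
  unfolding is_minimal_reduction_def
proof (intro conjI allI impI)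
  let ?Q = "residue_class m I ` gen d y"
  have yc: "y i \<in> carrier (x_ring m)" if "i \<in> {1..d}" for i
    using y[OF that] forms_subset_carrier by blast
  have "is_reduction m I ?Q \<longleftrightarrow> (\<exists>n. covers d y n)" by (rule gen_reduction[OF y])
  then show "is_reduction m I ?Q" using cov by blast
  fix Q' assume "is_reduction m I Q' \<and> Q' \<subseteq> ?Q"
  then have red: "is_reduction m I Q'" and sub: "Q' \<subseteq> ?Q" by auto
  from red obtain L where L: "L \<subseteq> graded_part m I 1" and Q': "Q' = genideal (quot_alg m I) L"
    unfolding is_reduction_def by (elim exE conjE)
  have Lc: "L \<subseteq> carrier (quot_alg m I)"
    using L forms_subset_carrier[of "{1..m}" 1] by (auto simp: graded_part_def carrier_quot)
  \<comment> \<open>In a linear form inside \<open>(y)\<close> the multipliers can be taken of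
    degree 0, so modulo \<open>I\<close> it is a \<open>k\<close>-combination of the
    \<open>y i\<close>.\<close>
  have lin: "\<exists>c. l = residue_class m I (\<Sum>i\<in>{1..d}. mpoly_const (c i) * y i)" if l: "l \<in> L" for l
  proof -
    obtain p where p: "p \<in> forms {1..m} 1" "l = residue_class m I p"
      using L l unfolding graded_part_def by blast
    have pc: "p \<in> carrier (x_ring m)" using p(1) forms_subset_carrier by blast
    have "l \<in> ?Q" using l sub A.genideal_self[OF Lc] unfolding Q' by blast
    then have pg: "p \<in> gen d y" using res_in_res_gen[OF pc] p(2) by simp
    have p1: "p \<in> forms {1..m} (Suc 0)" using p(1) by (simp add: One_nat_def)
    obtain q where q: "\<forall>i. q i \<in> forms {1..m} 0" "p - (\<Sum>i\<in>{1..d}. y i * q i) \<in> I"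
      by (rule gen_homogeneous[of d y p 0, OF y pg p1])
    define c where "c i = Poly_Mapping.lookup (q i) 0" for i
    have qc: "q i = mpoly_const (c i)" for i
      unfolding c_def using q(1) by (intro forms_0_const) blast
    have "p - (\<Sum>i\<in>{1..d}. mpoly_const (c i) * y i) \<in> I"
      using q(2) by (simp add: qc mult.commute)
    moreover have "(\<Sum>i\<in>{1..d}. mpoly_const (c i) * y i) \<in> carrier (x_ring m)"
      using yc by (intro mpoly_sum_closed mpoly_mult_closed mpoly_const_closed)
    ultimately have "l = residue_class m I (\<Sum>i\<in>{1..d}. mpoly_const (c i) * y i)"
      using pc p(2) by (simp add: res_eq_iff)
    then show ?thesis by (rule exI[of _ c])
  qed
  have "\<exists>T\<subseteq>{1..d}. \<exists>\<beta>. (\<forall>i\<in>{1..d} - T. \<forall>j. \<beta> (i, j) = 0) \<and>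
    genideal (quot_alg m I) L = residue_class m I ` gen d (\<lambda>i. \<Sum>j\<in>{1..d}. mpoly_const (\<beta> (i, j)) * y j) \<and>
    (T = {1..d} \<longrightarrow> (\<forall>i\<in>{1..d}. residue_class m I (y i) \<in> genideal (quot_alg m I) L))"
    by (rule linear_ideal_parametrisation[OF y Lc lin])
  then obtain T \<beta> where T: "T \<subseteq> {1..d}" and \<beta>: "\<forall>i\<in>{1..d} - T. \<forall>j. \<beta> (i, j) = 0"
    and Qw: "genideal (quot_alg m I) L = residue_class m I ` gen d (\<lambda>i. \<Sum>j\<in>{1..d}. mpoly_const (\<beta> (i, j)) * y j)"
    and full: "T = {1..d} \<longrightarrow> (\<forall>i\<in>{1..d}. residue_class m I (y i) \<in> genideal (quot_alg m I) L)"
    by (elim exE conjE)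
  let ?w = "\<lambda>i. \<Sum>j\<in>{1..d}. mpoly_const (\<beta> (i, j)) * y j"
  have w: "?w i \<in> forms {1..m} 1" for i
    by (rule forms_sum) (use forms_mult[OF forms_const y] in simp)
  show "Q' = ?Q"
  proof (cases "T = {1..d}")
    case True
    have "?Q = genideal (quot_alg m I) ((\<lambda>i. residue_class m I (y i)) ` {1..d})"
      by (rule genideal_res_family[OF yc, symmetric])
    also have "\<dots> \<subseteq> Q'"
      unfolding Q' using full True by (intro A.genideal_minimal A.genideal_ideal Lc) auto
    finally have "?Q \<subseteq> Q'" .
    then show ?thesis using sub by blast
  next
    case False
    then obtain i0 where i0: "i0 \<in> {1..d}" "i0 \<notin> T" using T by blast
    then have wi0: "?w i0 = 0" using \<beta> by simp
    have "is_reduction m I (residue_class m I ` gen d ?w) \<longleftrightarrow> (\<exists>n. covers d ?w n)"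
      by (rule gen_reduction[OF w])
    then obtain n where n: "covers d ?w n" using red unfolding Q' Qw by blast
    obtain a where a: "\<forall>i. a i \<in> carrier (x_ring m)"
      "\<forall>F\<in>carrier (mpoly_ring {1..d}). msubst a F \<in> I \<longrightarrow> F = 0"
      by (rule krull_dim_alg_independent[OF dim])
    \<comment> \<open>The variable \<open>i0\<close> is a relation of \<open>?w\<close>, whose
      member at \<open>i0\<close> is zero, whereas the counting lemma forces every relation of
      \<open>?w\<close> to vanish.\<close>
    have "mpoly_var i0 = (0 :: (nat, 'k) mpoly)"
    proof (rule covers_alg_independent[of d ?w n a])
      show "msubst ?w (mpoly_var i0) \<in> I" unfolding msubst_var wi0 by (rule I_zero)
      show "mpoly_var i0 \<in> carrier (mpoly_ring {1..d})" by (rule mpoly_var_closed[OF i0(1)])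
    qed (use w n a in blast)+
    then show ?thesis by (rule notE[OF mpoly_var_nonzero])
  qed
qed

text \<open>The number \<open>m\<close> of forms does not depend on the reduction, so all reductions
  get parameters in one space, on which the loci of the \<open>J_n\<close> can be compared.\<close>

lemma reduction_parametrisation:
  assumes "is_reduction m I Q"
  shows "\<exists>\<beta>. Q = residue_class m I ` gen m (linear_form m \<beta>)"
proof -
  from assms obtain L where L: "L \<subseteq> graded_part m I 1" and Q: "Q = genideal (quot_alg m I) L"
    unfolding is_reduction_def by (elim exE conjE)
  have Lc: "L \<subseteq> carrier (quot_alg m I)"
    using L forms_subset_carrier[of "{1..m}" 1] by (auto simp: graded_part_def carrier_quot)
  have lin: "\<exists>c. l = residue_class m I (\<Sum>i\<in>{1..m}. mpoly_const (c i) * mpoly_var i)" if l: "l \<in> L" for l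
  proof -
    obtain p where p: "p \<in> forms {1..m} 1" "l = residue_class m I p"
      using L l unfolding graded_part_def by blast
    show ?thesis unfolding p(2)
      by (intro exI[of _ "\<lambda>i. Poly_Mapping.lookup p (Poly_Mapping.single i 1)"]
          arg_cong[of _ _ "residue_class m I"] forms_1_sum p(1))
  qed
  have "\<exists>T\<subseteq>{1..m}. \<exists>\<beta>. (\<forall>i\<in>{1..m} - T. \<forall>j. \<beta> (i, j) = 0) \<and>
    genideal (quot_alg m I) L = residue_class m I ` gen m (\<lambda>i. \<Sum>j\<in>{1..m}. mpoly_const (\<beta> (i, j)) * mpoly_var j) \<and>
    (T = {1..m} \<longrightarrow> (\<forall>i\<in>{1..m}. residue_class m I (mpoly_var i) \<in> genideal (quot_alg m I) L))"
    by (rule linear_ideal_parametrisation[OF forms_var Lc lin])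
  then obtain T \<beta> where "T \<subseteq> {1..m}" "\<forall>i\<in>{1..m} - T. \<forall>j. \<beta> (i, j) = 0" and
    \<beta>: "genideal (quot_alg m I) L = residue_class m I ` gen m (\<lambda>i. \<Sum>j\<in>{1..m}. mpoly_const (\<beta> (i, j)) * mpoly_var j)"
    by (elim exE conjE)
  show ?thesis unfolding Q linear_form_def by (rule exI[of _ \<beta>], rule \<beta>)
qed

text \<open>Makes conditions on \<open>\<alpha>\<close> depend on the projective point only.\<close>

lemma gen_proportional:
  assumes "c \<noteq> 0" "\<beta> = (\<lambda>x. c * \<alpha> x)"
  shows "gen d (linear_form m \<beta>) = gen d (linear_form m \<alpha>)"
proof -
  have sub: "gen d (linear_form m (\<lambda>x. c * \<alpha> x)) \<subseteq> gen d (linear_form m \<alpha>)" for c \<alpha>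
  proof (rule gen_subsetI)
    fix i assume i: "i \<in> {1..d}"
    have "linear_form m (\<lambda>x. c * \<alpha> x) i = mpoly_const c * linear_form m \<alpha> i"
      by (simp add: linear_form_def mpoly_const_mult sum_distrib_left mult.assoc)
    moreover have "linear_form m \<alpha> i \<in> carrier (x_ring m)"
      using linear_form_forms forms_subset_carrier by blast
    ultimately show "linear_form m (\<lambda>x. c * \<alpha> x) i \<in> gen d (linear_form m \<alpha>)"
      using i by (simp only:) (intro gen_mult gen_self mpoly_const_closed)
  qed
  have "\<alpha> = (\<lambda>x. inverse c * \<beta> x)" using assms by (auto simp: fun_eq_iff)
  then have "gen d (linear_form m \<alpha>) \<subseteq> gen d (linear_form m \<beta>)"
    using sub[of "inverse c" \<beta>] by simp
  then show ?thesis using sub[of c \<alpha>] assms(2) by blast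
qed

end

section \<open>The matrices \<open>M\<^sub>n(u)\<close>\<close>

text \<open>Stars and bars. The binomial coefficient in \<open>J_ideal\<close> is thus the number of
  columns, so every minor in question uses all of them. For \<open>m = 0\<close> the truncated
  \<open>m - 1\<close> would spoil the formula in positive degrees.\<close>

lemma card_monomials:
  assumes m: "1 \<le> m"
  shows "card (monomials {1..m} n) = (n + m - 1) choose (m - 1)"
proof -
  let ?L = "{l :: nat list. size l = m \<and> sum_list l = n}"
  let ?h = "\<lambda>t. map (Poly_Mapping.lookup t) [1..<Suc m]"
  let ?g = "\<lambda>l. \<Sum>x\<in>{1..m}. Poly_Mapping.single x (l ! (x - 1))"
  have set: "set [1..<Suc m] = {1..m}" by auto
  have sum: "sum_list (map F [1..<Suc m]) = sum F {1..m}" for F :: "nat \<Rightarrow> nat"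
    by (simp only: sum_list_distinct_conv_sum_set[OF distinct_upt] set)
  have deg: "mdeg t = sum_list (?h t)" if "Poly_Mapping.keys t \<subseteq> {1..m}" for t
    unfolding sum by (rule mdeg_superset) (use that in auto)
  have kg: "Poly_Mapping.keys (?g l) \<subseteq> {1..m}" for l
    by (auto simp: in_keys_iff lookup_sum_single split: if_splits)
  have hg: "?h (?g l) = l" if "size l = m" for l
  proof (rule nth_equalityI)
    fix i assume "i < length (?h (?g l))"
    then have i: "i < m" by (simp del: upt_Suc)
    then have "[1..<Suc m] ! i = 1 + i" by (intro nth_upt) simp
    then show "?h (?g l) ! i = l ! i" using i by (simp add: lookup_sum_single del: upt_Suc)
  qed (simp add: that)
  have "bij_betw ?h (monomials {1..m} n) ?L"
  proof (rule bij_betw_byWitness[where f' = ?g])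
    show "\<forall>t\<in>monomials {1..m} n. ?g (?h t) = t"
    proof
      fix t assume t: "t \<in> monomials {1..m} n"
      show "?g (?h t) = t"
      proof (rule poly_mapping_eqI)
        fix x
        show "Poly_Mapping.lookup (?g (?h t)) x = Poly_Mapping.lookup t x"
        proof (cases "x \<in> {1..m}")
          case True
          then have "[1..<Suc m] ! (x - 1) = x" by (subst nth_upt) auto
          moreover have "x - 1 < length [1..<Suc m]" using True by auto
          ultimately have "?h t ! (x - 1) = Poly_Mapping.lookup t x" by (simp only: nth_map)
          then show ?thesis using True by (simp only: lookup_sum_single[OF finite_atLeastAtMost] if_True)
        next
          case False
          then have "x \<notin> Poly_Mapping.keys t" using t by (auto simp: monomials_def)
          then show ?thesis using False
            by (simp only: lookup_sum_single[OF finite_atLeastAtMost] if_False in_keys_iff not_not)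
        qed
      qed
    qed
    show "\<forall>l\<in>?L. ?h (?g l) = l" using hg by blast
    show "?h ` monomials {1..m} n \<subseteq> ?L"
      using deg by (auto simp: monomials_def simp del: upt_Suc)
    show "?g ` ?L \<subseteq> monomials {1..m} n"
      unfolding monomials_def using deg[OF kg] hg kg by auto
  qed
  then have "card (monomials {1..m} n) = card ?L" by (rule bij_betw_same_card)
  also have "\<dots> = (n + m - 1) choose n" by (rule card_length_sum_list)
  also have "\<dots> = (n + m - 1) choose (m - 1)"
    using binomial_symmetric[of n "n + m - 1"] m by simp
  finally show ?thesis .
qed

lemma lookup_generic_form:
  "Poly_Mapping.lookup (generic_form m i) s =
    (\<Sum>j = 1..m. if Poly_Mapping.single j 1 = s then mpoly_var (i, j) else 0)"
  unfolding generic_form_def lookup_sum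
  by (intro sum.cong) (auto simp: mpoly_const_def[of "mpoly_var _"] mpoly_var_def[of "_ :: nat"]
      mult_single lookup_single when_def)

lemma lookup_linear_form:
  "Poly_Mapping.lookup (linear_form m \<alpha> i) s =
    (\<Sum>j = 1..m. if Poly_Mapping.single j 1 = s then \<alpha> (i, j) else 0)"
  unfolding linear_form_def lookup_sum
  by (intro sum.cong) (auto simp: mpoly_const_def mpoly_var_def mult_single lookup_single when_def)

lemma lookup_lift_coeffs:
  "Poly_Mapping.lookup (lift_coeffs p) s = mpoly_const (Poly_Mapping.lookup p s)"
  by (simp add: lift_coeffs_def map.rep_eq when_def mpoly_const_def)

text \<open>The element of \<open>k[x]\<close> whose coefficients form the given row once
  \<open>u\<close> is specialised to \<open>\<alpha>\<close>; see
  \<open>eval_at_M_entry\<close>.\<close>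

fun row_form :: "nat \<Rightarrow> (nat \<Rightarrow> (nat, 'k::comm_ring_1) mpoly) \<Rightarrow> (nat \<times> nat \<Rightarrow> 'k) \<Rightarrow> row_index \<Rightarrow> (nat, 'k) mpoly" where
  "row_form m f \<alpha> (Inl (i, g)) = linear_form m \<alpha> i * mpoly_mono g"
| "row_form m f \<alpha> (Inr (j, h)) = f j * mpoly_mono h"

lemma eval_at_sum: "eval_at a (\<Sum>i\<in>A. p i) = (\<Sum>i\<in>A. eval_at a (p i) :: 'k::comm_ring_1)"
  by (rule eval_at.hom_sum)

lemma eval_at_M_entry:
  "eval_at \<alpha> (M_entry m f r t) = Poly_Mapping.lookup (row_form m f \<alpha> r) t"
proof (cases "(m, f, r, t)" rule: M_entry.cases)
  case (1 m f i g t)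
  have "eval_at \<alpha> (Poly_Mapping.lookup (generic_form m i) s) = Poly_Mapping.lookup (linear_form m \<alpha> i) s" for s
    unfolding lookup_generic_form lookup_linear_form eval_at_sum
    by (intro sum.cong) (auto simp: eval_at.hom_zero)
  then show ?thesis using 1 by (simp add: mpoly_mono_def lookup_mult_single eval_at.hom_zero)
next
  case (2 m f j h t)
  then show ?thesis by (simp add: mpoly_mono_def lookup_mult_single lookup_lift_coeffs eval_at.hom_zero)
qed

lemma M_entry_closed:
  assumes "r \<in> M_rows m d v e n"
  shows "M_entry m f r t \<in> carrier (u_ring d m)"
proof (cases "(m, f, r, t)" rule: M_entry.cases)
  case (1 m' f' i g t')
  then have i: "i \<in> {1..d}" using assms by (auto simp: M_rows_def)
  have "Poly_Mapping.lookup (generic_form m i :: (nat, (nat \<times> nat, 'a) mpoly) mpoly) s \<in> carrier (u_ring d m)" for s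
    unfolding lookup_generic_form using i
    by (intro mpoly_sum_closed) (auto intro!: mpoly_var_closed mpoly_zero_closed)
  then show ?thesis using 1 by (simp add: mpoly_mono_def lookup_mult_single mpoly_zero_closed)
next
  case (2 m' f' j h t')
  then show ?thesis
    by (simp add: mpoly_mono_def lookup_mult_single lookup_lift_coeffs mpoly_const_closed mpoly_zero_closed)
qed

lemma det_closed:
  assumes "\<And>a b. a < N \<Longrightarrow> b < N \<Longrightarrow> M a b \<in> carrier (mpoly_ring X)"
  shows "Determinant.det (mat N N (\<lambda>(a, b). M a b)) \<in> carrier (mpoly_ring X :: ('v, 'k::comm_ring_1) mpoly ring)"
proof -
  have "of_int (sign p) \<in> carrier (mpoly_ring X :: ('v, 'k) mpoly ring)" for p :: "nat \<Rightarrow> nat"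
    by (simp add: sign_def mpoly_one_closed mpoly_uminus_closed)
  moreover have "(\<Prod>i = 0..<N. mat N N (\<lambda>(a, b). M a b) $$ (i, p i)) \<in> carrier (mpoly_ring X)"
    if "p permutes {0..<N}" for p
    using assms permutes_in_image[OF that] by (intro mpoly_prod_closed) auto
  ultimately show ?thesis
    by (subst det_def'[of _ N]) (auto intro!: mpoly_sum_closed mpoly_mult_closed)
qed

lemma matrix_minors_closed:
  "matrix_minors N (M_rows m d v e n) Cs (M_entry m f) \<subseteq> carrier (u_ring d m)"
  unfolding matrix_minors_def by (auto intro!: det_closed M_entry_closed)

lemma J_ideal_closed: "J_ideal m d v e f n \<subseteq> carrier (u_ring d m :: (nat \<times> nat, 'k::comm_ring_1) mpoly ring)"
proof -
  interpret U: cring "u_ring d m :: (nat \<times> nat, 'k) mpoly ring" by (rule mpoly_ring_cring)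
  interpret J: ideal "J_ideal m d v e f n" "u_ring d m :: (nat \<times> nat, 'k) mpoly ring"
    unfolding J_ideal_def by (rule U.genideal_ideal[OF matrix_minors_closed])
  show ?thesis by (rule J.a_subset)
qed

lemma J_ideal_vanishes_iff:
  "(\<forall>F\<in>J_ideal m d v e f n. eval_at \<alpha> F = (0 :: 'k::comm_ring_1)) \<longleftrightarrow>
   (\<forall>F\<in>matrix_minors ((n + m - 1) choose (m - 1)) (M_rows m d v e n) (monomials {1..m} n) (M_entry m f).
      eval_at \<alpha> F = 0)" (is "_ \<longleftrightarrow> (\<forall>F\<in>?S. _)")
proof -
  interpret U: cring "u_ring d m :: (nat \<times> nat, 'k) mpoly ring" by (rule mpoly_ring_cring)
  let ?K = "{F \<in> carrier (u_ring d m). eval_at \<alpha> F = 0}"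
  have K: "ideal ?K (u_ring d m)"
    by (rule U.idealI_cring)
      (auto simp: eval_at.hom_zero eval_at.hom_add eval_at.hom_mult mpoly_zero_closed mpoly_add_closed mpoly_mult_closed)
  have "J_ideal m d v e f n \<subseteq> ?K" if "\<forall>F\<in>?S. eval_at \<alpha> F = 0"
    unfolding J_ideal_def
    by (rule U.genideal_minimal[OF K]) (use that matrix_minors_closed in blast)
  moreover have "?S \<subseteq> J_ideal m d v e f n"
    unfolding J_ideal_def by (rule U.genideal_self[OF matrix_minors_closed])
  ultimately show ?thesis by blast
qed

lemma eval_at_minor:
  "eval_at \<alpha> (Determinant.det (mat N N (\<lambda>(a, b). M_entry m f (\<rho> a) (\<gamma> b)))) =
    Determinant.det (mat N N (\<lambda>(a, b). Poly_Mapping.lookup (row_form m f \<alpha> (\<rho> a)) (\<gamma> b)))"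
proof -
  have "map_mat (eval_at \<alpha>) (mat N N (\<lambda>(a, b). M_entry m f (\<rho> a) (\<gamma> b))) =
      mat N N (\<lambda>(a, b). Poly_Mapping.lookup (row_form m f \<alpha> (\<rho> a)) (\<gamma> b))"
    by (rule eq_matI) (auto simp: eval_at_M_entry)
  then show ?thesis using eval_at.hom_det[of \<alpha> "mat N N (\<lambda>(a, b). M_entry m f (\<rho> a) (\<gamma> b))"] by simp
qed

text \<open>A kernel vector is read as a linear functional \<open>l\<close> on forms that
  annihilates the chosen rows; \<open>\<gamma>\<close> only puts the columns in order.\<close>

lemma det_zero_iff_orthogonal:
  fixes w :: "nat \<Rightarrow> 's \<Rightarrow> 'k::field"
  assumes g: "bij_betw \<gamma> {..<N} S"
  shows "Determinant.det (mat N N (\<lambda>(a, b). w a (\<gamma> b))) = 0 \<longleftrightarrow>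
    (\<exists>l. (\<exists>s\<in>S. l s \<noteq> 0) \<and> (\<forall>a<N. (\<Sum>s\<in>S. l s * w a s) = 0))"
proof -
  let ?A = "mat N N (\<lambda>(a, b). w a (\<gamma> b))"
  have mv: "(?A *\<^sub>v v) $ a = (\<Sum>b<N. w a (\<gamma> b) * v $ b)" if "a < N" "v \<in> carrier_vec N" for a v
    using that by (simp add: scalar_prod_def row_def atLeast0LessThan)
  have reindex: "(\<Sum>s\<in>S. l s * w a s) = (\<Sum>b<N. w a (\<gamma> b) * l (\<gamma> b))" for l a
    using sum.reindex_bij_betw[OF g, of "\<lambda>s. l s * w a s"] by (simp add: mult.commute)
  have iff: "Determinant.det ?A = 0 \<longleftrightarrow> (\<exists>v. v \<in> carrier_vec N \<and> v \<noteq> 0\<^sub>v N \<and> ?A *\<^sub>v v = 0\<^sub>v N)"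
    by (rule det_0_iff_vec_prod_zero) simp
  show ?thesis
    unfolding iff
  proof
    assume "\<exists>v. v \<in> carrier_vec N \<and> v \<noteq> 0\<^sub>v N \<and> ?A *\<^sub>v v = 0\<^sub>v N"
    then obtain v where v: "v \<in> carrier_vec N" "v \<noteq> 0\<^sub>v N" "?A *\<^sub>v v = 0\<^sub>v N" by blast
    define l where "l s = v $ (the_inv_into {..<N} \<gamma> s)" for s
    have lg: "l (\<gamma> b) = v $ b" if "b < N" for b
      using that g by (simp add: l_def the_inv_into_f_f bij_betw_def)
    have "\<exists>b<N. v $ b \<noteq> 0"
    proof (rule ccontr)
      assume "\<not> ?thesis"
      then have "v = 0\<^sub>v N" using v(1) by (intro eq_vecI) auto
      then show False using v(2) by blast
    qed
    then obtain b where "b < N" "v $ b \<noteq> 0" by blast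
    then have "\<exists>s\<in>S. l s \<noteq> 0" using lg g by (intro bexI[of _ "\<gamma> b"]) (auto simp: bij_betw_def)
    moreover have "(\<Sum>s\<in>S. l s * w a s) = 0" if "a < N" for a
    proof -
      have "(\<Sum>s\<in>S. l s * w a s) = (\<Sum>b<N. w a (\<gamma> b) * v $ b)"
        unfolding reindex by (intro sum.cong) (simp_all add: lg)
      also have "\<dots> = 0" using mv[OF that v(1)] v(3) that by simp
      finally show ?thesis .
    qed
    ultimately show "\<exists>l. (\<exists>s\<in>S. l s \<noteq> 0) \<and> (\<forall>a<N. (\<Sum>s\<in>S. l s * w a s) = 0)" by blast
  next
    assume "\<exists>l. (\<exists>s\<in>S. l s \<noteq> 0) \<and> (\<forall>a<N. (\<Sum>s\<in>S. l s * w a s) = 0)"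
    then obtain l where l: "\<exists>s\<in>S. l s \<noteq> 0" "\<forall>a<N. (\<Sum>s\<in>S. l s * w a s) = 0" by blast
    let ?v = "vec N (\<lambda>b. l (\<gamma> b))"
    obtain s where s: "s \<in> S" "l s \<noteq> 0" using l(1) by blast
    then obtain b where b: "b < N" "s = \<gamma> b" using g by (auto simp: bij_betw_def)
    then have "?v $ b \<noteq> 0\<^sub>v N $ b" using s(2) by simp
    then have "?v \<noteq> 0\<^sub>v N" by auto
    moreover have "?A *\<^sub>v ?v = 0\<^sub>v N"
    proof (rule eq_vecI)
      fix a assume "a < dim_vec (0\<^sub>v N)"
      then have a: "a < N" by simp
      have "(?A *\<^sub>v ?v) $ a = (\<Sum>b<N. w a (\<gamma> b) * ?v $ b)" by (rule mv[OF a]) simp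
      also have "\<dots> = (\<Sum>s\<in>S. l s * w a s)" unfolding reindex by (intro sum.cong) simp_all
      finally show "(?A *\<^sub>v ?v) $ a = 0\<^sub>v N $ a" using l(2) a by simp
    qed simp
    ultimately show "\<exists>v. v \<in> carrier_vec N \<and> v \<noteq> 0\<^sub>v N \<and> ?A *\<^sub>v v = 0\<^sub>v N"
      by (intro exI[of _ ?v]) simp
  qed
qed

section \<open>The rank of the specialised matrix\<close>

context homogeneous_presentation
begin

lemma row_form_in:
  assumes "r \<in> M_rows m d v e n"
  shows "row_form m f \<alpha> r \<in> forms {1..m} n" "row_form m f \<alpha> r \<in> gen d (linear_form m \<alpha>)"
proof -
  have lc: "linear_form m \<alpha> i \<in> carrier (x_ring m)" for i
    using linear_form_forms forms_subset_carrier by blast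
  have "row_form m f \<alpha> r \<in> forms {1..m} n \<and> row_form m f \<alpha> r \<in> gen d (linear_form m \<alpha>)"
  proof (cases r)
    case (Inl p)
    then obtain i g where r: "r = Inl (i, g)" by (cases p) simp
    then have ig: "i \<in> {1..d}" "1 \<le> n" "g \<in> monomials {1..m} (n - 1)"
      using assms by (auto simp: M_rows_def)
    have "mpoly_mono g \<in> carrier (x_ring m)"
      using ig(3) by (auto simp: monomials_def intro!: mpoly_mono_closed)
    then have "mpoly_mono g * linear_form m \<alpha> i \<in> gen d (linear_form m \<alpha>)"
      using ig(1) lc by (intro gen_mult gen_self)
    moreover have "linear_form m \<alpha> i * mpoly_mono g \<in> forms {1..m} (1 + (n - 1))"
      by (rule forms_mult[OF linear_form_forms forms_mono[OF ig(3)]])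
    ultimately show ?thesis using ig(2) by (simp add: r mult.commute)
  next
    case (Inr p)
    then obtain j h where r: "r = Inr (j, h)" by (cases p) simp
    then have jh: "j \<in> {1..v}" "e j \<le> n" "h \<in> monomials {1..m} (n - e j)"
      using assms by (auto simp: M_rows_def)
    have "f j \<in> I" unfolding I_gen using jh(1) f_closed by (intro R.genideal_self[THEN subsetD]) auto
    moreover have "mpoly_mono h \<in> carrier (x_ring m)"
      using jh(3) by (auto simp: monomials_def intro!: mpoly_mono_closed)
    ultimately have "mpoly_mono h * f j \<in> gen d (linear_form m \<alpha>)" by (intro gen_I I_mult)
    moreover have "f j * mpoly_mono h \<in> forms {1..m} (e j + (n - e j))"
      by (rule forms_mult[OF f_forms[OF jh(1)] forms_mono[OF jh(3)]])
    ultimately show ?thesis using jh(2) by (simp add: r mult.commute)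
  qed
  then show "row_form m f \<alpha> r \<in> forms {1..m} n" "row_form m f \<alpha> r \<in> gen d (linear_form m \<alpha>)" by auto
qed

text \<open>If \<open>Q_n\<close> is smaller than \<open>A_n\<close>, the coefficient vectors of the
  forms of degree \<open>n\<close> in \<open>gen\<close> make up a proper subspace. A nonzero
  functional vanishing on it annihilates every row.\<close>

lemma not_covers_minor_zero:
  assumes nc: "\<not> covers d (linear_form m \<alpha>) n"
    and \<rho>: "\<rho> ` {..<N} \<subseteq> M_rows m d v e n" and \<gamma>: "bij_betw \<gamma> {..<N} (monomials {1..m} n)"
  shows "Determinant.det (mat N N (\<lambda>(a, b). Poly_Mapping.lookup (row_form m f \<alpha> (\<rho> a)) (\<gamma> b))) = 0"
proof -
  let ?S = "monomials {1..m} n"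
  let ?y = "linear_form m \<alpha>"
  let ?p = "\<lambda>c. \<Sum>t\<in>?S. mpoly_const (c t) * mpoly_mono t :: (nat, 'k) mpoly"
  have S: "finite ?S" by (rule finite_monomials) simp
  define C where "C = {c :: nat monom \<Rightarrow> 'k. (\<forall>t. t \<notin> ?S \<longrightarrow> c t = 0) \<and> ?p c \<in> gen d ?y}"
  have "\<exists>T\<subseteq>?S. \<exists>b. (\<forall>t\<in>T. b t \<in> C) \<and> (\<forall>u\<in>C. \<exists>c. u = (\<lambda>s. \<Sum>t\<in>T. c t * b t s)) \<and>
    (T = ?S \<longrightarrow> C = {u. \<forall>s. s \<notin> ?S \<longrightarrow> u s = 0})"
  proof (rule coordinate_subspace_spanned[OF S])
    show "(\<lambda>_. 0) \<in> C" by (simp add: C_def gen_I I_zero)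
    show "u s = 0" if "u \<in> C" "s \<notin> ?S" for u s using that unfolding C_def by blast
    fix u v a assume u: "u \<in> C" and v: "v \<in> C"
    have "?p (\<lambda>s. u s + a * v s) = ?p u + mpoly_const a * ?p v"
      by (simp add: mpoly_const_add mpoly_const_mult distrib_right sum.distrib sum_distrib_left mult.assoc)
    also have "\<dots> \<in> gen d ?y"
      using u v by (intro gen_add gen_mult mpoly_const_closed) (simp_all add: C_def)
    finally show "(\<lambda>s. u s + a * v s) \<in> C" using u v by (simp add: C_def)
  qed
  then obtain T b where T: "T \<subseteq> ?S"
    and span: "\<forall>u\<in>C. \<exists>c. u = (\<lambda>s. \<Sum>t\<in>T. c t * b t s)"
    and full: "T = ?S \<longrightarrow> C = {u. \<forall>s. s \<notin> ?S \<longrightarrow> u s = 0}"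
    by (elim exE conjE)
  have coeff: "Poly_Mapping.lookup p \<in> C" if "p \<in> forms {1..m} n" "p \<in> gen d ?y" for p
    unfolding C_def mem_Collect_eq
  proof
    show "\<forall>t. t \<notin> ?S \<longrightarrow> Poly_Mapping.lookup p t = 0" using that(1) by (auto simp: forms_def in_keys_iff)
    show "?p (Poly_Mapping.lookup p) \<in> gen d ?y" using forms_eq_sum[OF that(1)] that(2) by simp
  qed
  \<comment> \<open>If every coordinate were a pivot, all forms of degree \<open>n\<close> would lie
    in \<open>gen\<close>.\<close>
  have "T \<noteq> ?S"
  proof
    assume "T = ?S"
    then have all: "C = {u. \<forall>s. s \<notin> ?S \<longrightarrow> u s = 0}" using full by (rule mp[rotated])
    have "p \<in> gen d ?y" if p: "p \<in> forms {1..m} n" for p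
    proof -
      have "Poly_Mapping.lookup p \<in> C" unfolding all using p by (auto simp: forms_def in_keys_iff)
      then have "?p (Poly_Mapping.lookup p) \<in> gen d ?y" unfolding C_def by blast
      then show ?thesis using forms_eq_sum[OF p] by simp
    qed
    then show False using nc unfolding covers_def by blast
  qed
  then have "card T < card ?S" using T S by (intro psubset_card_mono) auto
  from underdetermined_system[OF S finite_subset[OF T S] this, of b]
  obtain l where l: "\<exists>s\<in>?S. l s \<noteq> 0" "\<forall>t\<in>T. (\<Sum>s\<in>?S. l s * b t s) = 0" by (elim exE conjE)
  have orth: "(\<Sum>s\<in>?S. l s * u s) = 0" if u: "u \<in> C" for u
  proof -
    from bspec[OF span u] obtain c where c: "u = (\<lambda>s. \<Sum>t\<in>T. c t * b t s)" by (rule exE)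
    have "(\<Sum>s\<in>?S. l s * u s) = (\<Sum>s\<in>?S. \<Sum>t\<in>T. c t * (l s * b t s))"
      unfolding c sum_distrib_left by (intro sum.cong refl) (simp only: mult_ac)
    also have "\<dots> = (\<Sum>t\<in>T. \<Sum>s\<in>?S. c t * (l s * b t s))" by (rule sum.swap)
    also have "\<dots> = (\<Sum>t\<in>T. c t * (\<Sum>s\<in>?S. l s * b t s))" by (simp only: sum_distrib_left)
    also have "\<dots> = 0" using l(2) by simp
    finally show ?thesis .
  qed
  have "(\<Sum>s\<in>?S. l s * Poly_Mapping.lookup (row_form m f \<alpha> (\<rho> a)) s) = 0" if "a < N" for a
  proof -
    have "\<rho> a \<in> M_rows m d v e n" using \<rho> that by auto
    then show ?thesis by (intro orth coeff row_form_in)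
  qed
  then show ?thesis unfolding det_zero_iff_orthogonal[OF \<gamma>, of "\<lambda>a. Poly_Mapping.lookup (row_form m f \<alpha> (\<rho> a))"]
    using l(1) by (intro exI[of _ l] conjI allI impI)
qed

text \<open>A form of degree \<open>n\<close> in \<open>gen\<close> is a linear combination of the
  rows, because its multipliers can be cut down to the degrees that occur in \<open>M_rows\<close>.
  A functional annihilating the rows therefore vanishes on all monomials of degree
  \<open>n\<close>.\<close>

lemma covers_orthogonal_zero:
  assumes cov: "covers d (linear_form m \<alpha>) n" and n: "1 \<le> n"
    and orth: "\<forall>r\<in>M_rows m d v e n. (\<Sum>t\<in>monomials {1..m} n. l t * Poly_Mapping.lookup (row_form m f \<alpha> r) t) = 0"
    and t: "t \<in> monomials {1..m} n"
  shows "l t = 0"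
proof -
  let ?S = "monomials {1..m} n"
  let ?y = "linear_form m \<alpha>"
  have S: "finite ?S" by (rule finite_monomials) simp
  define \<Lambda> where "\<Lambda> p = (\<Sum>t\<in>?S. l t * Poly_Mapping.lookup p t)" for p
  have L_add: "\<Lambda> (p + q) = \<Lambda> p + \<Lambda> q" for p q
    by (simp add: \<Lambda>_def lookup_add distrib_left sum.distrib)
  have L_zero: "\<Lambda> 0 = 0" by (simp add: \<Lambda>_def)
  have L_sum: "\<Lambda> (\<Sum>i\<in>A. p i) = (\<Sum>i\<in>A. \<Lambda> (p i))" for A :: "'z set" and p
    by (induction A rule: infinite_finite_induct) (simp_all add: L_add L_zero)
  have L_const: "\<Lambda> (p * mpoly_const c) = \<Lambda> p * c" for p c
    by (simp add: \<Lambda>_def mpoly_const_def lookup_mult_single sum_distrib_right mult.assoc)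
  have L_row: "\<Lambda> (row_form m f \<alpha> r) = 0" if "r \<in> M_rows m d v e n" for r
    using orth that by (simp add: \<Lambda>_def)
  have L_mult: "\<Lambda> (p * q) = 0" if q: "q \<in> forms {1..m} k"
    and rows: "\<And>g. g \<in> monomials {1..m} k \<Longrightarrow> \<Lambda> (p * mpoly_mono g) = 0" for p q k
  proof -
    have "p * q = p * (\<Sum>g\<in>monomials {1..m} k. mpoly_const (Poly_Mapping.lookup q g) * mpoly_mono g)"
      using forms_eq_sum[OF q] by simp
    also have "\<dots> = (\<Sum>g\<in>monomials {1..m} k. (p * mpoly_mono g) * mpoly_const (Poly_Mapping.lookup q g))"
      by (simp add: sum_distrib_left mult_ac)
    finally show ?thesis by (simp add: L_sum L_const rows)
  qed
  obtain n' where n': "n = Suc n'" using n by (cases n) auto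
  let ?p = "mpoly_mono t :: (nat, 'k) mpoly"
  have p: "?p \<in> forms {1..m} n" by (rule forms_mono[OF t])
  have pg: "?p \<in> gen d ?y" using cov p unfolding covers_def by blast
  obtain q where q: "\<forall>i. q i \<in> forms {1..m} n'" "?p - (\<Sum>i\<in>{1..d}. ?y i * q i) \<in> I"
    by (rule gen_homogeneous[OF linear_form_forms pg p[unfolded n']])
  obtain s where s: "\<forall>j. s j \<in> carrier (x_ring m)" "?p - (\<Sum>i\<in>{1..d}. ?y i * q i) = (\<Sum>j\<in>{1..v}. f j * s j)"
    using q(2) unfolding I_iff by (elim exE conjE)
  \<comment> \<open>Only the component of degree \<open>n - e j\<close> contributes. The default
    \<open>0\<close> is right because \<open>f j\<close> has no multiple of degree \<open>n\<close>,
    and no row, when \<open>e j > n\<close>.\<close>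
  define s' where "s' j = (if e j \<le> n then hcomp (n - e j) (s j) else 0)" for j
  have qf: "(\<Sum>i\<in>{1..d}. ?y i * q i) \<in> forms {1..m} n"
  proof (rule forms_sum)
    fix i
    have "?y i * q i \<in> forms {1..m} (1 + n')" using q(1) by (intro forms_mult linear_form_forms) blast
    then show "?y i * q i \<in> forms {1..m} n" unfolding n' by (simp only: One_nat_def add_Suc add_0)
  qed
  have "hcomp n (?p - (\<Sum>i\<in>{1..d}. ?y i * q i)) = ?p - (\<Sum>i\<in>{1..d}. ?y i * q i)"
    using hcomp_form[OF p, of n] hcomp_form[OF qf, of n] by (simp add: hcomp_diff)
  moreover have "hcomp n (\<Sum>j\<in>{1..v}. f j * s j) = (\<Sum>j\<in>{1..v}. f j * s' j)"
    unfolding hcomp_sum by (intro sum.cong) (simp_all add: hcomp_mult_form[OF f_forms] s'_def)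
  ultimately have "?p - (\<Sum>i\<in>{1..d}. ?y i * q i) = (\<Sum>j\<in>{1..v}. f j * s' j)" using s(2) by simp
  then have peq: "?p = (\<Sum>i\<in>{1..d}. ?y i * q i) + (\<Sum>j\<in>{1..v}. f j * s' j)" by (simp add: algebra_simps)
  have "\<Lambda> (?y i * q i) = 0" if i: "i \<in> {1..d}" for i
  proof (rule L_mult)
    show "q i \<in> forms {1..m} n'" using q(1) by blast
    fix g assume "g \<in> monomials {1..m} n'"
    then have "Inl (i, g) \<in> M_rows m d v e n" using i n by (simp add: M_rows_def n')
    from L_row[OF this] show "\<Lambda> (?y i * mpoly_mono g) = 0" by simp
  qed
  moreover have "\<Lambda> (f j * s' j) = 0" if j: "j \<in> {1..v}" for j
  proof (cases "e j \<le> n")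
    case True
    show ?thesis
    proof (rule L_mult)
      show "s' j \<in> forms {1..m} (n - e j)" using s(1) True by (simp add: s'_def hcomp_in_forms)
      fix g assume "g \<in> monomials {1..m} (n - e j)"
      then have "Inr (j, g) \<in> M_rows m d v e n" using j True by (simp add: M_rows_def)
      from L_row[OF this] show "\<Lambda> (f j * mpoly_mono g) = 0" by simp
    qed
  qed (simp add: s'_def L_zero)
  ultimately have "\<Lambda> ?p = 0" by (subst peq) (simp add: L_add L_sum)
  moreover have "\<Lambda> ?p = (\<Sum>u\<in>?S. if u = t then l t else 0)"
    unfolding \<Lambda>_def by (intro sum.cong) (auto simp: mpoly_mono_def lookup_single when_def)
  ultimately show ?thesis using S t by simp
qed

text \<open>As minors use all columns, one of them is nonzero exactly if only the zero functional
  annihilates all rows. Too few rows are no exception: there are no minors then, and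
  \<open>Q_n = A_n\<close> fails.\<close>

lemma covers_iff_J_ideal:
  assumes m: "1 \<le> m" and n: "1 \<le> n"
  shows "covers d (linear_form m \<alpha>) n \<longleftrightarrow> \<not> (\<forall>F\<in>J_ideal m d v e f n. eval_at \<alpha> F = 0)"
proof -
  let ?S = "monomials {1..m} n"
  let ?N = "(n + m - 1) choose (m - 1)"
  let ?R = "M_rows m d v e n"
  let ?w = "\<lambda>r. Poly_Mapping.lookup (row_form m f \<alpha> r)"
  have S: "finite ?S" by (rule finite_monomials) simp
  have N: "card ?S = ?N" by (rule card_monomials[OF m])
  have "\<forall>F\<in>matrix_minors ?N ?R ?S (M_entry m f). eval_at \<alpha> F = 0" if nc: "\<not> covers d (linear_form m \<alpha>) n"
  proof
    fix F assume "F \<in> matrix_minors ?N ?R ?S (M_entry m f)"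
    then obtain \<rho> \<gamma> where F: "F = Determinant.det (mat ?N ?N (\<lambda>(a, b). M_entry m f (\<rho> a) (\<gamma> b)))"
      and \<rho>: "\<rho> ` {..<?N} \<subseteq> ?R" and \<gamma>: "inj_on \<gamma> {..<?N}" "\<gamma> ` {..<?N} \<subseteq> ?S"
      unfolding matrix_minors_def by (elim CollectE exE conjE)
    have "card (\<gamma> ` {..<?N}) = card ?S" using N card_image[OF \<gamma>(1)] by simp
    then have "\<gamma> ` {..<?N} = ?S" by (rule card_subset_eq[OF S \<gamma>(2)])
    then have "bij_betw \<gamma> {..<?N} ?S" using \<gamma>(1) by (simp add: bij_betw_def)
    then show "eval_at \<alpha> F = 0" unfolding F eval_at_minor by (rule not_covers_minor_zero[OF nc \<rho>])
  qed
  moreover have "\<exists>F\<in>matrix_minors ?N ?R ?S (M_entry m f). eval_at \<alpha> F \<noteq> 0"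
    if cov: "covers d (linear_form m \<alpha>) n"
  proof -
    from select_rows[OF S, of ?R ?w] obtain R0 where R0: "R0 \<subseteq> ?R" "finite R0" "card R0 \<le> card ?S"
      "\<forall>l. (\<forall>r\<in>R0. (\<Sum>s\<in>?S. l s * ?w r s) = 0) \<longrightarrow> (\<forall>r\<in>?R. (\<Sum>s\<in>?S. l s * ?w r s) = 0)"
      by (elim exE conjE)
    have inj: "\<forall>s\<in>?S. l s = 0" if "\<forall>r\<in>R0. (\<Sum>s\<in>?S. l s * ?w r s) = 0" for l
      using R0(4)[rule_format, of l] that covers_orthogonal_zero[OF cov n, of l] by blast
    \<comment> \<open>The selected rows have trivial common kernel, so they are at least as many as
      the columns; by their choice they are not more.\<close>
    have "\<not> card R0 < card ?S"
    proof
      assume "card R0 < card ?S"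
      from underdetermined_system[OF S R0(2) this, of ?w] show False using inj by blast
    qed
    then have cR: "card R0 = ?N" using R0(3) N by simp
    obtain \<rho> where \<rho>: "bij_betw \<rho> {..<?N} R0"
      using ex_bij_betw_nat_finite[OF R0(2)] unfolding cR atLeast0LessThan by (rule exE)
    obtain \<gamma> where \<gamma>: "bij_betw \<gamma> {..<?N} ?S"
      using ex_bij_betw_nat_finite[OF S] unfolding N atLeast0LessThan by (rule exE)
    let ?F = "Determinant.det (mat ?N ?N (\<lambda>(a, b). M_entry m f (\<rho> a) (\<gamma> b)))"
    have "?F \<in> matrix_minors ?N ?R ?S (M_entry m f)"
      unfolding matrix_minors_def using \<rho> \<gamma> R0(1)
      by (intro CollectI exI[of _ \<rho>] exI[of _ \<gamma>]) (auto simp: bij_betw_def)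
    moreover have "eval_at \<alpha> ?F \<noteq> 0"
    proof
      assume "eval_at \<alpha> ?F = 0"
      then have "Determinant.det (mat ?N ?N (\<lambda>(a, b). ?w (\<rho> a) (\<gamma> b))) = 0"
        unfolding eval_at_minor .
      then obtain l where l: "\<exists>s\<in>?S. l s \<noteq> 0" "\<forall>a<?N. (\<Sum>s\<in>?S. l s * ?w (\<rho> a) s) = 0"
        unfolding det_zero_iff_orthogonal[OF \<gamma>, of "\<lambda>a. ?w (\<rho> a)"] by (elim exE conjE)
      have "\<forall>r\<in>R0. (\<Sum>s\<in>?S. l s * ?w r s) = 0"
      proof
        fix r assume "r \<in> R0"
        then obtain a where "a < ?N" "r = \<rho> a" using \<rho> by (auto simp: bij_betw_def)
        then show "(\<Sum>s\<in>?S. l s * ?w r s) = 0" using l(2) by blast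
      qed
      from inj[OF this] show False using l(1) by blast
    qed
    ultimately show ?thesis by (rule bexI[rotated])
  qed
  ultimately show ?thesis unfolding J_ideal_vanishes_iff by blast
qed

text \<open>The parameter of a reduction lies outside \<open>Z n\<close> for some large
  \<open>n\<close>, hence outside the stable locus \<open>Z n0\<close>, which bounds the reduction
  number by \<open>n0\<close>. The index \<open>n + 1\<close> matches the definition of the
  reduction number and avoids degree 0.\<close>

lemma reduction_numbers_bounded:
  assumes m: "1 \<le> m"
  shows "\<exists>b. \<forall>Q. is_reduction m I Q \<longrightarrow> reduction_number m I Q \<le> b"
proof -
  define Z where "Z n = {\<beta>. \<forall>F\<in>J_ideal m m v e f (n + 1). eval_at \<beta> F = 0}" for n
  have Z: "\<beta> \<in> Z n \<longleftrightarrow> \<not> covers m (linear_form m \<beta>) (n + 1)" for \<beta> n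
    using covers_iff_J_ideal[OF m, of "n + 1" m \<beta>] by (simp add: Z_def)
  have "\<exists>n0. \<forall>n\<ge>n0. Z n = Z n0"
  proof (rule zero_loci_stabilise)
    show "finite (u_index m m)" by simp
    show "J_ideal m m v e f (n + 1) \<subseteq> carrier (u_ring m m)" for n by (rule J_ideal_closed)
    show "Z n = {\<beta>. \<forall>F\<in>J_ideal m m v e f (n + 1). eval_at \<beta> F = 0}" for n by (rule Z_def)
    show "Z (Suc n) \<subseteq> Z n" for n
      using Z covers_Suc[of m _ "n + 1"] by auto
  qed
  then obtain n0 where n0: "\<forall>n\<ge>n0. Z n = Z n0" by (rule exE)
  have "reduction_number m I Q \<le> n0" if Q: "is_reduction m I Q" for Q
  proof -
    from reduction_parametrisation[OF Q] obtain \<beta> where \<beta>: "Q = residue_class m I ` gen m (linear_form m \<beta>)"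
      by (rule exE)
    have "\<exists>n. covers m (linear_form m \<beta>) n"
      using Q unfolding \<beta> gen_reduction[OF linear_form_forms] .
    then obtain n where n: "covers m (linear_form m \<beta>) n" by (rule exE)
    have "covers m (linear_form m \<beta>) (max n n0 + 1)" by (rule covers_mono[OF n]) simp
    then have "\<beta> \<notin> Z (max n n0)" using Z by blast
    then have "\<beta> \<notin> Z n0" using n0[rule_format, of "max n n0"] by simp
    then have "covers m (linear_form m \<beta>) (n0 + 1)" using Z by blast
    then show ?thesis unfolding \<beta> reduction_number_gen by (rule Least_le)
  qed
  then show ?thesis by blast
qed

text \<open>If some degree is covered, \<open>(y)\<close> is a minimal reduction, so its reduction
  number is at most \<open>br(A)\<close> and the degree \<open>br(A) + 1\<close> is covered by
  monotonicity. The converse needs just one covered degree.\<close>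

lemma noether_normalization_iff_covers_big_reduction_number:
  assumes dim: "krull_dim (quot_alg m I) = enat d" "1 \<le> d" and m: "1 \<le> m"
  shows "noether_normalization (quot_alg m I) res_const {1..d} (\<lambda>i. residue_class m I (linear_form m \<alpha> i)) \<longleftrightarrow>
    covers d (linear_form m \<alpha>) (big_reduction_number m I + 1)"
proof -
  have "covers d (linear_form m \<alpha>) (big_reduction_number m I + 1)" if n: "covers d (linear_form m \<alpha>) n" for n
  proof -
    let ?Q = "residue_class m I ` gen d (linear_form m \<alpha>)"
    let ?rs = "{reduction_number m I Q | Q. is_minimal_reduction m I Q}"
    obtain b where b: "\<forall>Q. is_reduction m I Q \<longrightarrow> reduction_number m I Q \<le> b"
      using reduction_numbers_bounded[OF m] by (rule exE)
    have "?rs \<subseteq> {..b}" using b by (auto simp: is_minimal_reduction_def)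
    \<comment> \<open>Finiteness is what makes the \<open>Max\<close> in \<open>br(A)\<close> an
      upper bound.\<close>
    then have "finite ?rs" using finite_subset by blast
    moreover have "reduction_number m I ?Q \<in> ?rs"
      using minimal_reduction[OF dim linear_form_forms n] by blast
    ultimately have le: "reduction_number m I ?Q \<le> big_reduction_number m I"
      unfolding big_reduction_number_def by (rule Max_ge)
    have "covers d (linear_form m \<alpha>) (n + 1)" by (rule covers_mono[OF n]) simp
    then have "covers d (linear_form m \<alpha>) (reduction_number m I ?Q + 1)"
      unfolding reduction_number_gen by (rule LeastI)
    then show ?thesis by (rule covers_mono) (use le in simp)
  qed
  then show ?thesis
    unfolding noether_normalization_iff_covers[OF dim linear_form_forms] by blast
qed

end

theorem corollary2p4:
  fixes I :: "(nat, 'k::field) mpoly set"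
    and m d v :: nat
    and f :: "nat \<Rightarrow> (nat, 'k) mpoly"
    and e :: "nat \<Rightarrow> nat"
    and P :: "(nat \<times> nat \<Rightarrow> 'k) set"
    and \<alpha> :: "nat \<times> nat \<Rightarrow> 'k"
  assumes "infinite (UNIV :: 'k set)"
    and "homogeneous_ideal m I"
    and "I \<noteq> carrier (x_ring m)"
    and "\<forall>j\<in>{1..v}. f j \<in> forms {1..m} (e j)"
    and "I = genideal (x_ring m) (f ` {1..v})"
    and "krull_dim (quot_alg m I) = enat d"
    and "P \<in> proj_space (u_index d m)"
    and "\<alpha> \<in> P"
  shows "noether_normalization (quot_alg m I) (\<lambda>c. residue_class m I (mpoly_const c)) {1..d}
           (\<lambda>i. residue_class m I (linear_form m \<alpha> i))
     \<longleftrightarrow> P \<notin> V_variety m d v e f (big_reduction_number m I + 1)"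
proof -
  interpret homogeneous_presentation m v e f I
  proof
    show "f j \<in> forms {1..m} (e j)" if "j \<in> {1..v}" for j using assms(4) that by (rule bspec)
  qed (rule assms(5), rule assms(3))
  let ?n = "big_reduction_number m I + 1"
  obtain \<beta>0 where \<beta>0: "\<beta>0 \<in> coord_vectors (u_index d m)" and P: "P = proportional (u_index d m) `` {\<beta>0}"
    using assms(7) unfolding proj_space_def by (rule quotientE)
  \<comment> \<open>Projective space has a point only if there is at least one coordinate, which
    rules out \<open>d = 0\<close> and \<open>m = 0\<close>.\<close>
  obtain x where "x \<in> u_index d m" using \<beta>0 unfolding coord_vectors_def by blast
  then have d: "1 \<le> d" and m: "1 \<le> m" by auto
  \<comment> \<open>\<open>V_variety\<close> quantifies over all representatives of
    \<open>P\<close>, whereas the forms \<open>y_i\<close> use the single representative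
    \<open>\<alpha>\<close>.\<close>
  have same: "gen d (linear_form m \<beta>) = gen d (linear_form m \<beta>0)" if "\<beta> \<in> P" for \<beta>
  proof -
    from that obtain c where "c \<noteq> 0" "\<beta> = (\<lambda>x. c * \<beta>0 x)"
      by (auto simp: P proportional_def)
    then show ?thesis by (rule gen_proportional)
  qed
  have cov: "covers d (linear_form m \<beta>) ?n \<longleftrightarrow> covers d (linear_form m \<alpha>) ?n" if "\<beta> \<in> P" for \<beta>
    unfolding covers_def same[OF that] same[OF assms(8)] ..
  have "P \<in> V_variety m d v e f ?n \<longleftrightarrow> (\<forall>\<beta>\<in>P. \<not> covers d (linear_form m \<beta>) ?n)"
    using assms(7) covers_iff_J_ideal[OF m, of ?n d] by (simp add: V_variety_def)
  also have "\<dots> \<longleftrightarrow> \<not> covers d (linear_form m \<alpha>) ?n" using cov assms(8) by blast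
  finally show ?thesis
    unfolding noether_normalization_iff_covers_big_reduction_number[OF assms(6) d m] by blast
qed

end
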